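(* Let $u\in Lip(\Omega)$ be a vanishing viscosity solution in $\Omega$ of the equation $$X_{1,u}\left(\frac{X_{1,u}u}{\sqrt{1+|X_{1,u}u|^2}}\right)=0 .$$ Then for every integer $k>0$ and every $\alpha\in(0,1)$, $$X_{1,u}^k u\in C^{\alpha}_{loc}(\Omega).$$
   Context: Setting. $\Omega\subset\mathbb R^2$ is an open set. $\sigma_1^1,\sigma_1^2:\mathbb R^3\to\mathbb R$ are fixed $C^\infty$ functions, $\sigma_2^j:=\partial_{x_3}\sigma_1^j$ ($j=1,2$), and it is assumed that $|\sigma_1^1\,\partial_{x_3}\sigma_1^2-\sigma_1^2\,\partial_{x_3}\sigma_1^1|>0$ at every point of $\mathbb R^3$. (These are the components along $\partial_{x_1},\partial_{x_2}$ of vector fields $X_1$ and $X_2=[X_3,X_1]$ on $\mathbb R^3$, where $X_3=\partial_{x_3}$.) For a function $u:\Omega\to\mathbb R$ and $\epsilon>0$ define the vector fields on $\Omega$ $$X_{1,u}=\sum_{j=1}^2\sigma_1^j(x_1,x_2,u(x_1,x_2))\partial_{x_j},\quad Y_u=\sum_{j=1}^2\sigma_2^j(x_1,x_2,u(x_1,x_2))\partial_{x_j},\quad X_{2,u}=\epsilon Y_u,$$ and $\nabla_\epsilon=(X_{1,u},X_{2,u})$. Define $$L_{\epsilon,u}u=\sum_{i=1}^2X_{i,u}\left(\frac{X_{i,u}u}{\sqrt{1+|\nabla_\epsilon u|^2}}\right).$$ Vanishing viscosity solution: $u\in Lip(\Omega)$ is a vanishing viscosity solution of the equation $$X_{1,u}\left(\frac{X_{1,u}u}{\sqrt{1+|X_{1,u}u|^2}}\right)=0$$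 if there exist $\epsilon_n>0$ with $\epsilon_n\to0$ and $u_n\in C^\infty(\Omega)$ such that (1) $L_{\epsilon_n,u_n}u_n=0$ in $\Omega$ for all $n$; (2) there is $l>0$ with $\|u_n\|_{Lip(\Omega)}\le l$ for all $n$, and $u_n\to u$ uniformly on compact subsets of $\Omega$. $X_{1,u}^ku$ denotes the $k$-fold iterated derivative of $u$ along $X_{1,u}$, understood in the weak sense. $C^\alpha_{loc}(\Omega)$ is the space of functions locally (Euclidean) H\"older continuous of order $\alpha$. *)

theory Defs
  imports "HOL-Analysis.Analysis"
begin

text \<open>Points of the plane and of 3-space are \<open>real^2\<close> and \<open>real^3\<close>. The pair of components
  $\sigma_1^1, \sigma_1^2$ is one family \<open>\<sigma> :: 2 \<Rightarrow> real^3 \<Rightarrow> real\<close>, indexed by \<open>j :: 2\<close>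
  (the indices are \<open>1\<close> and \<open>2\<close>). A function on \<open>\<Omega>\<close> is a total function whose
  values outside \<open>\<Omega>\<close> play no role.\<close>

section \<open>Function spaces\<close>

fun Ck_on :: "nat \<Rightarrow> 'a::euclidean_space set \<Rightarrow> ('a \<Rightarrow> real) \<Rightarrow> bool" where
  "Ck_on 0 S f \<longleftrightarrow> continuous_on S f"
| "Ck_on (Suc k) S f \<longleftrightarrow> (\<forall>x\<in>S. f differentiable (at x)) \<and>
     (\<forall>b\<in>Basis. Ck_on k S (\<lambda>x. frechet_derivative f (at x) b))"

text \<open>Meaningful for open \<open>S\<close>, since the derivatives are taken at \<open>at x\<close>.\<close>
definition smooth_on :: "'a::euclidean_space set \<Rightarrow> ('a \<Rightarrow> real) \<Rightarrow> bool" where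
  "smooth_on S f \<longleftrightarrow> (\<forall>k. Ck_on k S f)"

definition test_function :: "'a::euclidean_space set \<Rightarrow> ('a \<Rightarrow> real) \<Rightarrow> bool" where
  "test_function S \<phi> \<longleftrightarrow>
     smooth_on UNIV \<phi> \<and> compact (closure {x. \<phi> x \<noteq> 0}) \<and> closure {x. \<phi> x \<noteq> 0} \<subseteq> S"

text \<open>The full Lipschitz norm, supremum norm plus Lipschitz seminorm; it may be infinite.\<close>
definition Lip_norm :: "'a::euclidean_space set \<Rightarrow> ('a \<Rightarrow> real) \<Rightarrow> ennreal" where
  "Lip_norm S f = (SUP x\<in>S. ennreal \<bar>f x\<bar>) +
     (SUP (x, y)\<in>{(x, y). x \<in> S \<and> y \<in> S \<and> x \<noteq> y}. ennreal (\<bar>f x - f y\<bar> / dist x y))"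

definition Lip :: "'a::euclidean_space set \<Rightarrow> ('a \<Rightarrow> real) set" where
  "Lip S = {f. Lip_norm S f < \<infinity>}"

definition holder_loc :: "real \<Rightarrow> 'a::euclidean_space set \<Rightarrow> ('a \<Rightarrow> real) set" where
  "holder_loc \<alpha> S = {f. \<forall>K. compact K \<and> K \<subseteq> S \<longrightarrow>
     (\<exists>C. \<forall>x\<in>K. \<forall>y\<in>K. \<bar>f x - f y\<bar> \<le> C * dist x y powr \<alpha>)}"

definition L1_loc :: "'a::euclidean_space set \<Rightarrow> ('a \<Rightarrow> real) set" where
  "L1_loc S = {f. \<forall>K. compact K \<and> K \<subseteq> S \<longrightarrow> set_integrable lebesgue K f}"

section \<open>Vector fields\<close>

text \<open>At points where \<open>f\<close> is not differentiable the value is unspecified.\<close>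
definition pd :: "'n::finite \<Rightarrow> (real^'n \<Rightarrow> real) \<Rightarrow> real^'n \<Rightarrow> real" where
  "pd j f x = frechet_derivative f (at x) (axis j 1)"

definition on_graph :: "(real^2 \<Rightarrow> real) \<Rightarrow> real^2 \<Rightarrow> real^3" where
  "on_graph u x = vector [x $ 1, x $ 2, u x]"

definition X1 :: "(2 \<Rightarrow> real^3 \<Rightarrow> real) \<Rightarrow> (real^2 \<Rightarrow> real) \<Rightarrow>
    (real^2 \<Rightarrow> real) \<Rightarrow> real^2 \<Rightarrow> real" where
  "X1 \<sigma> u f x = (\<Sum>j\<in>UNIV. \<sigma> j (on_graph u x) * pd j f x)"

definition \<sigma>2 :: "(2 \<Rightarrow> real^3 \<Rightarrow> real) \<Rightarrow> 2 \<Rightarrow> real^3 \<Rightarrow> real" where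
  "\<sigma>2 \<sigma> j = pd 3 (\<sigma> j)"

definition Y_field :: "(2 \<Rightarrow> real^3 \<Rightarrow> real) \<Rightarrow> (real^2 \<Rightarrow> real) \<Rightarrow>
    (real^2 \<Rightarrow> real) \<Rightarrow> real^2 \<Rightarrow> real" where
  "Y_field \<sigma> u f x = (\<Sum>j\<in>UNIV. \<sigma>2 \<sigma> j (on_graph u x) * pd j f x)"

definition X_eps :: "(2 \<Rightarrow> real^3 \<Rightarrow> real) \<Rightarrow> real \<Rightarrow> (real^2 \<Rightarrow> real) \<Rightarrow> 2 \<Rightarrow>
    (real^2 \<Rightarrow> real) \<Rightarrow> real^2 \<Rightarrow> real" where
  "X_eps \<sigma> \<epsilon> u i f x = (if i = 1 then X1 \<sigma> u f x else \<epsilon> * Y_field \<sigma> u f x)"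

definition grad_eps :: "(2 \<Rightarrow> real^3 \<Rightarrow> real) \<Rightarrow> real \<Rightarrow> (real^2 \<Rightarrow> real) \<Rightarrow>
    (real^2 \<Rightarrow> real) \<Rightarrow> real^2 \<Rightarrow> real^2" where
  "grad_eps \<sigma> \<epsilon> u f x = (\<chi> i. X_eps \<sigma> \<epsilon> u i f x)"

text \<open>\<open>L_op \<sigma> \<epsilon> u\<close> is $L_{\epsilon,u}u$: the same \<open>u\<close> is the coefficient and the argument.\<close>
definition L_op :: "(2 \<Rightarrow> real^3 \<Rightarrow> real) \<Rightarrow> real \<Rightarrow> (real^2 \<Rightarrow> real) \<Rightarrow>
    real^2 \<Rightarrow> real" where
  "L_op \<sigma> \<epsilon> u x = (\<Sum>i\<in>UNIV.
     X_eps \<sigma> \<epsilon> u i (\<lambda>y. X_eps \<sigma> \<epsilon> u i u y / sqrt (1 + (norm (grad_eps \<sigma> \<epsilon> u u y))\<^sup>2)) x)"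

section \<open>Vanishing viscosity solutions and weak derivatives\<close>

definition vanishing_viscosity_solution ::
    "(2 \<Rightarrow> real^3 \<Rightarrow> real) \<Rightarrow> (real^2) set \<Rightarrow> (real^2 \<Rightarrow> real) \<Rightarrow> bool" where
  "vanishing_viscosity_solution \<sigma> \<Omega> u \<longleftrightarrow> u \<in> Lip \<Omega> \<and>
     (\<exists>(\<epsilon> :: nat \<Rightarrow> real) (v :: nat \<Rightarrow> real^2 \<Rightarrow> real).
        (\<forall>n. \<epsilon> n > 0) \<and> \<epsilon> \<longlonglongrightarrow> 0 \<and> (\<forall>n. smooth_on \<Omega> (v n)) \<and>
        (\<forall>n. \<forall>x\<in>\<Omega>. L_op \<sigma> (\<epsilon> n) (v n) x = 0) \<and>
        (\<exists>l>0. \<forall>n. Lip_norm \<Omega> (v n) \<le> ennreal l) \<and>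
        (\<forall>K. compact K \<and> K \<subseteq> \<Omega> \<longrightarrow> uniform_limit K v u sequentially))"

text \<open>The formal adjoint $X_{1,u}^*\varphi = -\sum_j \partial_{x_j}(\sigma_1^j(x,u(x))\varphi)$.
  For Lipschitz \<open>u\<close> and smooth \<open>\<sigma>\<close> and \<open>\<phi>\<close> the product is locally Lipschitz, hence
  differentiable almost everywhere, and the adjoint only occurs under integrals with respect
  to the (complete) Lebesgue measure.\<close>
definition X1_adj :: "(2 \<Rightarrow> real^3 \<Rightarrow> real) \<Rightarrow> (real^2 \<Rightarrow> real) \<Rightarrow>
    (real^2 \<Rightarrow> real) \<Rightarrow> real^2 \<Rightarrow> real" where
  "X1_adj \<sigma> u \<phi> x = - (\<Sum>j\<in>UNIV. pd j (\<lambda>y. \<sigma> j (on_graph u y) * \<phi> y) x)"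

text \<open>\<open>w\<close> is (a representative of) $X_{1,u}v$ in the weak sense on \<open>\<Omega>\<close>.\<close>
definition weak_X1 :: "(2 \<Rightarrow> real^3 \<Rightarrow> real) \<Rightarrow> (real^2) set \<Rightarrow> (real^2 \<Rightarrow> real) \<Rightarrow>
    (real^2 \<Rightarrow> real) \<Rightarrow> (real^2 \<Rightarrow> real) \<Rightarrow> bool" where
  "weak_X1 \<sigma> \<Omega> u v w \<longleftrightarrow> v \<in> L1_loc \<Omega> \<and> w \<in> L1_loc \<Omega> \<and>
     (\<forall>\<phi>. test_function \<Omega> \<phi> \<longrightarrow>
        (LINT x:\<Omega>|lebesgue. w x * \<phi> x) = (LINT x:\<Omega>|lebesgue. v x * X1_adj \<sigma> u \<phi> x))"

text \<open>\<open>w\<close> is (a representative of) the iterated weak derivative $X_{1,u}^k u$; weak derivatives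
  are unique up to null sets.\<close>
fun weak_X1_pow :: "(2 \<Rightarrow> real^3 \<Rightarrow> real) \<Rightarrow> (real^2) set \<Rightarrow> (real^2 \<Rightarrow> real) \<Rightarrow>
    nat \<Rightarrow> (real^2 \<Rightarrow> real) \<Rightarrow> bool" where
  "weak_X1_pow \<sigma> \<Omega> u 0 w \<longleftrightarrow> w = u"
| "weak_X1_pow \<sigma> \<Omega> u (Suc k) w \<longleftrightarrow> (\<exists>v. weak_X1_pow \<sigma> \<Omega> u k v \<and> weak_X1 \<sigma> \<Omega> u v w)"

end

theory Submission
  imports Defs
begin

text \<open>The limit equation is \<open>X\<^sub>1 (X\<^sub>1 u) = 0\<close>: along an integral curve of \<open>X\<^sub>1\<close> the function \<open>u\<close> is affine.
  This is obtained from the maximum principle only. Call \<open>(X, z)\<close> a lifted curve if \<open>X' = \<sigma>(X, z)\<close>. If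
  \<open>z'' < 0\<close>, such a curve cannot touch the graph of \<open>u\<close> from above at an interior time: comparing
  \<open>u\<^sub>n\<close> with the penalisation \<open>z t + K |y - X t|\<^sup>2\<close> at a joint maximum in \<open>(t, y)\<close>, the equation for \<open>u\<^sub>n\<close>
  contradicts \<open>z'' < 0\<close> for large \<open>K\<close> and then small \<open>\<epsilon>\<^sub>n\<close>; symmetrically from below. Shooting and sliding then
  give through every point of the graph a lifted curve with affine \<open>z\<close> inside the graph. Since \<open>u\<close>
  is Lipschitz, nearby curves stay close for a fixed time, so their slopes \<open>X\<^sub>1 u\<close> depend in a
  Lipschitz way on the starting point, and these slopes are constant along the curves. Thus \<open>X\<^sub>1 u\<close> is locally Lipschitz and all
  higher derivatives vanish. To read this as a statement about weak derivatives one integrates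
  by parts Lipschitz functions, which rests on Rademacher's theorem in the plane.\<close>

section \<open>Lipschitz functions are differentiable almost everywhere\<close>

text \<open>The obstacle is that the only bound uniform in \<open>n\<close> is the Lipschitz
  constant \<open>l\<close>: second derivatives of the approximations are uncontrolled,
  \<open>u\<close> is merely Lipschitz, and the field depends on \<open>u\<close> itself. Hence the
  height \<open>z\<close> of a comparison curve is prescribed instead of being read off from
  \<open>u\<close>. As \<open>z\<close> is a polynomial, \<open>X\<close> is twice differentiable,
  and z'' takes the place of the second derivative of \<open>u\<close> along the field. A curve
  alone gives no test function on the plane, which is why a penalty surrounds it. Its Hessian 2 K is
  large, but the velocity of the curve and the field at the maximum are values of the same \<sigma>
  at points O(1/K) apart, so moving along with the curve costs only K O(1/K)^2. The transverse
  directions cost K \<epsilon>^2, which is why \<open>K\<close> is fixed before \<open>n\<close>.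
  All curves live for a time \<open>r\<close> with \<open>r * M * (1 + l) \<le> 1 / 32\<close>. Then
  changing \<open>z\<close> by \<eta> changes \<open>u\<close> along the curve by at most \<eta>/16,
  so the gap between curve and graph follows the imposed shift almost exactly. This makes the
  sliding argument quantitative.\<close>

lemma lmeasurable_outer_open:
  fixes S :: "'a::euclidean_space set"
  assumes "S \<in> lmeasurable" "0 < e"
  obtains U where "open U" "S \<subseteq> U" "U \<in> lmeasurable" "measure lebesgue U < measure lebesgue S + e"
proof -
  obtain U where U: "open U" "S \<subseteq> U" "U - S \<in> lmeasurable" "emeasure lebesgue (U - S) < ennreal e"
    by (rule sets_lebesgue_outer_open[OF fmeasurableD[OF assms(1)] assms(2)])
  have "U = S \<union> (U - S)" using U by auto
  then have UL: "U \<in> lmeasurable" using fmeasurable.Un[OF assms(1) U(3)] by simp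
  have "measure lebesgue (U - S) < e"
    using U(3,4) assms(2) by (simp add: emeasure_eq_measure2 ennreal_less_iff)
  moreover have "measure lebesgue (U - S) = measure lebesgue U - measure lebesgue S"
    using measurable_measure_Diff[OF UL fmeasurableD[OF assms(1)] U(2)] .
  ultimately show ?thesis using that[OF U(1,2) UL] by simp
qed

text \<open>The outer measure \<open>m\<close>, taken over open supersets, satisfies
  \<open>m \<le> \<theta> * m\<close>, because every open superset can be replaced by one smaller by
  nearly the factor \<open>\<theta>\<close>. It is finite since \<open>S\<close> is bounded, so it
  vanishes. Outer measure is used because the sets in the Vitali arguments are not known to be
  measurable.\<close>

lemma negligible_if_contracting_covers:
  fixes S :: "'a::euclidean_space set"
  assumes bS: "bounded S" and \<theta>: "\<theta> < 1"
    and cover: "\<And>U e. open U \<Longrightarrow> S \<subseteq> U \<Longrightarrow> U \<in> lmeasurable \<Longrightarrow> 0 < e \<Longrightarrow>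
      \<exists>V\<in>lmeasurable. negligible (S - V) \<and> measure lebesgue V \<le> \<theta> * measure lebesgue U + e"
  shows "negligible S"
proof -
  define A where "A = {measure lebesgue U | U. open U \<and> S \<subseteq> U \<and> U \<in> lmeasurable}"
  define m where "m = Inf A"
  obtain r where r: "S \<subseteq> ball 0 r" using bS bounded_subset_ballD by blast
  have ne: "A \<noteq> {}" unfolding A_def using r by (auto intro!: exI[of _ "ball 0 r"])
  have bb: "bdd_below A" unfolding A_def by (auto intro!: bdd_belowI[of _ 0])
  have m0: "0 \<le> m" unfolding m_def using ne by (intro cInf_greatest) (auto simp: A_def)
  have open_cover: "\<exists>W. open W \<and> S \<subseteq> W \<and> W \<in> lmeasurable \<and> measure lebesgue W < measure lebesgue V + e"
    if V: "V \<in> lmeasurable" "negligible (S - V)" and e: "0 < e" for V e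
  proof -
    have VL: "V \<union> (S - V) \<in> lmeasurable"
      by (rule fmeasurable.Un[OF V(1) negligible_imp_measurable[OF V(2)]])
    have Vm: "measure lebesgue (V \<union> (S - V)) = measure lebesgue V"
      using V by (intro measure_Un_null_set) (auto simp: negligible_iff_null_sets)
    obtain W where "open W" "V \<union> (S - V) \<subseteq> W" "W \<in> lmeasurable" "measure lebesgue W < measure lebesgue V + e"
      by (rule lmeasurable_outer_open[OF VL e, unfolded Vm])
    then show ?thesis by blast
  qed
  have step: "m \<le> \<theta> * m + e" if e: "0 < e" for e
  proof -
    \<comment> \<open>Three errors of \<open>e / 3\<close> add up: choosing \<open>U\<close> near
      the infimum, the cover \<open>V\<close>, and enlarging \<open>V\<close> to an open set. The
      absolute value is there because \<open>\<theta>\<close> may be negative.\<close>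
    define e' where "e' = e / (3 * (1 + \<bar>\<theta>\<bar>))"
    have e': "0 < e'" "\<bar>\<theta>\<bar> * e' \<le> e / 3" "e' \<le> e / 3"
      using e by (auto simp: e'_def field_simps add_pos_nonneg)
    obtain U where U: "open U" "S \<subseteq> U" "U \<in> lmeasurable" "measure lebesgue U < m + e'"
      using cInf_lessD[OF ne, of "m + e'"] e' unfolding m_def A_def by auto
    obtain V where V: "V \<in> lmeasurable" "negligible (S - V)" "measure lebesgue V \<le> \<theta> * measure lebesgue U + e/3"
      using cover[OF U(1-3), of "e/3"] e by auto
    obtain W where W: "open W" "S \<subseteq> W" "W \<in> lmeasurable" "measure lebesgue W < measure lebesgue V + e/3"
      using open_cover[OF V(1,2), of "e/3"] e by auto
    have mU: "m \<le> measure lebesgue U" unfolding m_def by (rule cInf_lower[OF _ bb]) (use U in \<open>unfold A_def, blast\<close>)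
    have "\<theta> * (measure lebesgue U - m) \<le> \<bar>\<theta>\<bar> * e'"
      using mU U(4) by (smt (verit) e'(1) mult_mono' mult_right_mono zero_le_mult_iff mult_nonpos_nonneg)
    then have "\<theta> * measure lebesgue U \<le> \<theta> * m + e / 3" using e' by (simp add: algebra_simps)
    moreover have "m \<le> measure lebesgue W"
      unfolding m_def by (rule cInf_lower[OF _ bb]) (use W in \<open>unfold A_def, blast\<close>)
    ultimately show ?thesis using W V by linarith
  qed
  have "m = 0"
  proof (rule ccontr)
    assume "m \<noteq> 0"
    then have "0 < (1 - \<theta>) * m / 2" using m0 \<theta> by simp
    from step[OF this] \<open>0 < (1 - \<theta>) * m / 2\<close> show False by (simp add: field_simps)
  qed
  show ?thesis unfolding negligible_outer
  proof (intro allI impI)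
    fix e :: real assume "0 < e"
    then obtain U where "open U" "S \<subseteq> U" "U \<in> lmeasurable" "measure lebesgue U < e"
      using cInf_lessD[OF ne, of e] \<open>m = 0\<close> unfolding m_def A_def by auto
    then show "\<exists>T. S \<subseteq> T \<and> T \<in> lmeasurable \<and> measure lebesgue T < e" by blast
  qed
qed

text \<open>The counting step shared by both Vitali arguments below: intervals and their images
  under \<open>F\<close>, and balls before and after removal of a hole.\<close>

lemma measure_UN_scaled_le:
  fixes A B :: "'i \<Rightarrow> 'a::euclidean_space set"
  assumes C: "countable C" and disj: "disjoint_family_on A C" "disjoint_family_on B C"
    and sets: "\<And>i. i \<in> C \<Longrightarrow> A i \<in> sets lebesgue" "\<And>i. i \<in> C \<Longrightarrow> B i \<in> sets lebesgue"
    and le: "\<And>i. i \<in> C \<Longrightarrow> emeasure lebesgue (B i) \<le> ennreal c * emeasure lebesgue (A i)"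
    and sub: "\<And>i. i \<in> C \<Longrightarrow> A i \<subseteq> U" and U: "U \<in> lmeasurable" and c: "0 \<le> c"
  shows "(\<Union>i\<in>C. B i) \<in> lmeasurable \<and> measure lebesgue (\<Union>i\<in>C. B i) \<le> c * measure lebesgue U"
proof
  let ?V = "\<Union>i\<in>C. B i"
  have "emeasure lebesgue ?V = (\<integral>\<^sup>+ i. emeasure lebesgue (B i) \<partial>count_space C)"
    using C disj(2) sets(2) by (intro emeasure_UN_countable) auto
  also have "\<dots> \<le> (\<integral>\<^sup>+ i. ennreal c * emeasure lebesgue (A i) \<partial>count_space C)"
    by (rule nn_integral_mono) (use le in auto)
  also have "\<dots> = ennreal c * (\<integral>\<^sup>+ i. emeasure lebesgue (A i) \<partial>count_space C)"
    by (rule nn_integral_cmult) auto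
  also have "(\<integral>\<^sup>+ i. emeasure lebesgue (A i) \<partial>count_space C) = emeasure lebesgue (\<Union>i\<in>C. A i)"
    using C disj(1) sets(1) by (intro emeasure_UN_countable[symmetric]) auto
  also have "\<dots> \<le> emeasure lebesgue U"
    by (rule emeasure_mono) (use sub U in \<open>auto simp: fmeasurableD\<close>)
  also have "ennreal c * emeasure lebesgue U = ennreal (c * measure lebesgue U)"
    using U c by (simp only: emeasure_eq_measure2 ennreal_mult measure_nonneg)
  finally have eV: "emeasure lebesgue ?V \<le> ennreal (c * measure lebesgue U)"
    by (simp add: mult_left_mono)
  have "?V \<in> sets lebesgue" using C sets(2) by (intro sets.countable_UN'') auto
  then show V: "?V \<in> lmeasurable" using eV by (intro fmeasurableI) (auto simp: less_top[symmetric] top_unique)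
  show "measure lebesgue ?V \<le> c * measure lebesgue U"
    using eV c unfolding emeasure_eq_measure2[OF V] by (simp add: ennreal_le_iff)
qed

section \<open>Differentiability almost everywhere on the line\<close>

definition lower_slope_set :: "(real \<Rightarrow> real) \<Rightarrow> real \<Rightarrow> real set" where
  "lower_slope_set F p = {x. \<forall>d>0. \<exists>a b. a \<le> x \<and> x \<le> b \<and> a < b \<and> b - a < d \<and> F b - F a < p * (b - a)}"

text \<open>In both definitions the interval need only contain the point, which is what a Vitali
  cover requires; taking the point as an endpoint recovers the one-sided difference
  quotients.\<close>

definition upper_slope_set :: "(real \<Rightarrow> real) \<Rightarrow> real \<Rightarrow> real set" where
  "upper_slope_set F q = {x. \<forall>d>0. \<exists>a b. a \<le> x \<and> x \<le> b \<and> a < b \<and> b - a < d \<and> F b - F a > q * (b - a)}"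

text \<open>For strictly increasing \<open>F\<close>, the image of a Vitali cover by intervals of slope below \<open>p\<close> shrinks measure
  by the factor \<open>p\<close>. Applied to \<open>F\<close> and then to its inverse, this gives a contraction by \<open>p / q\<close>
  on the set where lower slopes below \<open>p\<close> and upper slopes above \<open>q\<close> coexist.\<close>
lemma image_cover_lower_slope:
  fixes F :: "real \<Rightarrow> real"
  assumes mono: "strict_mono F" and lip: "L-lipschitz_on UNIV F"
    and S: "S \<subseteq> lower_slope_set F p" and U: "open U" "S \<subseteq> U" "U \<in> lmeasurable" and p: "0 < p"
  shows "\<exists>V\<in>lmeasurable. negligible (F ` S - V) \<and> measure lebesgue V \<le> p * measure lebesgue U"
proof -
  define K where "K = {(a,b). a < b \<and> {a..b} \<subseteq> U \<and> F b - F a < p * (b - a)}"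
  define ctr where "ctr = (\<lambda>(a,b). (a + b) / 2 :: real)"
  define rad where "rad = (\<lambda>(a,b). (b - a) / 2 :: real)"
  have cb: "cball (ctr i) (rad i) = {fst i..snd i}" for i
    by (auto simp: cball_eq_atLeastAtMost ctr_def rad_def case_prod_beta field_simps)
  obtain C where C: "countable C" "C \<subseteq> K"
    "pairwise (\<lambda>i j. disjnt (cball (ctr i) (rad i)) (cball (ctr j) (rad j))) C"
    "negligible (S - (\<Union>i\<in>C. cball (ctr i) (rad i)))"
  proof (rule Vitali_covering_theorem_cballs[of K rad S ctr])
    show "0 < rad i" if "i \<in> K" for i using that by (auto simp: K_def rad_def)
    show "\<exists>i. i \<in> K \<and> x \<in> cball (ctr i) (rad i) \<and> rad i < d" if x: "x \<in> S" and d: "0 < d" for x d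
    proof -
      obtain e where e: "0 < e" "ball x e \<subseteq> U" using U x by (meson openE subsetD)
      obtain a b where ab: "a \<le> x" "x \<le> b" "a < b" "b - a < min d e" "F b - F a < p * (b - a)"
      proof -
        have "x \<in> lower_slope_set F p" "0 < min d e" using S x d e by auto
        then show ?thesis using that unfolding lower_slope_set_def by blast
      qed
      have "{a..b} \<subseteq> ball x e" using ab by (auto simp: dist_real_def)
      then have "{a..b} \<subseteq> U" using e by blast
      then show ?thesis using ab unfolding cb by (intro exI[of _ "(a,b)"]) (auto simp: K_def rad_def)
    qed
  qed auto
  define V where "V = (\<Union>i\<in>C. {F (fst i)..F (snd i)})"
  have cont: "continuous_on X F" for X using lip lipschitz_on_continuous_on lipschitz_on_subset by (meson subset_UNIV)
  have im: "F ` {a..b} = {F a..F b}" if "a < b" for a b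
  proof
    show "F ` {a..b} \<subseteq> {F a..F b}" using mono by (auto simp: strict_mono_less_eq)
    show "{F a..F b} \<subseteq> F ` {a..b}"
    proof
      fix y assume "y \<in> {F a..F b}"
      then show "y \<in> F ` {a..b}" using IVT'[of F a y b] cont that by (auto simp: image_iff)
    qed
  qed
  have inj: "inj F" using mono strict_mono_imp_inj_on by blast
  have disj1: "disjoint_family_on (\<lambda>i. {fst i..snd i}) C"
    using C(3) unfolding cb by (auto simp: disjoint_family_on_def pairwise_def disjnt_def)
  have disj2: "disjoint_family_on (\<lambda>i. {F (fst i)..F (snd i)}) C"
  proof -
    have "{F (fst i)..F (snd i)} = F ` {fst i..snd i}" if "i \<in> C" for i
      by (rule im[symmetric]) (use that C(2) in \<open>auto simp: K_def\<close>)
    then show ?thesis using disj1 inj unfolding disjoint_family_on_def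
      by (metis (no_types, lifting) image_Int image_empty)
  qed
  have Km: "fst i < snd i" "F (fst i) < F (snd i)" "F (snd i) - F (fst i) \<le> p * (snd i - fst i)" if "i \<in> C" for i
    using that C(2) mono by (auto simp: K_def strict_mono_less)
  have "V \<in> lmeasurable \<and> measure lebesgue V \<le> p * measure lebesgue U"
    unfolding V_def
  proof (rule measure_UN_scaled_le[OF C(1) disj1 disj2])
    fix i assume i: "i \<in> C"
    then show "emeasure lebesgue {F (fst i)..F (snd i)} \<le> ennreal p * emeasure lebesgue {fst i..snd i}"
      using Km[of i] p by (simp add: ennreal_mult[symmetric] ennreal_leI)
    show "{fst i..snd i} \<subseteq> U" using subsetD[OF C(2) i] unfolding K_def case_prod_beta by blast
  qed (use U(3) p in auto)
  moreover have "negligible (F ` S - V)"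
  proof (rule negligible_subset)
    \<comment> \<open>What the Vitali family leaves uncovered is null, and a Lipschitz map sends
      null sets to null sets.\<close>
    show "negligible (F ` (S - (\<Union>i\<in>C. cball (ctr i) (rad i))))"
      by (rule negligible_locally_Lipschitz_image[OF _ C(4)])
        (use lip in \<open>auto intro!: exI[of _ UNIV] exI[of _ L] simp: lipschitz_on_def dist_norm\<close>)
    show "F ` S - V \<subseteq> F ` (S - (\<Union>i\<in>C. cball (ctr i) (rad i)))"
    proof
      fix y assume y: "y \<in> F ` S - V"
      then obtain x where x: "x \<in> S" "y = F x" by auto
      have "F x \<in> V" if "i \<in> C" "x \<in> {fst i..snd i}" for i
        using that mono unfolding V_def by (auto intro!: bexI[of _ i] simp: strict_mono_less_eq)
      then show "y \<in> F ` (S - (\<Union>i\<in>C. cball (ctr i) (rad i)))"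
        using x y unfolding cb by (intro image_eqI[of _ _ x]) auto
    qed
  qed
  ultimately show ?thesis by blast
qed


text \<open>Inverting the function exchanges rise and run, so a slope above \<open>q\<close> becomes
  a slope below \<open>1 / q\<close>. The Lipschitz bound on \<open>F\<close> keeps the image
  intervals short.\<close>

lemma slope_in_upper_imp_inverse_lower:
  fixes F G :: "real \<Rightarrow> real"
  assumes mono: "strict_mono F" and lip: "L-lipschitz_on UNIV F" and GF: "\<And>x. G (F x) = x"
    and x: "x \<in> upper_slope_set F q" and q: "0 < q"
  shows "F x \<in> lower_slope_set G (1 / q)"
  unfolding lower_slope_set_def
proof (safe)
  fix d :: real assume d: "0 < d"
  have L: "0 \<le> L" using lip lipschitz_on_nonneg by blast
  then have "0 < d / (L + 1)" using d by simp
  then obtain a b where ab: "a \<le> x" "x \<le> b" "a < b" "b - a < d / (L + 1)" "F b - F a > q * (b - a)"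
    using x unfolding upper_slope_set_def by blast
  have Fab: "F a < F b" using mono ab by (simp add: strict_mono_less)
  have "F b - F a \<le> L * (b - a)"
    using lipschitz_onD[OF lip, of b a] ab Fab by (simp add: dist_real_def)
  also have "\<dots> \<le> (L + 1) * (b - a)" using ab by (simp add: algebra_simps)
  also have "\<dots> < d" using ab L by (simp add: field_simps)
  finally have "F b - F a < d" .
  moreover have "F a \<le> F x" "F x \<le> F b" using ab mono by (simp_all add: strict_mono_less_eq)
  moreover have "G (F b) - G (F a) < 1 / q * (F b - F a)" using ab q by (simp add: GF field_simps)
  ultimately show "\<exists>a b. a \<le> F x \<and> F x \<le> b \<and> a < b \<and> b - a < d \<and> G b - G a < 1 / q * (b - a)"
    using Fab by blast
qed

lemma negligible_slope_gap:
  fixes F G :: "real \<Rightarrow> real"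
  assumes F: "strict_mono F" "L-lipschitz_on UNIV F" and G: "strict_mono G" "M-lipschitz_on UNIV G"
    and GF: "\<And>x. G (F x) = x" and pq: "0 < p" "p < q"
  shows "negligible (lower_slope_set F p \<inter> upper_slope_set F q)"
proof -
  have "negligible (lower_slope_set F p \<inter> upper_slope_set F q \<inter> ball 0 r)" (is "negligible ?S") for r :: real
  proof (rule negligible_if_contracting_covers[where \<theta> = "p / q"])
    show "bounded ?S" by (rule bounded_subset[of "ball 0 r"]) auto
    show "p / q < 1" using pq by simp
    fix U :: "real set" and e :: real
    assume U: "open U" "?S \<subseteq> U" "U \<in> lmeasurable" and e: "0 < e"
    obtain V where V: "V \<in> lmeasurable" "negligible (F ` ?S - V)" "measure lebesgue V \<le> p * measure lebesgue U"
      using image_cover_lower_slope[OF F, of ?S p U] U pq by blast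
    have V1: "V \<union> (F ` ?S - V) \<in> lmeasurable"
      by (rule fmeasurable.Un[OF V(1) negligible_imp_measurable[OF V(2)]])
    have V2: "measure lebesgue (V \<union> (F ` ?S - V)) = measure lebesgue V"
      using V by (intro measure_Un_null_set) (auto simp: negligible_iff_null_sets)
    \<comment> \<open>The second use of the image lemma starts from an open set, so the cover is
      enlarged first; the excess \<open>q * e\<close> becomes \<open>e\<close> after the factor
      \<open>1 / q\<close>.\<close>
    have "0 < q * e" using pq e by simp
    obtain W where W: "open W" "V \<union> (F ` ?S - V) \<subseteq> W" "W \<in> lmeasurable"
        "measure lebesgue W < measure lebesgue V + q * e"
      by (rule lmeasurable_outer_open[OF V1 \<open>0 < q * e\<close>, unfolded V2])
    have "F ` ?S \<subseteq> lower_slope_set G (1 / q)"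
      using slope_in_upper_imp_inverse_lower[OF F GF, where q = q] pq by auto
    then obtain V' where V': "V' \<in> lmeasurable" "negligible (G ` F ` ?S - V')"
        "measure lebesgue V' \<le> 1 / q * measure lebesgue W"
      using image_cover_lower_slope[OF G, of "F ` ?S" "1 / q" W] W pq by auto
    have "G ` F ` ?S = ?S" by (auto simp: GF image_iff)
    moreover have "1 / q * measure lebesgue W \<le> p / q * measure lebesgue U + e"
      using W V pq by (simp add: field_simps)
    ultimately show "\<exists>V\<in>lmeasurable. negligible (?S - V) \<and> measure lebesgue V \<le> p / q * measure lebesgue U + e"
      using V' by (intro bexI[of _ V']) auto
  qed
  then have "negligible (\<Union>n::nat. lower_slope_set F p \<inter> upper_slope_set F q \<inter> ball 0 (real n))"
    by (intro negligible_countable_Union) auto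
  moreover have "(\<Union>n::nat. lower_slope_set F p \<inter> upper_slope_set F q \<inter> ball 0 (real n)) =
      lower_slope_set F p \<inter> upper_slope_set F q"
    by (auto simp: dist_real_def) (meson reals_Archimedean2)
  ultimately show ?thesis by simp
qed

text \<open>\<open>D\<close>, the infimum of the eventual upper bounds for slopes, is the upper
  derivate at \<open>x\<close>. If the lower derivate were smaller, two rationals would fit between
  them, contrary to \<open>gap\<close>. Restricting to rationals keeps the exceptional set a
  countable union.\<close>

lemma has_field_derivative_if_no_slope_gap:
  fixes F :: "real \<Rightarrow> real"
  assumes low: "\<And>x y. x < y \<Longrightarrow> c * (y - x) \<le> F y - F x"
    and up: "\<And>x y. x < y \<Longrightarrow> F y - F x \<le> C * (y - x)"
    and gap: "\<And>p q. p \<in> \<rat> \<Longrightarrow> q \<in> \<rat> \<Longrightarrow> c \<le> p \<Longrightarrow> p < q \<Longrightarrow> x \<notin> lower_slope_set F p \<inter> upper_slope_set F q"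
  shows "\<exists>D. (F has_field_derivative D) (at x)"
proof -
  define A where "A = {q. x \<notin> upper_slope_set F q}"
  define D where "D = Inf A"
  have "C \<in> A" unfolding A_def upper_slope_set_def using up by (auto intro!: exI[of _ 1] simp: not_less)
  have lowA: "c \<le> q" if "q \<in> A" for q
  proof (rule ccontr)
    assume "\<not> c \<le> q"
    have "x \<in> upper_slope_set F q" unfolding upper_slope_set_def
    proof safe
      fix d :: real assume "0 < d"
      have "q * (d/2) < c * (d/2)" using \<open>0 < d\<close> \<open>\<not> c \<le> q\<close> by simp
      also have "\<dots> \<le> F (x + d/2) - F x" using low[of x "x + d/2"] \<open>0 < d\<close> by simp
      finally show "\<exists>a b. a \<le> x \<and> x \<le> b \<and> a < b \<and> b - a < d \<and> q * (b - a) < F b - F a"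
        using \<open>0 < d\<close> by (intro exI[of _ x] exI[of _ "x + d/2"]) auto
    qed
    then show False using that by (simp add: A_def)
  qed
  have bb: "bdd_below A" using lowA by (rule bdd_belowI)
  have Dc: "c \<le> D" unfolding D_def using \<open>C \<in> A\<close> lowA by (intro cInf_greatest) auto
  have key: "\<exists>d>0. \<forall>y. y \<noteq> x \<and> \<bar>y - x\<bar> < d \<longrightarrow> \<bar>(F y - F x) / (y - x) - D\<bar> < e" if e: "0 < e" for e
  proof -
    obtain q0 where q0: "q0 \<in> A" "q0 < D + e" using cInf_lessD[of A "D + e"] \<open>C \<in> A\<close> e unfolding D_def by auto
    then obtain d1 where d1: "0 < d1" "\<And>a b. a \<le> x \<Longrightarrow> x \<le> b \<Longrightarrow> a < b \<Longrightarrow> b - a < d1 \<Longrightarrow> F b - F a \<le> q0 * (b - a)"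
    proof -
      from q0(1) obtain d where "d > 0" "\<forall>a b. \<not> (a \<le> x \<and> x \<le> b \<and> a < b \<and> b - a < d \<and> F b - F a > q0 * (b - a))"
        unfolding A_def upper_slope_set_def mem_Collect_eq by blast
      then show ?thesis by (intro that[of d]) (assumption, rule leI, blast)
    qed
    have "\<exists>d2>0. \<exists>p > D - e. \<forall>a b. a \<le> x \<longrightarrow> x \<le> b \<longrightarrow> a < b \<longrightarrow> b - a < d2 \<longrightarrow> F b - F a \<ge> p * (b - a)"
    proof (cases "D - e < c")
      \<comment> \<open>\<open>gap\<close> speaks only of \<open>p \<ge> c\<close>; below that the
        global bound \<open>low\<close> is enough.\<close>
      case True
      then show ?thesis using low by (intro exI[of _ 1] conjI exI[of _ c]) auto
    next
      case False
      obtain p where p: "p \<in> \<rat>" "D - e < p" "p < D" using Rats_dense_in_real[of "D - e" D] e by auto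
      obtain q where q: "q \<in> \<rat>" "p < q" "q < D" using Rats_dense_in_real[of p D] p by auto
      have "q \<notin> A" using cInf_lower[OF _ bb, of q] q unfolding D_def by auto
      then have "x \<in> upper_slope_set F q" by (simp add: A_def)
      then have "x \<notin> lower_slope_set F p" using gap[of p q] p q False by auto
      then obtain d where "d > 0" "\<forall>a b. \<not> (a \<le> x \<and> x \<le> b \<and> a < b \<and> b - a < d \<and> F b - F a < p * (b - a))"
        unfolding lower_slope_set_def mem_Collect_eq by blast
      then have "0 < d \<and> p > D - e \<and> (\<forall>a b. a \<le> x \<longrightarrow> x \<le> b \<longrightarrow> a < b \<longrightarrow> b - a < d \<longrightarrow> F b - F a \<ge> p * (b - a))"
        using p(2) by (blast intro: leI)
      then show ?thesis by blast
    qed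
    then obtain d2 p where d2: "0 < d2" "D - e < p"
        "\<And>a b. a \<le> x \<Longrightarrow> x \<le> b \<Longrightarrow> a < b \<Longrightarrow> b - a < d2 \<Longrightarrow> F b - F a \<ge> p * (b - a)" by blast
    show ?thesis
    proof (intro exI[of _ "min d1 d2"] conjI allI impI)
      show "0 < min d1 d2" using d1 d2 by simp
      fix y assume y: "y \<noteq> x \<and> \<bar>y - x\<bar> < min d1 d2"
      consider "x < y" | "y < x" using y by linarith
      then have "p \<le> (F y - F x) / (y - x) \<and> (F y - F x) / (y - x) \<le> q0"
      proof cases
        case 1
        then show ?thesis using d1(2)[of x y] d2(3)[of x y] y by (auto simp: field_simps)
      next
        case 2
        then have "p * (x - y) \<le> F x - F y" "F x - F y \<le> q0 * (x - y)"
          using d1(2)[of y x] d2(3)[of y x] y by auto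
        moreover have "(F y - F x) / (y - x) = (F x - F y) / (x - y)" using minus_divide_divide[of "F x - F y" "x - y"] by simp
        ultimately show ?thesis using 2 by (simp add: pos_le_divide_eq pos_divide_le_eq)
      qed
      then show "\<bar>(F y - F x) / (y - x) - D\<bar> < e" using q0 d2 by auto
    qed
  qed
  have "((\<lambda>y. (F y - F x) / (y - x)) \<longlongrightarrow> D) (at x)"
    unfolding LIM_eq using key by (simp add: real_norm_def)
  then show ?thesis by (auto simp: has_field_derivative_iff)
qed

theorem lipschitz_real_differentiable_ae:
  fixes f :: "real \<Rightarrow> real"
  assumes lip: "L-lipschitz_on UNIV f"
  shows "negligible {x. \<not> f differentiable (at x)}"
proof -
  define K where "K = L + 1"
  \<comment> \<open>All slopes of \<open>F\<close> lie between \<open>K\<close> and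
    \<open>3 * K\<close>, so \<open>F\<close> is a bi-Lipschitz bijection of the line;
    \<open>K = L + 1\<close> is positive even for constant \<open>f\<close>.\<close>
  define F where "F = (\<lambda>x. f x + 2 * K * x)"
  have L: "0 \<le> L" using lip lipschitz_on_nonneg by blast
  then have K: "0 < K" by (simp add: K_def)
  have fb: "\<bar>f y - f x\<bar> \<le> K * (y - x)" if "x < y" for x y
  proof -
    have "\<bar>f y - f x\<bar> \<le> L * (y - x)" using lipschitz_onD[OF lip, of y x] that by (simp add: dist_real_def)
    also have "\<dots> \<le> K * (y - x)" using that by (simp add: K_def)
    finally show ?thesis .
  qed
  have low: "K * (y - x) \<le> F y - F x" and up: "F y - F x \<le> 3 * K * (y - x)" if "x < y" for x y
    using fb[OF that] by (auto simp: F_def algebra_simps abs_le_iff)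
  have Fm: "strict_mono F"
  proof
    fix x y :: real assume "x < y"
    then show "F x < F y" using low[of x y] K by (smt (verit) mult_pos_pos)
  qed
  have Fl: "(3 * K)-lipschitz_on UNIV F"
  proof (rule lipschitz_on_leI)
    fix x y :: real assume "x \<le> y"
    then show "dist (F x) (F y) \<le> 3 * K * dist x y"
      using up[of x y] low[of x y] K by (cases "x = y") (auto simp: dist_real_def abs_if mult_le_0_iff)
  qed (use K in auto)
  have surj: "\<exists>x. F x = y" for y
  proof -
    define r where "r = (\<bar>y - F 0\<bar> + 1) / K"
    have r: "0 < r" "K * r = \<bar>y - F 0\<bar> + 1" using K by (auto simp: r_def)
    have "F (-r) \<le> y" "y \<le> F r" using low[of "-r" 0] low[of 0 r] r by auto
    moreover have "continuous_on {-r..r} F"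
      using Fl lipschitz_on_continuous_on lipschitz_on_subset by (meson subset_UNIV)
    ultimately show ?thesis using IVT'[of F "-r" y r] r by auto
  qed
  define G where "G = inv F"
  have inj: "inj F" using Fm strict_mono_imp_inj_on by blast
  have GF: "G (F x) = x" for x using inj by (simp add: G_def)
  have FG: "F (G y) = y" for y using surj unfolding G_def by (metis f_inv_into_f rangeI)
  have Gm: "strict_mono G"
    by (rule strict_monoI) (metis FG Fm strict_mono_less)
  have Gl: "(1 / K)-lipschitz_on UNIV G"
  proof (rule lipschitz_on_leI)
    fix x y :: real assume "x \<le> y"
    have "G x \<le> G y" using Gm \<open>x \<le> y\<close> by (simp add: strict_mono_less_eq)
    then show "dist (G x) (G y) \<le> 1 / K * dist x y"
      using low[of "G x" "G y"] \<open>x \<le> y\<close> K by (cases "G x = G y") (auto simp: FG dist_real_def field_simps)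
  qed (use K in auto)
  define N where "N = (\<Union>p\<in>\<rat> \<inter> {K..}. \<Union>q\<in>\<rat> \<inter> {p<..}. lower_slope_set F p \<inter> upper_slope_set F q)"
  have "negligible N" unfolding N_def
  proof (rule negligible_countable_Union)
    show "countable ((\<lambda>p. \<Union>q\<in>\<rat> \<inter> {p<..}. lower_slope_set F p \<inter> upper_slope_set F q) ` (\<rat> \<inter> {K..}))"
      by (intro countable_image countable_Int1 countable_rat)
    fix T assume "T \<in> (\<lambda>p. \<Union>q\<in>\<rat> \<inter> {p<..}. lower_slope_set F p \<inter> upper_slope_set F q) ` (\<rat> \<inter> {K..})"
    then obtain p where p: "K \<le> p" and T: "T = (\<Union>q\<in>\<rat> \<inter> {p<..}. lower_slope_set F p \<inter> upper_slope_set F q)" by auto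
    show "negligible T" unfolding T
    proof (rule negligible_countable_Union)
      show "countable ((\<lambda>q. lower_slope_set F p \<inter> upper_slope_set F q) ` (\<rat> \<inter> {p<..}))"
        by (intro countable_image countable_Int1 countable_rat)
      fix T' assume "T' \<in> (\<lambda>q. lower_slope_set F p \<inter> upper_slope_set F q) ` (\<rat> \<inter> {p<..})"
      then obtain q where q: "p < q" and T': "T' = lower_slope_set F p \<inter> upper_slope_set F q" by auto
      show "negligible T'" unfolding T' by (rule negligible_slope_gap[OF Fm Fl Gm Gl GF]) (use p q K in auto)
    qed
  qed
  moreover have "{x. \<not> f differentiable (at x)} \<subseteq> N"
  proof safe
    fix x assume nd: "\<not> f differentiable (at x)"
    show "x \<in> N"
    proof (rule ccontr)
      assume "x \<notin> N"
      then have "\<exists>D. (F has_field_derivative D) (at x)"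
        by (intro has_field_derivative_if_no_slope_gap[OF low up]) (auto simp: N_def)
      then obtain D where "(F has_field_derivative D) (at x)" ..
      then have "((\<lambda>x. F x - 2 * K * x) has_field_derivative (D - 2 * K)) (at x)"
        by (auto intro!: derivative_eq_intros)
      then have "(f has_field_derivative (D - 2 * K)) (at x)" by (simp add: F_def)
      then show False using nd by (metis real_differentiable_def)
    qed
  qed
  ultimately show ?thesis by (rule negligible_subset)
qed

section \<open>Null sets from lines and from porosity\<close>

lemma negligible_if_negligible_on_lines:
  fixes N :: "'a::euclidean_space set"
  assumes N: "N \<in> sets borel" and line: "\<And>x. negligible {t::real. x + t *\<^sub>R v \<in> N}"
  shows "negligible N"
proof -
  let ?g = "\<lambda>x t. indicator N (x + t *\<^sub>R v) * indicator {0..1} (t::real) :: ennreal"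
  have meas: "(\<lambda>(x, t). ?g x t) \<in> borel_measurable (lborel \<Otimes>\<^sub>M lborel)"
  proof -
    have "(\<lambda>p::'a \<times> real. fst p + snd p *\<^sub>R v) \<in> borel_measurable borel"
      by (intro borel_measurable_continuous_onI continuous_intros)
    then have [measurable]: "(\<lambda>p::'a \<times> real. fst p + snd p *\<^sub>R v) \<in> borel_measurable (lborel \<Otimes>\<^sub>M lborel)"
      by (simp add: lborel_prod)
    have [measurable]: "N \<in> sets borel" by (rule N)
    show ?thesis unfolding case_prod_beta by measurable
  qed
  \<comment> \<open>Fubini in \<open>x\<close> and \<open>t\<close> with \<open>t\<close> in the
    unit interval: by translation invariance the integral over \<open>x\<close> is the measure of
    \<open>N\<close> for every \<open>t\<close>, while the integral over \<open>t\<close> is zero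
    for every \<open>x\<close>. No coordinates adapted to \<open>v\<close> are required.\<close>
  have tr: "(\<integral>\<^sup>+x. indicator N (x + t *\<^sub>R v) \<partial>lborel) = emeasure lborel N" for t :: real
  proof -
    have "emeasure lborel N = (\<integral>\<^sup>+x. indicator N x \<partial>distr lborel borel ((+) (t *\<^sub>R v)))"
      using N by (simp add: lborel_distr_plus)
    also have "\<dots> = (\<integral>\<^sup>+x. indicator N (t *\<^sub>R v + x) \<partial>lborel)"
      using N by (intro nn_integral_distr) auto
    finally show ?thesis by (simp add: add.commute)
  qed
  have "emeasure lborel N = (\<integral>\<^sup>+t. emeasure lborel N * indicator {0..1::real} t \<partial>lborel)"
    by (subst nn_integral_cmult) auto
  also have "\<dots> = (\<integral>\<^sup>+t. \<integral>\<^sup>+x. ?g x t \<partial>lborel \<partial>lborel)"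
  proof (rule nn_integral_cong)
    fix t :: real
    have "(\<lambda>x. indicator N (x + t *\<^sub>R v) :: ennreal) \<in> borel_measurable lborel"
      using N by measurable
    then show "emeasure lborel N * indicator {0..1} t = (\<integral>\<^sup>+x. ?g x t \<partial>lborel)"
      by (subst nn_integral_multc) (auto simp: tr)
  qed
  also have "\<dots> = (\<integral>\<^sup>+x. \<integral>\<^sup>+t. ?g x t \<partial>lborel \<partial>lborel)"
    by (rule lborel_pair.Fubini'[OF meas])
  also have "\<dots> = (\<integral>\<^sup>+x. 0 \<partial>(lborel :: 'a measure))"
  proof (rule nn_integral_cong)
    fix x :: 'a
    have b: "{t. x + t *\<^sub>R v \<in> N} \<in> sets borel"
    proof -
      have "(\<lambda>t::real. x + t *\<^sub>R v) \<in> borel_measurable borel"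
        by (intro borel_measurable_continuous_onI continuous_intros)
      from measurable_sets[OF this N] show ?thesis by (simp add: vimage_def)
    qed
    have "AE t in lborel. t \<notin> {t. x + t *\<^sub>R v \<in> N}"
      using line[of x] b by (intro AE_not_in) (auto simp: negligible_iff_null_sets null_sets_completion_iff)
    then have "AE t in lborel. ?g x t = 0" by eventually_elim auto
    then show "(\<integral>\<^sup>+t. ?g x t \<partial>lborel) = 0"
      by (subst nn_integral_cong_AE[of _ "\<lambda>t. 0"]) auto
  qed
  finally have "emeasure lborel N = 0" by simp
  then have "N \<in> null_sets lborel" using N by auto
  then show ?thesis using N by (simp add: negligible_iff_null_sets null_sets_completion_iff)
qed

lemma negligible_Union_nat: "(\<And>n::nat. negligible (A n)) \<Longrightarrow> negligible (\<Union>n. A n)"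
  by (rule negligible_countable_Union) auto

definition porous_points :: "'a::metric_space set \<Rightarrow> 'a set" where
  "porous_points A = {x\<in>A. \<exists>\<eta>>0. \<forall>\<rho>>0. \<exists>z. 0 < dist x z \<and> dist x z < \<rho> \<and> ball z (\<eta> * dist x z) \<inter> A = {}}"

text \<open>Around a porous point, a ball of radius \<open>2 * dist x z\<close> contains a hole of
  radius \<open>\<eta> * dist x z\<close> that misses \<open>A\<close>. Removing the holes from a
  Vitali family thus loses no point of \<open>A\<close>, but a fixed fraction
  \<open>(\<eta> / 2) ^ DIM('a)\<close> of the measure.\<close>

lemma negligible_porous_points:
  fixes A :: "'a::euclidean_space set"
  shows "negligible (porous_points A)"
proof -
  define P where "P = (\<lambda>\<eta>. {x\<in>A. \<forall>\<rho>>0. \<exists>z. 0 < dist x z \<and> dist x z < \<rho> \<and> ball z (\<eta> * dist x z) \<inter> A = {}})"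
  have neg: "negligible (P \<eta> \<inter> ball 0 r)" if \<eta>: "0 < \<eta>" "\<eta> \<le> 1" for \<eta> r
  proof (rule negligible_if_contracting_covers[where \<theta> = "1 - (\<eta> / 2) ^ DIM('a)"])
    show "bounded (P \<eta> \<inter> ball 0 r)" by (rule bounded_subset[of "ball 0 r"]) auto
    show "1 - (\<eta> / 2) ^ DIM('a) < 1" using \<eta> by simp
    let ?\<theta> = "1 - (\<eta> / 2) ^ DIM('a)"
    have \<theta>0: "0 \<le> ?\<theta>" using \<eta> by (simp add: power_le_one)
    fix U :: "'a set" and e :: real
    assume U: "open U" "P \<eta> \<inter> ball 0 r \<subseteq> U" "U \<in> lmeasurable" and e: "0 < e"
    \<comment> \<open>A ball is coded by its centre and the centre of its hole; the factor 2 and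
      \<open>\<eta> \<le> 1\<close> keep the hole inside the ball.\<close>
    define K where "K = {(x, z). x \<in> P \<eta> \<and> 0 < dist x z \<and> cball x (2 * dist x z) \<subseteq> U \<and> ball z (\<eta> * dist x z) \<inter> A = {}}"
    define rad where "rad = (\<lambda>(x::'a, z). 2 * dist x z)"
    obtain C where C: "countable C" "C \<subseteq> K"
      "pairwise (\<lambda>i j. disjnt (cball (fst i) (rad i)) (cball (fst j) (rad j))) C"
      "negligible (P \<eta> \<inter> ball 0 r - (\<Union>i\<in>C. cball (fst i) (rad i)))"
    proof (rule Vitali_covering_theorem_cballs[of K rad "P \<eta> \<inter> ball 0 r" fst])
      show "0 < rad i" if "i \<in> K" for i using that by (auto simp: K_def rad_def)
      fix x and d :: real assume x: "x \<in> P \<eta> \<inter> ball 0 r" and d: "0 < d"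
      obtain s where s: "0 < s" "cball x s \<subseteq> U" using U x open_contains_cball by (metis subsetD)
      have "0 < min d s / 2" using d s by simp
      then obtain z where z: "0 < dist x z" "dist x z < min d s / 2" "ball z (\<eta> * dist x z) \<inter> A = {}"
        using x unfolding P_def by blast
      have "cball x (2 * dist x z) \<subseteq> cball x s" using z by (intro subset_cball) auto
      then have "(x, z) \<in> K" using x z s by (auto simp: K_def)
      then show "\<exists>i. i \<in> K \<and> x \<in> cball (fst i) (rad i) \<and> rad i < d"
        using z by (intro exI[of _ "(x,z)"]) (auto simp: rad_def)
    qed auto
    define B where "B = (\<lambda>i::'a\<times>'a. ball (snd i) (\<eta> * dist (fst i) (snd i)))"
    define V where "V = (\<Union>i\<in>C. cball (fst i) (rad i) - B i)"
    have Ci: "fst i \<in> P \<eta>" "0 < dist (fst i) (snd i)" "cball (fst i) (rad i) \<subseteq> U" "B i \<inter> A = {}" if "i \<in> C" for i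
    proof -
      have "(fst i, snd i) \<in> K" using that C(2) by auto
      then show "fst i \<in> P \<eta>" "0 < dist (fst i) (snd i)" "cball (fst i) (rad i) \<subseteq> U" "B i \<inter> A = {}"
        unfolding K_def B_def rad_def case_prod_beta by simp_all
    qed
    have sub: "B i \<subseteq> cball (fst i) (rad i)" for i
    proof
      fix y assume "y \<in> B i"
      then have "dist (snd i) y < \<eta> * dist (fst i) (snd i)" by (simp add: B_def)
      also have "\<dots> \<le> dist (fst i) (snd i)" using \<eta> by (simp add: mult_left_le_one_le)
      finally show "y \<in> cball (fst i) (rad i)"
        using dist_triangle[of "fst i" y "snd i"] by (simp add: rad_def case_prod_beta)
    qed
    have ball_eq: "emeasure lebesgue (cball (fst i) (rad i) - B i) = ennreal ?\<theta> * emeasure lebesgue (cball (fst i) (rad i))"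
      if "i \<in> C" for i
    proof -
      let ?d = "dist (fst i) (snd i)"
      have m1: "measure lebesgue (cball (fst i) (rad i)) = unit_ball_vol DIM('a) * (2 * ?d) ^ DIM('a)"
        using Ci[OF that] by (simp add: content_cball rad_def case_prod_beta)
      have m2: "measure lebesgue (B i) = unit_ball_vol DIM('a) * (\<eta> * ?d) ^ DIM('a)"
        using Ci[OF that] \<eta> by (simp add: content_ball B_def)
      have "measure lebesgue (cball (fst i) (rad i) - B i) = measure lebesgue (cball (fst i) (rad i)) - measure lebesgue (B i)"
        by (rule measurable_measure_Diff) (use sub in \<open>auto simp: B_def\<close>)
      also have "\<dots> = ?\<theta> * measure lebesgue (cball (fst i) (rad i))"
        unfolding m1 m2 by (simp add: algebra_simps power_mult_distrib power_divide)
      finally have "measure lebesgue (cball (fst i) (rad i) - B i) = ?\<theta> * measure lebesgue (cball (fst i) (rad i))" .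
      moreover have "cball (fst i) (rad i) - B i \<in> lmeasurable" by (auto simp: B_def intro!: fmeasurable_Diff)
      moreover have "cball (fst i) (rad i) \<in> lmeasurable" by simp
      ultimately show ?thesis using \<theta>0 by (simp only: emeasure_eq_measure2 ennreal_mult measure_nonneg)
    qed
    have disj1: "disjoint_family_on (\<lambda>i. cball (fst i) (rad i)) C"
      using C(3) by (auto simp: disjoint_family_on_def pairwise_def disjnt_def)
    then have disj2: "disjoint_family_on (\<lambda>i. cball (fst i) (rad i) - B i) C"
      by (rule disjoint_family_on_bisimulation) auto
    have "V \<in> lmeasurable \<and> measure lebesgue V \<le> ?\<theta> * measure lebesgue U"
      unfolding V_def
    proof (rule measure_UN_scaled_le[OF C(1) disj1 disj2 _ _ _ Ci(3) U(3) \<theta>0])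
      show "emeasure lebesgue (cball (fst i) (rad i) - B i) \<le> ennreal ?\<theta> * emeasure lebesgue (cball (fst i) (rad i))"
        if "i \<in> C" for i using ball_eq[OF that] by (rule eq_refl)
    qed (auto simp: B_def intro!: sets.Diff)
    moreover have "negligible (P \<eta> \<inter> ball 0 r - V)"
    proof (rule negligible_subset[OF C(4)])
      show "P \<eta> \<inter> ball 0 r - V \<subseteq> P \<eta> \<inter> ball 0 r - (\<Union>i\<in>C. cball (fst i) (rad i))"
        using Ci(4) unfolding V_def P_def by blast
    qed
    ultimately show "\<exists>V\<in>lmeasurable. negligible (P \<eta> \<inter> ball 0 r - V) \<and> measure lebesgue V \<le> ?\<theta> * measure lebesgue U + e"
      using e by (intro bexI[of _ V]) auto
  qed
  have "negligible (\<Union>n::nat. \<Union>m::nat. P (1 / (1 + real n)) \<inter> ball 0 (real m))"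
    by (intro negligible_Union_nat neg) auto
  moreover have "porous_points A \<subseteq> (\<Union>n::nat. \<Union>m::nat. P (1 / (1 + real n)) \<inter> ball 0 (real m))"
  proof
    fix x assume "x \<in> porous_points A"
    then obtain \<eta> where x: "x \<in> A" and \<eta>: "0 < \<eta>"
      "\<And>\<rho>. \<rho> > 0 \<Longrightarrow> \<exists>z. 0 < dist x z \<and> dist x z < \<rho> \<and> ball z (\<eta> * dist x z) \<inter> A = {}"
      unfolding porous_points_def by blast
    obtain n :: nat where n: "1 / (1 + real n) < \<eta>"
      using \<eta>(1) nat_approx_posE[of \<eta>] by (auto simp: add.commute)
    obtain m :: nat where m: "norm x < real m" using reals_Archimedean2 by blast
    have "x \<in> P (1 / (1 + real n))" unfolding P_def
    proof safe
      fix \<rho> :: real assume "\<rho> > 0"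
      then obtain z where z: "0 < dist x z" "dist x z < \<rho>" "ball z (\<eta> * dist x z) \<inter> A = {}" using \<eta>(2) by blast
      have "ball z (1 / (1 + real n) * dist x z) \<subseteq> ball z (\<eta> * dist x z)"
        using n z by (intro subset_ball mult_right_mono) auto
      then show "\<exists>z. 0 < dist x z \<and> dist x z < \<rho> \<and> ball z (1 / (1 + real n) * dist x z) \<inter> A = {}" using z by blast
    qed (rule x)
    then show "x \<in> (\<Union>n::nat. \<Union>m::nat. P (1 / (1 + real n)) \<inter> ball 0 (real m))" using m by auto
  qed
  ultimately show ?thesis by (rule negligible_subset)
qed


section \<open>From directional derivatives to differentiability in the plane\<close>

lemma differentiable_if_approximately_linear:
  fixes f :: "'a::euclidean_space \<Rightarrow> real"
  assumes approx: "\<And>e. 0 < e \<Longrightarrow> \<exists>w. \<exists>d>0. \<forall>y. norm (y - x) < d \<longrightarrow> \<bar>f y - f x - w \<bullet> (y - x)\<bar> \<le> e * norm (y - x)"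
  shows "f differentiable (at x)"
proof -
  define e where "e = (\<lambda>n::nat. 1 / (1 + real n))"
  have e0: "0 < e n" for n by (simp add: e_def)
  obtain w d where d0: "\<And>n. 0 < d n"
    and w: "\<And>n y. norm (y - x) < d n \<Longrightarrow> \<bar>f y - f x - w n \<bullet> (y - x)\<bar> \<le> e n * norm (y - x)"
    using approx[OF e0] by metis
  \<comment> \<open>Two approximate gradients are tested against each other in the direction of
    their difference, at a point where both approximations hold. Hence they form a Cauchy sequence,
    whose limit is the gradient.\<close>
  have close: "norm (w n - w m) \<le> e n + e m" for n m
  proof (cases "w n = w m")
    case True
    then show ?thesis using e0[of n] e0[of m] by simp
  next
    case False
    define h where "h = w n - w m"
    have h0: "0 < norm h" using False by (simp add: h_def)
    define s where "s = min (d n) (d m) / (2 * norm h)"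
    have s0: "0 < s" using d0[of n] d0[of m] h0 by (simp add: s_def)
    have ns: "norm (s *\<^sub>R h) < d n" "norm (s *\<^sub>R h) < d m"
      using d0[of n] d0[of m] h0 by (auto simp: s_def)
    have "\<bar>f (x + s *\<^sub>R h) - f x - w n \<bullet> (s *\<^sub>R h)\<bar> \<le> e n * norm (s *\<^sub>R h)"
         "\<bar>f (x + s *\<^sub>R h) - f x - w m \<bullet> (s *\<^sub>R h)\<bar> \<le> e m * norm (s *\<^sub>R h)"
      using w[of "x + s *\<^sub>R h" n] w[of "x + s *\<^sub>R h" m] ns by auto
    then have "\<bar>w n \<bullet> (s *\<^sub>R h) - w m \<bullet> (s *\<^sub>R h)\<bar> \<le> (e n + e m) * norm (s *\<^sub>R h)"
      unfolding distrib_right by linarith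
    moreover have "w n \<bullet> (s *\<^sub>R h) - w m \<bullet> (s *\<^sub>R h) = s * (norm h * norm h)"
      by (simp add: h_def inner_diff_left[symmetric] power2_norm_eq_inner[symmetric] power2_eq_square flip: right_diff_distrib)
    ultimately have "s * (norm h * norm h) \<le> s * ((e n + e m) * norm h)"
      using s0 by (simp add: algebra_simps abs_le_iff)
    then show ?thesis using s0 h0 by (simp add: h_def)
  qed
  have elim: "e \<longlonglongrightarrow> 0" unfolding e_def using LIMSEQ_inverse_real_of_nat by (simp add: inverse_eq_divide add.commute)
  have "Cauchy w"
  proof (rule metric_CauchyI)
    fix r :: real assume "0 < r"
    then obtain M where M: "\<And>n. n \<ge> M \<Longrightarrow> e n < r / 2"
      using order_tendstoD(2)[OF elim, of "r/2"] by (auto simp: eventually_sequentially)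
    show "\<exists>M. \<forall>m\<ge>M. \<forall>n\<ge>M. dist (w m) (w n) < r"
    proof (intro exI allI impI)
      fix m n assume "m \<ge> M" "n \<ge> M"
      then show "dist (w m) (w n) < r" using close[of m n] M[of m] M[of n] by (simp add: dist_norm)
    qed
  qed
  then obtain l where l: "w \<longlonglongrightarrow> l" using Cauchy_convergent convergent_def by blast
  have ln: "norm (w n - l) \<le> e n" for n
  proof (rule LIMSEQ_le)
    show "(\<lambda>m. norm (w n - w m)) \<longlonglongrightarrow> norm (w n - l)" by (intro tendsto_intros l)
    show "(\<lambda>m. e n + e m) \<longlonglongrightarrow> e n"
      using tendsto_add[OF tendsto_const[of "e n"] elim] by simp
  qed (use close in auto)
  have "(f has_derivative (\<lambda>h. l \<bullet> h)) (at x)"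
    unfolding has_derivative_at_alt
  proof (intro conjI allI impI)
    show "bounded_linear (\<lambda>h. l \<bullet> h)" by (rule bounded_linear_inner_right)
    fix r :: real assume "0 < r"
    then obtain n where n: "e n < r / 2"
      using order_tendstoD(2)[OF elim, of "r/2"] by (auto simp: eventually_sequentially)
    show "\<exists>d>0. \<forall>y. norm (y - x) < d \<longrightarrow> norm (f y - f x - l \<bullet> (y - x)) \<le> r * norm (y - x)"
    proof (intro exI[of _ "d n"] conjI allI impI d0)
      fix y assume y: "norm (y - x) < d n"
      have "\<bar>(w n - l) \<bullet> (y - x)\<bar> \<le> norm (w n - l) * norm (y - x)" by (rule Cauchy_Schwarz_ineq2)
      also have "\<dots> \<le> e n * norm (y - x)" using ln by (intro mult_right_mono) auto
      finally have "\<bar>f y - f x - l \<bullet> (y - x)\<bar> \<le> 2 * e n * norm (y - x)"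
        using w[OF y] by (simp add: inner_diff_left)
      also have "\<dots> \<le> r * norm (y - x)" using n by (intro mult_right_mono) auto
      finally show "norm (f y - f x - l \<bullet> (y - x)) \<le> r * norm (y - x)" by simp
    qed
  qed
  then show ?thesis by (auto simp: differentiable_def)
qed

definition slope_approx :: "('a::real_vector \<Rightarrow> real) \<Rightarrow> 'a \<Rightarrow> real \<Rightarrow> real \<Rightarrow> real \<Rightarrow> 'a set" where
  "slope_approx f v e c d = {x. \<forall>t. \<bar>t\<bar> < d \<longrightarrow> \<bar>f (x + t *\<^sub>R v) - f x - c * t\<bar> \<le> e * \<bar>t\<bar>}"

text \<open>Existence of the derivative along \<open>v\<close>, written with countably many closed
  conditions, so that the set is Borel for continuous \<open>f\<close>. The indices
  \<open>n\<close>, \<open>c\<close>, \<open>m\<close> also enumerate the sets whose porosity points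
  are discarded in the theorem below.\<close>

definition dir_diff_set :: "('a::real_vector \<Rightarrow> real) \<Rightarrow> 'a \<Rightarrow> 'a set" where
  "dir_diff_set f v = (\<Inter>n::nat. \<Union>c\<in>\<rat>. \<Union>m::nat. slope_approx f v (1 / (1 + real n)) c (1 / (1 + real m)))"

lemma dir_diff_setD:
  assumes "x \<in> dir_diff_set f v" "0 < e"
  obtains n m c where "c \<in> \<rat>" "1 / (1 + real n) < e" "x \<in> slope_approx f v (1 / (1 + real n)) c (1 / (1 + real m))"
proof -
  obtain n :: nat where "1 / (1 + real n) < e"
    using assms(2) nat_approx_posE[of e] by (auto simp: add.commute)
  then show ?thesis using assms(1) that unfolding dir_diff_set_def by blast
qed

lemma negligible_not_dir_diff_set:
  fixes f :: "'a::euclidean_space \<Rightarrow> real"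
  assumes lip: "L-lipschitz_on UNIV f"
  shows "negligible (- dir_diff_set f v)"
proof (rule negligible_if_negligible_on_lines[where v = v])
  have contf: "continuous_on UNIV f" using lip by (rule lipschitz_on_continuous_on)
  have "closed (slope_approx f v e c d)" for e c d
  proof -
    have "slope_approx f v e c d = (\<Inter>t\<in>{t. \<bar>t\<bar> < d}. {x. \<bar>f (x + t *\<^sub>R v) - f x - c * t\<bar> \<le> e * \<bar>t\<bar>})"
      by (auto simp: slope_approx_def)
    then show ?thesis
      by (auto intro!: closed_INT closed_Collect_le continuous_intros continuous_on_compose2[OF contf])
  qed
  then show "- dir_diff_set f v \<in> sets borel"
    unfolding dir_diff_set_def
    by (intro borel_comp sets.countable_INT'' sets.countable_UN'' countable_rat borel_closed) auto
  fix x
  define g where "g = (\<lambda>t::real. f (x + t *\<^sub>R v))"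
  have "(L * norm v)-lipschitz_on UNIV g"
  proof (rule lipschitz_onI)
    show "dist (g s) (g t) \<le> L * norm v * dist s t" for s t
      using lipschitz_onD[OF lip, of "x + s *\<^sub>R v" "x + t *\<^sub>R v"]
      by (simp add: g_def dist_norm flip: scaleR_diff_left) (simp add: algebra_simps)
    show "0 \<le> L * norm v" using lipschitz_on_nonneg[OF lip] by simp
  qed
  then have neg: "negligible {t. \<not> g differentiable (at t)}" by (rule lipschitz_real_differentiable_ae)
  have "x + t *\<^sub>R v \<in> dir_diff_set f v" if diff: "g differentiable (at t)" for t
  proof -
    obtain D where D: "(g has_field_derivative D) (at t)" using diff real_differentiable_def by blast
    show ?thesis unfolding dir_diff_set_def
    proof (intro INT_I)
      fix n :: nat
      let ?e = "1 / (1 + real n)"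
      obtain c where c: "c \<in> \<rat>" "D < c" "c < D + ?e / 2"
        using Rats_dense_in_real[of D "D + ?e/2"] by auto
      have D': "(g has_derivative (\<lambda>h. D * h)) (at t)" using D by (simp add: has_field_derivative_def)
      have "0 < ?e / 2" by simp
      then obtain d where d: "0 < d" "\<And>y. \<bar>y - t\<bar> < d \<Longrightarrow> \<bar>g y - g t - D * (y - t)\<bar> \<le> ?e / 2 * \<bar>y - t\<bar>"
        using D' unfolding has_derivative_at_alt real_norm_def by blast
      obtain m :: nat where m: "1 / (1 + real m) < d" using d(1) nat_approx_posE[of d] by (auto simp: add.commute)
      have "x + t *\<^sub>R v \<in> slope_approx f v ?e c (1 / (1 + real m))"
        unfolding slope_approx_def
      proof safe
        fix s :: real assume "\<bar>s\<bar> < 1 / (1 + real m)"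
        then have 1: "\<bar>g (t + s) - g t - D * s\<bar> \<le> ?e / 2 * \<bar>s\<bar>" using d(2)[of "t + s"] m by simp
        have 2: "\<bar>(c - D) * s\<bar> \<le> ?e / 2 * \<bar>s\<bar>" unfolding abs_mult using c by (intro mult_right_mono) auto
        have "\<bar>g (t + s) - g t - c * s\<bar> \<le> \<bar>g (t + s) - g t - D * s\<bar> + \<bar>(c - D) * s\<bar>"
          unfolding left_diff_distrib by linarith
        also have "\<dots> \<le> ?e / 2 * \<bar>s\<bar> + ?e / 2 * \<bar>s\<bar>" using 1 2 by (rule add_mono)
        also have "\<dots> = ?e * \<bar>s\<bar>" by (simp only: distrib_right[symmetric] field_sum_of_halves)
        finally show "\<bar>f (x + t *\<^sub>R v + s *\<^sub>R v) - f (x + t *\<^sub>R v) - c * s\<bar> \<le> ?e * \<bar>s\<bar>"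
          by (simp add: g_def scaleR_add_left add.assoc)
      qed
      then show "x + t *\<^sub>R v \<in> (\<Union>c\<in>\<rat>. \<Union>m::nat. slope_approx f v ?e c (1 / (1 + real m)))"
        using c(1) by blast
    qed
  qed
  then show "negligible {t. x + t *\<^sub>R v \<in> - dir_diff_set f v}"
    by (intro negligible_subset[OF neg]) auto
qed

text \<open>At \<open>x\<close>, move first along \<open>e1\<close> and then along \<open>e2\<close>. The slope of the second step is controlled because
  the intermediate point lies close to a point where the difference quotient along \<open>e2\<close> is
  uniformly approximated by the same \<open>c2\<close> as at \<open>x\<close>; this fails only if \<open>x\<close> is a porosity point of that set.\<close>
theorem Rademacher_plane:
  fixes f :: "real^2 \<Rightarrow> real"
  assumes lip: "L-lipschitz_on UNIV f"
  shows "negligible {x. \<not> f differentiable (at x)}"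
proof -
  define e1 e2 :: "real^2" where "e1 = axis 1 1" and "e2 = axis 2 1"
  have nrm: "norm e1 = 1" "norm e2 = 1" by (auto simp: e1_def e2_def norm_axis_1)
  have L0: "0 \<le> L" using lip lipschitz_on_nonneg by blast
  have fl: "\<bar>f y - f z\<bar> \<le> L * norm (y - z)" for y z using lipschitz_onD[OF lip, of y z] by (simp add: dist_norm)
  define Q where "Q = (\<Union>n::nat. \<Union>c\<in>\<rat>. \<Union>m::nat. porous_points (slope_approx f e2 (1 / (1 + real n)) c (1 / (1 + real m))))"
  define N where "N = - dir_diff_set f e1 \<union> - dir_diff_set f e2 \<union> Q"
  have "negligible Q" unfolding Q_def
    by (rule negligible_Union_nat, rule negligible_countable_Union)
      (auto intro!: negligible_Union_nat negligible_porous_points countable_rat)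
  then have "negligible N" unfolding N_def by (intro negligible_Un negligible_not_dir_diff_set[OF lip])
  moreover have "f differentiable (at x)" if x: "x \<notin> N" for x
  proof (rule differentiable_if_approximately_linear)
    fix \<epsilon> :: real assume \<epsilon>: "0 < \<epsilon>"
    \<comment> \<open>The errors are \<open>e * \<bar>h\<bar>\<close> and
      \<open>e * \<bar>l\<bar>\<close> from the two steps, and twice
      \<open>L * (e * \<bar>h\<bar>)\<close> for passing between \<open>z\<close> and
      \<open>k\<close>.\<close>
    define e where "e = \<epsilon> / (2 * L + 2)"
    have e: "0 < e" "(2 * L + 2) * e = \<epsilon>" using \<epsilon> L0 by (auto simp: e_def)
    have x1: "x \<in> dir_diff_set f e1" and x2: "x \<in> dir_diff_set f e2" and xQ: "x \<notin> Q" using x by (auto simp: N_def)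
    obtain n1 m1 c1 where 1: "c1 \<in> \<rat>" "1 / (1 + real n1) < e" "x \<in> slope_approx f e1 (1 / (1 + real n1)) c1 (1 / (1 + real m1))"
      by (rule dir_diff_setD[OF x1 e(1)])
    obtain n2 m2 c2 where 2: "c2 \<in> \<rat>" "1 / (1 + real n2) < e" "x \<in> slope_approx f e2 (1 / (1 + real n2)) c2 (1 / (1 + real m2))"
      by (rule dir_diff_setD[OF x2 e(1)])
    define A where "A = slope_approx f e2 (1 / (1 + real n2)) c2 (1 / (1 + real m2))"
    have "x \<in> A" "x \<notin> porous_points A" using 2 xQ unfolding Q_def A_def by blast+
    \<comment> \<open>Non-porosity with the constant \<open>e\<close>: every point at a small
      distance s from \<open>x\<close> has a point of \<open>A\<close> within \<open>e\<close> times
      s.\<close>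
    then have "\<exists>\<rho>>0. \<forall>z. \<not> (0 < dist x z \<and> dist x z < \<rho> \<and> ball z (e * dist x z) \<inter> A = {})"
      unfolding porous_points_def using e(1) by blast
    then obtain \<rho> where \<rho>: "0 < \<rho>" "\<And>z. 0 < dist x z \<Longrightarrow> dist x z < \<rho> \<Longrightarrow> ball z (e * dist x z) \<inter> A \<noteq> {}" by blast
    define d where "d = min \<rho> (min (1 / (1 + real m1)) (1 / (1 + real m2)))"
    define w where "w = c1 *\<^sub>R e1 + c2 *\<^sub>R e2"
    have "\<bar>f y - f x - w \<bullet> (y - x)\<bar> \<le> \<epsilon> * norm (y - x)" if y: "norm (y - x) < d" for y
    proof -
      define h l where "h = (y - x) $ 1" and "l = (y - x) $ 2"
      have yx: "y = x + h *\<^sub>R e1 + l *\<^sub>R e2"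
        by (simp add: vec_eq_iff forall_2 h_def l_def e1_def e2_def axis_def)
      have hl: "\<bar>h\<bar> \<le> norm (y - x)" "\<bar>l\<bar> \<le> norm (y - x)"
        unfolding h_def l_def using component_le_norm_cart by blast+
      have wyx: "w \<bullet> (y - x) = c1 * h + c2 * l"
        by (simp add: w_def e1_def e2_def inner_axis' inner_add_left h_def l_def)
      define z where "z = x + h *\<^sub>R e1"
      have dz: "dist x z = \<bar>h\<bar>" by (simp add: z_def dist_norm nrm)
      have "\<exists>k\<in>A. norm (k - z) \<le> e * \<bar>h\<bar>"
      proof (cases "h = 0")
        case True
        then show ?thesis using \<open>x \<in> A\<close> by (auto simp: z_def)
      next
        case False
        then obtain k where "k \<in> ball z (e * dist x z)" "k \<in> A" using \<rho>(2)[of z] hl y by (auto simp: dz d_def)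
        then show ?thesis by (intro bexI[of _ k]) (use dz in \<open>auto simp: dist_norm norm_minus_commute\<close>)
      qed
      then obtain k where k: "k \<in> A" "norm (k - z) \<le> e * \<bar>h\<bar>" by blast
      have b1: "\<bar>f z - f x - c1 * h\<bar> \<le> e * \<bar>h\<bar>"
      proof -
        have "\<bar>h\<bar> < 1 / (1 + real m1)" using hl y by (auto simp: d_def)
        then have "\<bar>f z - f x - c1 * h\<bar> \<le> 1 / (1 + real n1) * \<bar>h\<bar>"
          using 1(3) unfolding slope_approx_def z_def by blast
        also have "\<dots> \<le> e * \<bar>h\<bar>" using 1(2) by (intro mult_right_mono) auto
        finally show ?thesis .
      qed
      have b2: "\<bar>f (k + l *\<^sub>R e2) - f k - c2 * l\<bar> \<le> e * \<bar>l\<bar>"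
      proof -
        have "\<bar>l\<bar> < 1 / (1 + real m2)" using hl y by (auto simp: d_def)
        then have "\<bar>f (k + l *\<^sub>R e2) - f k - c2 * l\<bar> \<le> 1 / (1 + real n2) * \<bar>l\<bar>"
          using k(1) unfolding A_def slope_approx_def by blast
        also have "\<dots> \<le> e * \<bar>l\<bar>" using 2(2) by (intro mult_right_mono) auto
        finally show ?thesis .
      qed
      have Lk: "L * norm (k - z) \<le> L * (e * \<bar>h\<bar>)" using k(2) L0 by (intro mult_left_mono) auto
      have "norm (y - (k + l *\<^sub>R e2)) = norm (z - k)" by (simp add: yx z_def)
      then have b3: "\<bar>f y - f (k + l *\<^sub>R e2)\<bar> \<le> L * (e * \<bar>h\<bar>)"
        using fl[of y "k + l *\<^sub>R e2"] Lk by (simp only: norm_minus_commute[of z k])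
      have b4: "\<bar>f k - f z\<bar> \<le> L * (e * \<bar>h\<bar>)" using fl[of k z] Lk by simp
      have "\<bar>f y - f x - w \<bullet> (y - x)\<bar> \<le> 2 * (L * (e * \<bar>h\<bar>)) + e * \<bar>h\<bar> + e * \<bar>l\<bar>"
        unfolding wyx using b1 b2 b3 b4 by linarith
      also have "\<dots> \<le> 2 * (L * (e * norm (y - x))) + e * norm (y - x) + e * norm (y - x)"
        using hl L0 e by (intro add_mono mult_left_mono) auto
      also have "\<dots> = \<epsilon> * norm (y - x)" unfolding e(2)[symmetric] by (simp add: algebra_simps)
      finally show ?thesis .
    qed
    moreover have "0 < d" using \<rho> by (simp add: d_def)
    ultimately show "\<exists>w. \<exists>d>0. \<forall>y. norm (y - x) < d \<longrightarrow> \<bar>f y - f x - w \<bullet> (y - x)\<bar> \<le> \<epsilon> * norm (y - x)" by blast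
  qed
  then have "{x. \<not> f differentiable (at x)} \<subseteq> N" by blast
  ultimately show ?thesis by (rule negligible_subset)
qed

text \<open>Composing with the nearest-point map onto a ball, which is 1-Lipschitz, extends
  \<open>f\<close> from that ball to a Lipschitz function on the plane without changing it
  inside.\<close>

corollary locally_Rademacher_plane:
  fixes f :: "real^2 \<Rightarrow> real"
  assumes \<Omega>: "open \<Omega>" and lip: "\<And>K. compact K \<Longrightarrow> K \<subseteq> \<Omega> \<Longrightarrow> \<exists>L. L-lipschitz_on K f"
  shows "negligible {x\<in>\<Omega>. \<not> f differentiable (at x)}"
  unfolding locally_negligible_alt[of "{x\<in>\<Omega>. \<not> f differentiable (at x)}"]
proof safe
  let ?S = "{x\<in>\<Omega>. \<not> f differentiable (at x)}"
  fix x assume x: "x \<in> \<Omega>" "\<not> f differentiable (at x)"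
  obtain r where r: "0 < r" "cball x r \<subseteq> \<Omega>" using \<Omega> x open_contains_cball by blast
  obtain L where L: "L-lipschitz_on (cball x r) f" using lip[of "cball x r"] r by auto
  define g where "g = f \<circ> closest_point (cball x r)"
  have "L-lipschitz_on UNIV g"
  proof (rule lipschitz_onI)
    fix y z
    have ne: "cball x r \<noteq> {}" using r by simp
    have "closest_point (cball x r) y \<in> cball x r" "closest_point (cball x r) z \<in> cball x r"
      using closest_point_in_set[OF closed_cball ne] by blast+
    then have "dist (g y) (g z) \<le> L * dist (closest_point (cball x r) y) (closest_point (cball x r) z)"
      unfolding g_def comp_def by (rule lipschitz_onD[OF L])
    also have "\<dots> \<le> L * dist y z"
      using lipschitz_on_nonneg[OF L] closest_point_lipschitz[OF convex_cball closed_cball ne]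
      by (intro mult_left_mono) auto
    finally show "dist (g y) (g z) \<le> L * dist y z" .
  qed (rule lipschitz_on_nonneg[OF L])
  then have "negligible {y. \<not> g differentiable (at y)}" by (rule Rademacher_plane)
  moreover have "?S \<inter> ball x r \<subseteq> {y. \<not> g differentiable (at y)}"
  proof safe
    fix y assume y: "y \<in> ball x r" "\<not> f differentiable (at y)" "g differentiable (at y)"
    have "g z = f z" if "z \<in> ball x r" for z
      using that closest_point_self[of z "cball x r"] by (simp add: g_def)
    moreover obtain d where "0 < d" "ball y d \<subseteq> ball x r" using y(1) by (meson openE open_ball)
    ultimately have "f differentiable (at y)"
      by (intro differentiable_transform_within[OF y(3)]) (auto simp: dist_commute subset_eq)
    with y(2) show False by blast
  qed
  ultimately have "negligible (?S \<inter> ball x r)" by (rule negligible_subset)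
  moreover have "openin (top_of_set ?S) (?S \<inter> ball x r)" by (rule openin_open_Int) simp
  ultimately show "\<exists>U. openin (top_of_set ?S) U \<and> x \<in> U \<and> negligible U" using x r by (intro exI[of _ "?S \<inter> ball x r"]) auto
qed

section \<open>Integration by parts\<close>

lemma borel_measurable_lebesgue_cong_AE:
  fixes f g :: "'a::euclidean_space \<Rightarrow> 'b::topological_space"
  assumes g: "g \<in> borel_measurable lebesgue" and eq: "AE x in lebesgue. f x = g x"
  shows "f \<in> borel_measurable lebesgue"
proof (rule measurableI)
  fix A :: "'b set" assume A: "A \<in> sets borel"
  have 1: "g -` A \<inter> space lebesgue \<in> sets lebesgue" using g A by (rule measurable_sets)
  have "AE x in lebesgue. x \<in> g -` A \<inter> space lebesgue \<longleftrightarrow> x \<in> f -` A \<inter> space lebesgue"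
    using eq by eventually_elim auto
  then show "f -` A \<inter> space lebesgue \<in> sets lebesgue"
    by (rule completion.in_sets_AE[OF _ 1]) auto
qed auto

text \<open>The limits to be treated are derivatives that exist only almost everywhere; completeness
  of Lebesgue measure supplies their measurability.\<close>

lemma dominated_convergence_lebesgue:
  fixes F :: "nat \<Rightarrow> 'a::euclidean_space \<Rightarrow> real"
  assumes F: "\<And>n. F n \<in> borel_measurable lebesgue" and G: "integrable lebesgue G"
    and lim: "AE x in lebesgue. (\<lambda>n. F n x) \<longlonglongrightarrow> f x"
    and bnd: "\<And>n x. \<bar>F n x\<bar> \<le> G x"
  shows "integrable lebesgue f" "(\<lambda>n. integral\<^sup>L lebesgue (F n)) \<longlonglongrightarrow> integral\<^sup>L lebesgue f"
proof -
  have "(\<lambda>x. lim (\<lambda>n. F n x)) \<in> borel_measurable lebesgue" using F by measurable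
  moreover have "AE x in lebesgue. f x = lim (\<lambda>n. F n x)" using lim by eventually_elim (simp add: limI)
  ultimately have f: "f \<in> borel_measurable lebesgue" by (rule borel_measurable_lebesgue_cong_AE)
  show "integrable lebesgue f"
    by (rule integrable_dominated_convergence[OF f F G lim]) (use bnd in auto)
  show "(\<lambda>n. integral\<^sup>L lebesgue (F n)) \<longlonglongrightarrow> integral\<^sup>L lebesgue f"
    by (rule integral_dominated_convergence[OF f F G lim]) (use bnd in auto)
qed

lemma has_derivative_directional_limit:
  fixes f :: "'a::real_normed_vector \<Rightarrow> real"
  assumes f: "(f has_derivative f') (at x)" and s: "filterlim s (at 0) F"
  shows "((\<lambda>n. (f (x + s n *\<^sub>R e) - f x) / s n) \<longlongrightarrow> f' e) F"
proof -
  have lin: "linear f'" using f by (rule has_derivative_linear)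
  have "((\<lambda>t::real. f (x + t *\<^sub>R e)) has_derivative (\<lambda>t. f' (t *\<^sub>R e))) (at 0)"
    by (rule has_derivative_compose[of "\<lambda>t. x + t *\<^sub>R e" "\<lambda>t. t *\<^sub>R e" 0 UNIV f f'])
      (use f in \<open>auto intro!: derivative_eq_intros\<close>)
  then have "((\<lambda>t::real. f (x + t *\<^sub>R e)) has_field_derivative f' e) (at 0)"
    by (simp add: has_field_derivative_def linear_scale[OF lin] mult.commute[of _ "f' e"])
  then have "((\<lambda>t. (f (x + t *\<^sub>R e) - f x) / t) \<longlongrightarrow> f' e) (at 0)"
    by (simp add: has_field_derivative_iff)
  then show ?thesis using s by (rule filterlim_compose)
qed

lemma compact_neighbourhood:
  fixes K :: "'a::euclidean_space set"
  assumes "compact K" "open \<Omega>" "K \<subseteq> \<Omega>"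
  obtains K1 \<eta> where "compact K1" "K1 \<subseteq> \<Omega>" "0 < \<eta>" "\<And>x y. x \<in> K \<Longrightarrow> dist x y \<le> \<eta> \<Longrightarrow> y \<in> K1" "K \<subseteq> K1"
proof -
  obtain e where e: "e > 0" "(\<Union>x\<in>K. ball x e) \<subseteq> \<Omega>"
    using compact_subset_open_imp_ball_epsilon_subset assms by metis
  define K1 where "K1 = {x + y |x y. x \<in> K \<and> y \<in> cball 0 (e/2)}"
  have in1: "y \<in> K1" if "x \<in> K" "dist x y \<le> e/2" for x y
  proof -
    have "y - x \<in> cball 0 (e/2)" using that by (simp add: dist_norm norm_minus_commute)
    moreover have "y = x + (y - x)" by simp
    ultimately show ?thesis unfolding K1_def using that(1) by blast
  qed
  have "K1 \<subseteq> (\<Union>x\<in>K. ball x e)" unfolding K1_def using e by (force simp: dist_norm)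
  then have "K1 \<subseteq> \<Omega>" using e(2) by (rule subset_trans)
  moreover have "K \<subseteq> K1" using in1 e(1) by auto
  moreover have "compact K1" unfolding K1_def by (rule compact_sums[OF assms(1) compact_cball])
  ultimately show ?thesis using that[of K1 "e/2"] e(1) in1 by simp
qed

text \<open>Pairs closer than \<open>\<eta>\<close> are handled by the Lipschitz constant on a
  neighbourhood of the support, distant pairs by the supremum bound divided by
  \<open>\<eta>\<close>.\<close>

lemma lipschitz_on_UNIV_if_compact_support:
  fixes h :: "'a::euclidean_space \<Rightarrow> real"
  assumes \<Omega>: "open \<Omega>" and K: "compact K" "K \<subseteq> \<Omega>" and supp: "\<And>x. x \<notin> K \<Longrightarrow> h x = 0"
    and lip: "\<And>K. compact K \<Longrightarrow> K \<subseteq> \<Omega> \<Longrightarrow> \<exists>L. L-lipschitz_on K h"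
  obtains M where "M-lipschitz_on UNIV h"
proof -
  obtain K1 \<eta> where K1: "compact K1" "K1 \<subseteq> \<Omega>" "0 < \<eta>" "\<And>x y. x \<in> K \<Longrightarrow> dist x y \<le> \<eta> \<Longrightarrow> y \<in> K1" "K \<subseteq> K1"
    using compact_neighbourhood[OF K(1) \<Omega> K(2)] by metis
  obtain L where L: "L-lipschitz_on K1 h" using lip K1 by blast
  have "bounded (h ` K)"
    using K(1) L lipschitz_on_continuous_on lipschitz_on_subset[OF L K1(5)] by (metis compact_continuous_image compact_imp_bounded)
  then obtain B where "\<And>x. x \<in> K \<Longrightarrow> \<bar>h x\<bar> \<le> B" by (auto simp: bounded_iff)
  then have B: "\<bar>h x\<bar> \<le> \<bar>B\<bar>" for x using supp[of x] by (cases "x \<in> K") force+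
  have L0: "0 \<le> L" using L lipschitz_on_nonneg by blast
  have "(L + 2 * \<bar>B\<bar> / \<eta>)-lipschitz_on UNIV h"
  proof (rule lipschitz_onI)
    show "0 \<le> L + 2 * \<bar>B\<bar> / \<eta>" using L0 K1 by simp
    fix x y
    have near: "dist (h x) (h y) \<le> L * dist x y" if "x \<in> K" "dist x y \<le> \<eta>" for x y
      using lipschitz_onD[OF L, of x y] that K1(4)[of x y] K1(5) by auto
    consider "dist x y > \<eta>" | "dist x y \<le> \<eta>" "x \<in> K" | "dist x y \<le> \<eta>" "y \<in> K" | "x \<notin> K" "y \<notin> K" by linarith
    then show "dist (h x) (h y) \<le> (L + 2 * \<bar>B\<bar> / \<eta>) * dist x y"
    proof cases
      case 1
      have "dist (h x) (h y) \<le> 2 * \<bar>B\<bar>" using B[of x] B[of y] by (simp add: dist_real_def)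
      also have "\<dots> = 2 * \<bar>B\<bar> / \<eta> * \<eta>" using K1(3) by simp
      also have "\<dots> \<le> 2 * \<bar>B\<bar> / \<eta> * dist x y" using 1 K1(3) by (intro mult_left_mono) auto
      also have "\<dots> \<le> (L + 2 * \<bar>B\<bar> / \<eta>) * dist x y" using L0 by (intro mult_right_mono) auto
      finally show ?thesis .
    next
      case 2
      have "L * dist x y \<le> (L + 2 * \<bar>B\<bar> / \<eta>) * dist x y" using K1 by (intro mult_right_mono) auto
      then show ?thesis using near[of x y] 2 by linarith
    next
      case 3
      have "L * dist x y \<le> (L + 2 * \<bar>B\<bar> / \<eta>) * dist x y" using K1 by (intro mult_right_mono) auto
      then show ?thesis using near[of y x] 3 by (simp add: dist_commute)
    next
      case 4
      then show ?thesis using supp L0 K1 by simp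
    qed
  qed
  then show ?thesis by (rule that)
qed

lemma integral_translate_product:
  fixes f g :: "'a::euclidean_space \<Rightarrow> real"
  assumes [measurable]: "f \<in> borel_measurable borel" "g \<in> borel_measurable borel"
  shows "integral\<^sup>L lborel (\<lambda>x. f x * g (x + a)) = integral\<^sup>L lborel (\<lambda>x. f (x - a) * g x)"
proof -
  have "integral\<^sup>L lborel (\<lambda>x. f (x - a) * g x) = integral\<^sup>L (distr lborel borel ((+) a)) (\<lambda>x. f (x - a) * g x)"
    by (simp add: lborel_distr_plus)
  also have "\<dots> = integral\<^sup>L lborel (\<lambda>x. f (a + x - a) * g (a + x))"
    by (rule integral_distr) measurable
  finally show ?thesis by (simp add: add.commute)
qed

text \<open>For difference quotients, integration by parts is translation invariance of the
  integral. Rademacher's theorem and dominated convergence give the limit, the Lipschitz bounds on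
  \<open>v\<close> near \<open>K\<close> and on \<open>h\<close> providing the dominating
  functions.\<close>

lemma integral_by_parts_lipschitz:
  fixes v h :: "real^2 \<Rightarrow> real"
  assumes \<Omega>: "open \<Omega>" and lipv: "\<And>K. compact K \<Longrightarrow> K \<subseteq> \<Omega> \<Longrightarrow> \<exists>L. L-lipschitz_on K v"
    and liph: "M-lipschitz_on UNIV h" and K: "compact K" "K \<subseteq> \<Omega>" and supp: "\<And>x. x \<notin> K \<Longrightarrow> h x = 0"
  shows "set_integrable lebesgue \<Omega> (\<lambda>x. v x * pd j h x)"
    and "set_integrable lebesgue \<Omega> (\<lambda>x. h x * pd j v x)"
    and "(LINT x:\<Omega>|lebesgue. v x * pd j h x) = - (LINT x:\<Omega>|lebesgue. h x * pd j v x)"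
proof -
  define e :: "real^2" where "e = axis j 1"
  have ne: "norm e = 1" by (simp add: e_def norm_axis_1)
  obtain K1 \<eta> where K1: "compact K1" "K1 \<subseteq> \<Omega>" "0 < \<eta>" "\<And>x y. x \<in> K \<Longrightarrow> dist x y \<le> \<eta> \<Longrightarrow> y \<in> K1" "K \<subseteq> K1"
    using compact_neighbourhood[OF K(1) \<Omega> K(2)] by metis
  obtain L where L: "L-lipschitz_on K1 v" using lipv K1 by blast
  have L0: "0 \<le> L" using L lipschitz_on_nonneg by blast
  have M0: "0 \<le> M" using liph lipschitz_on_nonneg by blast
  have contv: "continuous_on K1 v" using L by (rule lipschitz_on_continuous_on)
  have conth: "continuous_on UNIV h" using liph by (rule lipschitz_on_continuous_on)
  obtain Bv where Bv: "\<And>x. x \<in> K1 \<Longrightarrow> \<bar>v x\<bar> \<le> Bv" 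
    using compact_imp_bounded[OF compact_continuous_image[OF contv K1(1)]] by (auto simp: bounded_iff)
  obtain Bh where Bh: "\<And>x. x \<in> K \<Longrightarrow> \<bar>h x\<bar> \<le> Bh"
    using compact_imp_bounded[OF compact_continuous_image[OF continuous_on_subset[OF conth] K(1)]] by (auto simp: bounded_iff)
  \<comment> \<open>\<open>vt\<close> may jump at the boundary of \<open>K1\<close>, but in
    \<open>G\<close> its differences count only at points of \<open>K\<close>, whose translates by
    at most \<open>\<eta>\<close> stay in \<open>K1\<close>.\<close>
  define vt where "vt = (\<lambda>x. indicat_real K1 x * v x)"
  have vtb[measurable]: "vt \<in> borel_measurable borel"
    unfolding vt_def using borel_measurable_continuous_on_indicator[OF _ contv] K1(1) by (simp add: borel_compact)
  have hb[measurable]: "h \<in> borel_measurable borel" using conth by (rule borel_measurable_continuous_onI)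
  define s where "s = (\<lambda>n. \<eta> / (real n + 1))"
  have s0: "0 < s n" "s n \<le> \<eta>" for n using K1(3) by (auto simp: s_def field_simps)
  have slim: "s \<longlonglongrightarrow> 0"
    unfolding s_def using tendsto_mult[OF tendsto_const[of \<eta>] LIMSEQ_inverse_real_of_nat]
    by (simp add: field_simps)
  have sat: "filterlim s (at 0) sequentially" "filterlim (\<lambda>n. - s n) (at 0) sequentially"
    using slim tendsto_minus[OF slim] s0 by (auto simp: filterlim_at intro!: always_eventually) (metis less_irrefl)+
  define F where "F = (\<lambda>n x. vt x * ((h (x + s n *\<^sub>R e) - h x) / s n))"
  define G where "G = (\<lambda>n x. h x * ((vt (x - s n *\<^sub>R e) - vt x) / s n))"
  have Fb: "F n \<in> borel_measurable borel" and Gb: "G n \<in> borel_measurable borel" for n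
    unfolding F_def G_def by measurable
  have Fm: "F n \<in> borel_measurable lebesgue" and Gm: "G n \<in> borel_measurable lebesgue" for n
    using Fb[of n] Gb[of n] by (auto intro: measurable_completion)
  have hl: "\<bar>h y - h x\<bar> \<le> M * norm (y - x)" for x y using lipschitz_onD[OF liph, of y x] by (simp add: dist_norm)
  have Fbd: "\<bar>F n x\<bar> \<le> \<bar>Bv\<bar> * M * indicator K1 x" for n x
  proof (cases "x \<in> K1")
    case True
    have "\<bar>(h (x + s n *\<^sub>R e) - h x) / s n\<bar> \<le> M" using hl[of "x + s n *\<^sub>R e" x] s0[of n] ne by (simp add: field_simps)
    moreover have "\<bar>vt x\<bar> \<le> \<bar>Bv\<bar>" using Bv[OF True] True by (simp add: vt_def)
    ultimately have "\<bar>F n x\<bar> \<le> \<bar>Bv\<bar> * M" unfolding F_def abs_mult by (intro mult_mono) auto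
    then show ?thesis using True by simp
  qed (simp add: F_def vt_def)
  have Gbd: "\<bar>G n x\<bar> \<le> \<bar>Bh\<bar> * L * indicator K x" for n x
  proof (cases "x \<in> K")
    case True
    have "dist x (x - s n *\<^sub>R e) \<le> \<eta>" using s0[of n] ne by (simp add: dist_norm)
    then have y: "x - s n *\<^sub>R e \<in> K1" "x \<in> K1" using K1 True by auto
    have "\<bar>vt (x - s n *\<^sub>R e) - vt x\<bar> \<le> L * s n"
      using lipschitz_onD[OF L y] y s0[of n] ne by (simp add: vt_def dist_norm)
    then have "\<bar>(vt (x - s n *\<^sub>R e) - vt x) / s n\<bar> \<le> L" using s0[of n] by (simp add: field_simps)
    moreover have "\<bar>h x\<bar> \<le> \<bar>Bh\<bar>" using Bh[OF True] by simp
    ultimately have "\<bar>G n x\<bar> \<le> \<bar>Bh\<bar> * L" unfolding G_def abs_mult by (intro mult_mono) auto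
    then show ?thesis using True by simp
  qed (simp add: G_def supp)
  have intK: "integrable lebesgue (\<lambda>x. c * indicator X x :: real)" if "compact X" for c and X :: "(real^2) set"
    using lmeasurable_compact[OF that] by (auto simp: fmeasurable_def intro!: integrable_mult_right integrable_real_indicator)
  have AEh: "AE x in lebesgue. h differentiable (at x)"
    using Rademacher_plane[OF liph] by (simp add: completion.AE_iff_null_sets negligible_iff_null_sets)
  have AEv: "AE x in lebesgue. x \<in> \<Omega> \<longrightarrow> v differentiable (at x)"
    using locally_Rademacher_plane[OF \<Omega> lipv] by (simp add: completion.AE_iff_null_sets negligible_iff_null_sets)
  have AEF: "AE x in lebesgue. (\<lambda>n. F n x) \<longlonglongrightarrow> indicat_real \<Omega> x * (v x * pd j h x)"
    using AEh
  proof eventually_elim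
    fix x assume d: "h differentiable (at x)"
    then have "(\<lambda>n. (h (x + s n *\<^sub>R e) - h x) / s n) \<longlonglongrightarrow> pd j h x"
      unfolding pd_def e_def[symmetric] by (intro has_derivative_directional_limit sat) (simp add: frechet_derivative_works[symmetric])
    then have lim: "(\<lambda>n. F n x) \<longlonglongrightarrow> vt x * pd j h x" unfolding F_def by (intro tendsto_intros)
    show "(\<lambda>n. F n x) \<longlonglongrightarrow> indicat_real \<Omega> x * (v x * pd j h x)"
    proof (cases "x \<in> K1")
      case True
      then show ?thesis using lim K1(2) by (auto simp: vt_def)
    next
      case False
      \<comment> \<open>The cut-off makes the quotients vanish off \<open>K1\<close>, so the claimed
        limit requires \<open>pd j h x = 0\<close> there.\<close>
      then have "x \<in> - K" using K1(5) by auto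
      then have "(h has_derivative (\<lambda>_. 0)) (at x)"
        by (intro has_derivative_transform_within_open[of "\<lambda>_. 0" "\<lambda>_. 0" x UNIV "- K" h])
          (use K(1) supp in \<open>auto simp: open_Compl compact_imp_closed\<close>)
      then have "frechet_derivative h (at x) = (\<lambda>_. 0)" by (rule frechet_derivative_at[symmetric])
      then show ?thesis using lim False by (simp add: pd_def vt_def)
    qed
  qed
  have AEG: "AE x in lebesgue. (\<lambda>n. G n x) \<longlonglongrightarrow> indicat_real \<Omega> x * (- (h x * pd j v x))"
    using AEv
  proof eventually_elim
    fix x assume d: "x \<in> \<Omega> \<longrightarrow> v differentiable (at x)"
    show "(\<lambda>n. G n x) \<longlonglongrightarrow> indicat_real \<Omega> x * (- (h x * pd j v x))"
    proof (cases "x \<in> K")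
      case True
      then have "v differentiable (at x)" using K(2) d by auto
      then have "(\<lambda>n. (v (x + (- s n) *\<^sub>R e) - v x) / (- s n)) \<longlonglongrightarrow> pd j v x"
        unfolding pd_def e_def[symmetric] by (intro has_derivative_directional_limit sat) (simp add: frechet_derivative_works[symmetric])
      moreover have "x - s n *\<^sub>R e \<in> K1" "x \<in> K1" for n
        using K1(4)[OF True, of "x - s n *\<^sub>R e"] K1(5) True s0[of n] ne by (auto simp: dist_norm)
      then have "G n x = - (h x * ((v (x + (- s n) *\<^sub>R e) - v x) / (- s n)))" for n
        by (simp add: G_def vt_def)
      ultimately have "(\<lambda>n. G n x) \<longlonglongrightarrow> - (h x * pd j v x)"
        by (simp only:) (intro tendsto_intros)
      then show ?thesis using True K(2) by auto
    next
      case False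
      then show ?thesis by (simp add: G_def supp)
    qed
  qed
  note dcF = dominated_convergence_lebesgue[OF Fm intK[OF K1(1)] AEF Fbd]
  note dcG = dominated_convergence_lebesgue[OF Gm intK[OF K(1)] AEG Gbd]
  have eq: "integral\<^sup>L lebesgue (F n) = integral\<^sup>L lebesgue (G n)" for n
  proof -
    have int1: "integrable lborel (\<lambda>x. vt x * h (x + a))" and int2: "integrable lborel (\<lambda>x. vt (x - a) * h x)" for a
    proof -
      have hB: "\<bar>h y\<bar> \<le> \<bar>Bh\<bar>" for y using Bh[of y] supp[of y] by (cases "y \<in> K") force+
      have vB: "\<bar>vt y\<bar> \<le> \<bar>Bv\<bar>" for y using Bv[of y] by (cases "y \<in> K1") (force simp: vt_def)+
      have i1: "integrable lborel (\<lambda>x. c * indicator X x :: real)" if "compact X" for c and X :: "(real^2) set"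
        using that emeasure_compact_finite[OF that] by (auto intro!: integrable_mult_right integrable_real_indicator borel_compact)
      show "integrable lborel (\<lambda>x. vt x * h (x + a))"
      proof (rule Bochner_Integration.integrable_bound[OF i1[OF K1(1), of "\<bar>Bv\<bar> * \<bar>Bh\<bar>"]])
        show "AE x in lborel. norm (vt x * h (x + a)) \<le> norm (\<bar>Bv\<bar> * \<bar>Bh\<bar> * indicat_real K1 x)"
        proof (rule AE_I2)
          fix x show "norm (vt x * h (x + a)) \<le> norm (\<bar>Bv\<bar> * \<bar>Bh\<bar> * indicat_real K1 x)"
            using mult_mono[OF vB[of x] hB[of "x + a"]] by (cases "x \<in> K1") (auto simp: vt_def abs_mult)
        qed
      qed measurable
      show "integrable lborel (\<lambda>x. vt (x - a) * h x)"
      proof (rule Bochner_Integration.integrable_bound[OF i1[OF K(1), of "\<bar>Bv\<bar> * \<bar>Bh\<bar>"]])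
        show "AE x in lborel. norm (vt (x - a) * h x) \<le> norm (\<bar>Bv\<bar> * \<bar>Bh\<bar> * indicat_real K x)"
        proof (rule AE_I2)
          fix x show "norm (vt (x - a) * h x) \<le> norm (\<bar>Bv\<bar> * \<bar>Bh\<bar> * indicat_real K x)"
            using mult_mono[OF vB[of "x - a"] hB[of x]] supp[of x] by (cases "x \<in> K") (auto simp: abs_mult)
        qed
      qed measurable
    qed
    have int0: "integrable lborel (\<lambda>x. vt x * h x)" using int1[of 0] by simp
    let ?a = "s n *\<^sub>R e"
    have "integral\<^sup>L lborel (F n) = integral\<^sup>L lborel (\<lambda>x. (vt x * h (x + ?a) - vt x * h x) / s n)"
      by (rule Bochner_Integration.integral_cong) (auto simp: F_def right_diff_distrib)
    also have "\<dots> = (integral\<^sup>L lborel (\<lambda>x. vt x * h (x + ?a)) - integral\<^sup>L lborel (\<lambda>x. vt x * h x)) / s n"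
      using int1[of ?a] int0 by simp
    also have "integral\<^sup>L lborel (\<lambda>x. vt x * h (x + ?a)) = integral\<^sup>L lborel (\<lambda>x. vt (x - ?a) * h x)"
      by (rule integral_translate_product) auto
    also have "(integral\<^sup>L lborel (\<lambda>x. vt (x - ?a) * h x) - integral\<^sup>L lborel (\<lambda>x. vt x * h x)) / s n
        = integral\<^sup>L lborel (\<lambda>x. (vt (x - ?a) * h x - vt x * h x) / s n)"
      using int2[of ?a] int0 by simp
    also have "\<dots> = integral\<^sup>L lborel (G n)"
      by (rule Bochner_Integration.integral_cong) (auto simp: G_def algebra_simps diff_divide_distrib)
    finally show ?thesis using Fb[of n] Gb[of n] by (simp add: integral_completion)
  qed
  show "set_integrable lebesgue \<Omega> (\<lambda>x. v x * pd j h x)" using dcF(1) by (simp add: set_integrable_def)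
  have m: "integrable lebesgue (\<lambda>x. - (indicat_real \<Omega> x * (- (h x * pd j v x))))" using dcG(1) by (rule Bochner_Integration.integrable_minus)
  then show "set_integrable lebesgue \<Omega> (\<lambda>x. h x * pd j v x)" by (simp add: set_integrable_def)
  have "integral\<^sup>L lebesgue (\<lambda>x. indicat_real \<Omega> x * (v x * pd j h x)) = integral\<^sup>L lebesgue (\<lambda>x. indicat_real \<Omega> x * (- (h x * pd j v x)))"
    using dcF(2) dcG(2) unfolding eq by (rule LIMSEQ_unique)
  then show "(LINT x:\<Omega>|lebesgue. v x * pd j h x) = - (LINT x:\<Omega>|lebesgue. h x * pd j v x)"
    by (simp add: set_lebesgue_integral_def)
qed

section \<open>Smooth and Lipschitz functions on compact sets\<close>

lemma smooth_on_differentiable: "smooth_on S f \<Longrightarrow> x \<in> S \<Longrightarrow> f differentiable (at x)"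
  unfolding smooth_on_def by (drule spec[of _ "Suc 0"]) simp

lemma smooth_on_continuous_on: "smooth_on S f \<Longrightarrow> continuous_on S f"
  unfolding smooth_on_def by (drule spec[of _ 0]) simp

lemma smooth_on_frechet_derivative:
  assumes "smooth_on S f" "b \<in> Basis"
  shows "smooth_on S (\<lambda>x. frechet_derivative f (at x) b)"
  unfolding smooth_on_def
proof
  fix k
  have "Ck_on (Suc k) S f" using assms(1) by (simp only: smooth_on_def)
  then show "Ck_on k S (\<lambda>x. frechet_derivative f (at x) b)" using assms(2) by simp
qed

lemma smooth_on_pd: "smooth_on S f \<Longrightarrow> smooth_on S (pd j f)"
  unfolding pd_def[abs_def] by (rule smooth_on_frechet_derivative) (auto simp: axis_in_Basis_iff)

lemma smooth_lipschitz_on_compact: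
  fixes f :: "'a::euclidean_space \<Rightarrow> real"
  assumes f: "smooth_on UNIV f" and K: "compact K"
  shows "\<exists>L. L-lipschitz_on K f"
proof -
  \<comment> \<open>The mean value bound requires a convex set, so \<open>K\<close> is enlarged to a
    ball.\<close>
  obtain r where r: "K \<subseteq> cball 0 r" using compact_imp_bounded[OF K] by (auto simp: bounded_iff subset_eq)
  have "\<exists>B. \<forall>x\<in>cball 0 r. \<bar>frechet_derivative f (at x) b\<bar> \<le> B" if "b \<in> Basis" for b
  proof -
    have "continuous_on (cball 0 r) (\<lambda>x. frechet_derivative f (at x) b)"
      by (rule continuous_on_subset[OF smooth_on_continuous_on[OF smooth_on_frechet_derivative[OF f that]]]) simp
    then have "bounded ((\<lambda>x. frechet_derivative f (at x) b) ` cball 0 r)"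
      by (intro compact_imp_bounded compact_continuous_image compact_cball)
    then show ?thesis by (auto simp: bounded_iff)
  qed
  then obtain B where B: "\<And>b x. b \<in> Basis \<Longrightarrow> x \<in> cball 0 r \<Longrightarrow> \<bar>frechet_derivative f (at x) b\<bar> \<le> B b" by metis
  have d: "(f has_derivative frechet_derivative f (at x)) (at x)" for x
    using smooth_on_differentiable[OF f] by (simp add: frechet_derivative_works[symmetric])
  have "(\<Sum>b\<in>Basis. \<bar>B b\<bar>)-lipschitz_on (cball 0 r) f"
  proof (rule bounded_derivative_imp_lipschitz)
    show "(f has_derivative frechet_derivative f (at x)) (at x within cball 0 r)" for x
      using d by (rule has_derivative_at_withinI)
    fix x :: 'a assume x: "x \<in> cball 0 r"
    show "onorm (frechet_derivative f (at x)) \<le> (\<Sum>b\<in>Basis. \<bar>B b\<bar>)"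
    proof (rule onorm_le)
      fix h
      have lin: "linear (frechet_derivative f (at x))" using d has_derivative_linear by blast
      have "frechet_derivative f (at x) h = frechet_derivative f (at x) (\<Sum>b\<in>Basis. (h \<bullet> b) *\<^sub>R b)"
        by (simp add: euclidean_representation)
      also have "\<dots> = (\<Sum>b\<in>Basis. (h \<bullet> b) * frechet_derivative f (at x) b)"
        by (simp add: linear_sum[OF lin] linear_scale[OF lin])
      also have "norm \<dots> \<le> (\<Sum>b\<in>Basis. \<bar>B b\<bar> * norm h)"
      proof (rule sum_norm_le)
        fix b :: 'a assume b: "b \<in> Basis"
        show "norm ((h \<bullet> b) * frechet_derivative f (at x) b) \<le> \<bar>B b\<bar> * norm h"
        proof -
          have "\<bar>h \<bullet> b\<bar> * \<bar>frechet_derivative f (at x) b\<bar> \<le> norm h * \<bar>B b\<bar>"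
            using B[OF b x] Basis_le_norm[OF b, of h] by (intro mult_mono) auto
          then show ?thesis by (simp add: abs_mult mult.commute)
        qed
      qed
      finally show "norm (frechet_derivative f (at x) h) \<le> (\<Sum>b\<in>Basis. \<bar>B b\<bar>) * norm h"
        by (simp add: sum_distrib_right)
    qed
  qed (auto intro: sum_nonneg)
  then show ?thesis using lipschitz_on_subset[OF _ r] by metis
qed

lemma lipschitz_on_mult_compact:
  fixes f g :: "'a::metric_space \<Rightarrow> real"
  assumes K: "compact K" and f: "L-lipschitz_on K f" and g: "M-lipschitz_on K g"
  shows "\<exists>N. N-lipschitz_on K (\<lambda>x. f x * g x)"
proof -
  obtain A where A: "\<And>x. x \<in> K \<Longrightarrow> \<bar>f x\<bar> \<le> A"
    using compact_imp_bounded[OF compact_continuous_image[OF lipschitz_on_continuous_on[OF f] K]] by (auto simp: bounded_iff)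
  obtain B where B: "\<And>x. x \<in> K \<Longrightarrow> \<bar>g x\<bar> \<le> B"
    using compact_imp_bounded[OF compact_continuous_image[OF lipschitz_on_continuous_on[OF g] K]] by (auto simp: bounded_iff)
  have LM: "0 \<le> L" "0 \<le> M" using f g lipschitz_on_nonneg by blast+
  have "(\<bar>A\<bar> * M + L * \<bar>B\<bar>)-lipschitz_on K (\<lambda>x. f x * g x)"
  proof (rule lipschitz_onI)
    fix x y assume xy: "x \<in> K" "y \<in> K"
    have "f x * g x - f y * g y = f x * (g x - g y) + (f x - f y) * g y" by (simp add: algebra_simps)
    then have "dist (f x * g x) (f y * g y) \<le> \<bar>f x\<bar> * dist (g x) (g y) + dist (f x) (f y) * \<bar>g y\<bar>"
      by (simp add: dist_real_def abs_mult[symmetric])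
    also have "\<dots> \<le> \<bar>A\<bar> * (M * dist x y) + (L * dist x y) * \<bar>B\<bar>"
      using A[of x] B[of y] xy LM lipschitz_onD[OF f, of x y] lipschitz_onD[OF g, of x y]
      by (intro add_mono mult_mono) auto
    finally show "dist (f x * g x) (f y * g y) \<le> (\<bar>A\<bar> * M + L * \<bar>B\<bar>) * dist x y" by (simp add: algebra_simps)
  qed (use LM in auto)
  then show ?thesis by blast
qed

lemma continuous_on_if_lipschitz_on_compact:
  fixes f :: "'a::euclidean_space \<Rightarrow> real"
  assumes \<Omega>: "open \<Omega>" and lip: "\<And>K. compact K \<Longrightarrow> K \<subseteq> \<Omega> \<Longrightarrow> \<exists>L. L-lipschitz_on K f"
  shows "continuous_on \<Omega> f"
proof (rule continuous_at_imp_continuous_on, rule)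
  fix x assume "x \<in> \<Omega>"
  then obtain r where r: "0 < r" "cball x r \<subseteq> \<Omega>" using \<Omega> open_contains_cball by blast
  then obtain L where "L-lipschitz_on (cball x r) f" using lip[of "cball x r"] by auto
  then have "continuous_on (ball x r) f" using lipschitz_on_continuous_on continuous_on_subset ball_subset_cball by metis
  then show "isCont f x" using r(1) by (simp add: continuous_on_eq_continuous_at)
qed

lemma on_graph_nth [simp]: "on_graph u x $ 1 = x $ 1" "on_graph u x $ 2 = x $ 2" "on_graph u x $ 3 = u x"
  by (simp_all add: on_graph_def vector_3)

lemma smooth_on_graph_lipschitz:
  fixes f :: "real^3 \<Rightarrow> real"
  assumes f: "smooth_on UNIV f" and K: "compact K" and u: "L-lipschitz_on K u"
  shows "\<exists>M. M-lipschitz_on K (\<lambda>x. f (on_graph u x))"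
proof -
  have L0: "0 \<le> L" using u lipschitz_on_nonneg by blast
  have g: "(2 + L)-lipschitz_on K (on_graph u)"
  proof (rule lipschitz_onI)
    fix x y assume xy: "x \<in> K" "y \<in> K"
    have "dist (on_graph u x) (on_graph u y) \<le> (\<Sum>i\<in>UNIV. \<bar>(on_graph u x - on_graph u y) $ i\<bar>)"
      unfolding dist_norm by (rule norm_le_l1_cart)
    also have "\<dots> = \<bar>(x - y) $ 1\<bar> + \<bar>(x - y) $ 2\<bar> + \<bar>u x - u y\<bar>" by (simp add: sum_3)
    also have "\<dots> \<le> dist x y + dist x y + L * dist x y"
      using lipschitz_onD[OF u xy] component_le_norm_cart[of "x - y"] unfolding dist_norm real_norm_def
      by (intro add_mono) auto
    finally show "dist (on_graph u x) (on_graph u y) \<le> (2 + L) * dist x y" by (simp add: algebra_simps)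
  qed (use L0 in auto)
  then have "compact (on_graph u ` K)" using K lipschitz_on_continuous_on compact_continuous_image by blast
  then obtain M where "M-lipschitz_on (on_graph u ` K) f" using smooth_lipschitz_on_compact[OF f] by blast
  from lipschitz_on_compose[OF g this] show ?thesis by (auto simp: comp_def)
qed

text \<open>Treating each product \<open>\<sigma> j (on_graph u y) * \<phi> y\<close> as one
  compactly supported Lipschitz function moves the field onto \<open>v\<close> without expanding a
  divergence. The condition \<open>deriv\<close> concerns points where \<open>v\<close> is
  differentiable, which is almost all of \<open>\<Omega>\<close>.\<close>

lemma weak_X1_I:
  assumes \<Omega>: "open \<Omega>" and \<sigma>: "\<And>j. smooth_on UNIV (\<sigma> j)"
    and lipu: "\<And>K. compact K \<Longrightarrow> K \<subseteq> \<Omega> \<Longrightarrow> \<exists>L. L-lipschitz_on K u"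
    and lipv: "\<And>K. compact K \<Longrightarrow> K \<subseteq> \<Omega> \<Longrightarrow> \<exists>L. L-lipschitz_on K v"
    and w: "continuous_on \<Omega> w"
    and deriv: "\<And>x. x \<in> \<Omega> \<Longrightarrow> v differentiable (at x) \<Longrightarrow> X1 \<sigma> u v x = w x"
  shows "weak_X1 \<sigma> \<Omega> u v w"
  unfolding weak_X1_def
proof (intro conjI allI impI)
  have L1: "f \<in> L1_loc \<Omega>" if f: "continuous_on \<Omega> f" for f :: "real^2 \<Rightarrow> real"
    unfolding L1_loc_def
  proof safe
    fix K assume K: "compact K" "K \<subseteq> \<Omega>"
    have "set_integrable lborel K f"
      using borel_integrable_compact[OF K(1) continuous_on_subset[OF f K(2)]]
      by (simp add: set_integrable_def indicator_def mult.commute if_distrib cong: if_cong)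
    then show "set_integrable lebesgue K f"
      by (simp add: set_integrable_def integrable_completion borel_measurable_integrable)
  qed
  have contv: "continuous_on \<Omega> v" by (rule continuous_on_if_lipschitz_on_compact[OF \<Omega> lipv])
  show "v \<in> L1_loc \<Omega>" "w \<in> L1_loc \<Omega>" by (rule L1; fact)+
  fix \<phi> :: "real^2 \<Rightarrow> real" assume \<phi>: "test_function \<Omega> \<phi>"
  define K where "K = closure {x. \<phi> x \<noteq> 0}"
  have K: "compact K" "K \<subseteq> \<Omega>" and sm: "smooth_on UNIV \<phi>" using \<phi> by (auto simp: test_function_def K_def)
  have supp: "\<phi> x = 0" if "x \<notin> K" for x using that closure_subset[of "{x. \<phi> x \<noteq> 0}"] by (auto simp: K_def)
  define h where "h = (\<lambda>j y. \<sigma> j (on_graph u y) * \<phi> y)"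
  have "\<exists>M. M-lipschitz_on UNIV (h j)" for j
  proof -
    have "\<exists>L. L-lipschitz_on X (h j)" if X: "compact X" "X \<subseteq> \<Omega>" for X
    proof -
      obtain L where "L-lipschitz_on X u" using lipu X by blast
      then obtain M where "M-lipschitz_on X (\<lambda>x. \<sigma> j (on_graph u x))" using smooth_on_graph_lipschitz[OF \<sigma> X(1)] by blast
      moreover obtain N where "N-lipschitz_on X \<phi>" using smooth_lipschitz_on_compact[OF sm X(1)] by blast
      ultimately show ?thesis using lipschitz_on_mult_compact[OF X(1), of M "\<lambda>x. \<sigma> j (on_graph u x)" N \<phi>] by (simp add: h_def)
    qed
    then show ?thesis
      using lipschitz_on_UNIV_if_compact_support[OF \<Omega> K, of "h j"] supp by (metis h_def mult_zero_right)
  qed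
  then obtain M where M: "\<And>j. (M j)-lipschitz_on UNIV (h j)" by metis
  have h0: "\<And>x. x \<notin> K \<Longrightarrow> h j x = 0" for j by (simp add: h_def supp)
  have parts: "set_integrable lebesgue \<Omega> (\<lambda>x. v x * pd j (h j) x)"
    "set_integrable lebesgue \<Omega> (\<lambda>x. h j x * pd j v x)"
    "(LINT x:\<Omega>|lebesgue. v x * pd j (h j) x) = - (LINT x:\<Omega>|lebesgue. h j x * pd j v x)" for j
    by (rule integral_by_parts_lipschitz[OF \<Omega> lipv M K h0]; assumption)+
  have "(LINT x:\<Omega>|lebesgue. v x * X1_adj \<sigma> u \<phi> x) = (LINT x:\<Omega>|lebesgue. (\<Sum>j\<in>UNIV. - (v x * pd j (h j) x)))"
    by (simp add: X1_adj_def h_def sum_negf sum_distrib_left)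
  also have "\<dots> = (\<Sum>j\<in>UNIV. (LINT x:\<Omega>|lebesgue. - (v x * pd j (h j) x)))"
    unfolding set_lebesgue_integral_def scaleR_sum_right
    by (rule Bochner_Integration.integral_sum)
      (use parts(1)[unfolded set_integrable_def, THEN Bochner_Integration.integrable_minus] in simp)
  also have "\<dots> = (\<Sum>j\<in>UNIV. (LINT x:\<Omega>|lebesgue. h j x * pd j v x))"
    using parts(3) by (simp add: set_lebesgue_integral_def)
  also have "\<dots> = (LINT x:\<Omega>|lebesgue. (\<Sum>j\<in>UNIV. h j x * pd j v x))"
    unfolding set_lebesgue_integral_def scaleR_sum_right
    by (rule Bochner_Integration.integral_sum[symmetric]) (use parts(2) in \<open>simp add: set_integrable_def\<close>)
  also have "\<dots> = (LINT x:\<Omega>|lebesgue. w x * \<phi> x)"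
  proof -
    let ?g = "\<lambda>x. indicat_real \<Omega> x *\<^sub>R (\<Sum>j\<in>UNIV. h j x * pd j v x)"
    have "AE x in lebesgue. x \<in> \<Omega> \<longrightarrow> v differentiable (at x)"
      using locally_Rademacher_plane[OF \<Omega> lipv] by (simp add: completion.AE_iff_null_sets negligible_iff_null_sets)
    then have ae: "AE x in lebesgue. indicat_real \<Omega> x *\<^sub>R (w x * \<phi> x) = ?g x"
    proof eventually_elim
      fix x assume d: "x \<in> \<Omega> \<longrightarrow> v differentiable (at x)"
      show "indicat_real \<Omega> x *\<^sub>R (w x * \<phi> x) = ?g x"
      proof (cases "x \<in> \<Omega>")
        case True
        then have "w x = (\<Sum>j\<in>UNIV. \<sigma> j (on_graph u x) * pd j v x)" using deriv[of x] d by (simp add: X1_def)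
        then show ?thesis by (simp add: h_def sum_distrib_left sum_distrib_right mult_ac)
      qed simp
    qed
    have "?g \<in> borel_measurable lebesgue"
      unfolding scaleR_sum_right by (rule borel_measurable_sum) (rule borel_measurable_integrable[OF parts(2)[unfolded set_integrable_def]])
    then show ?thesis unfolding set_lebesgue_integral_def
      using borel_measurable_lebesgue_cong_AE[OF _ ae] ae by (intro integral_cong_AE[symmetric]) auto
  qed
  finally show "(LINT x:\<Omega>|lebesgue. w x * \<phi> x) = (LINT x:\<Omega>|lebesgue. v x * X1_adj \<sigma> u \<phi> x)" ..
qed

section \<open>The regularised equation at a point of contact\<close>

text \<open>Written with partial derivatives so that linearity in \<open>h\<close> is algebra and
  joint continuity in \<open>x\<close> and \<open>h\<close> follows from smoothness of the
  partials.\<close>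

definition dir_deriv :: "(real^'n \<Rightarrow> real) \<Rightarrow> real^'n \<Rightarrow> real^'n \<Rightarrow> real" where
  "dir_deriv f x h = (\<Sum>k\<in>UNIV. h $ k * pd k f x)"

lemma has_derivative_pd:
  fixes f :: "real^'n \<Rightarrow> real"
  assumes "(f has_derivative f') (at x)"
  shows "(\<Sum>k\<in>UNIV. h $ k * pd k f x) = f' h"
proof -
  have lin: "linear f'" using assms by (rule has_derivative_linear)
  have "f' h = f' (\<Sum>k\<in>UNIV. h $ k *\<^sub>R axis k 1)"
    by (simp add: basis_expansion scalar_mult_eq_scaleR[symmetric])
  also have "\<dots> = (\<Sum>k\<in>UNIV. h $ k * f' (axis k 1))" by (simp add: linear_sum[OF lin] linear_scale[OF lin])
  finally show ?thesis using frechet_derivative_at[OF assms] by (simp add: pd_def)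
qed

lemma smooth_on_has_derivative:
  fixes f :: "real^'n \<Rightarrow> real"
  assumes "smooth_on S f" "x \<in> S"
  shows "(f has_derivative dir_deriv f x) (at x)"
proof -
  have d: "(f has_derivative frechet_derivative f (at x)) (at x)"
    using smooth_on_differentiable[OF assms] by (simp add: frechet_derivative_works[symmetric])
  moreover have "dir_deriv f x = frechet_derivative f (at x)"
    by (rule ext) (simp add: dir_deriv_def has_derivative_pd[OF d])
  ultimately show ?thesis by simp
qed

lemma dir_deriv_scaleR: "dir_deriv f x (c *\<^sub>R h) = c * dir_deriv f x h"
  by (simp add: dir_deriv_def sum_distrib_left mult.assoc)

lemma dir_deriv_diff: "dir_deriv f x (g - h) = dir_deriv f x g - dir_deriv f x h"
  by (simp add: dir_deriv_def sum_subtractf left_diff_distrib)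

lemma continuous_on_dir_deriv [continuous_intros]:
  fixes f :: "real^'n \<Rightarrow> real" and g h :: "'b::t2_space \<Rightarrow> real^'n"
  assumes f: "smooth_on UNIV f" and "continuous_on A g" "continuous_on A h"
  shows "continuous_on A (\<lambda>x. dir_deriv f (g x) (h x))"
  unfolding dir_deriv_def
  by (intro continuous_intros assms continuous_on_compose2[OF smooth_on_continuous_on[OF smooth_on_pd[OF f]]]) auto

text \<open>The height is an independent argument because comparison curves leave the graph; the sum
  over axes makes linearity visible.\<close>

definition lift :: "real^2 \<Rightarrow> real \<Rightarrow> real^3" where
  "lift x c = x $ 1 *\<^sub>R axis 1 1 + x $ 2 *\<^sub>R axis 2 1 + c *\<^sub>R axis 3 1"

lemma lift_nth [simp]: "lift x c $ 1 = x $ 1" "lift x c $ 2 = x $ 2" "lift x c $ 3 = c"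
  by (simp_all add: lift_def axis_def)

lemma on_graph_eq_lift: "on_graph u x = lift x (u x)"
  by (simp add: vec_eq_iff forall_3)

lemma lift_diff: "lift x c - lift y d = lift (x - y) (c - d)"
  and lift_scaleR: "a *\<^sub>R lift x c = lift (a *\<^sub>R x) (a * c)"
  by (simp_all add: vec_eq_iff forall_3)

lemma norm_lift_le: "norm (lift x c) \<le> 2 * norm x + \<bar>c\<bar>"
proof -
  have "norm (lift x c) \<le> (\<Sum>i\<in>UNIV. \<bar>lift x c $ i\<bar>)" by (rule norm_le_l1_cart)
  also have "\<dots> = \<bar>x $ 1\<bar> + \<bar>x $ 2\<bar> + \<bar>c\<bar>" by (simp add: sum_3)
  finally show ?thesis using component_le_norm_cart[of x 1] component_le_norm_cart[of x 2] by simp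
qed

lemma continuous_on_lift [continuous_intros]:
  "continuous_on A f \<Longrightarrow> continuous_on A g \<Longrightarrow> continuous_on A (\<lambda>x. lift (f x) (g x))"
  unfolding lift_def by (intro continuous_intros)

lemma has_derivative_lift:
  assumes "(f has_derivative f') F" "(g has_derivative g') F"
  shows "((\<lambda>x. lift (f x) (g x)) has_derivative (\<lambda>h. lift (f' h) (g' h))) F"
  unfolding lift_def
  by (intro has_derivative_add has_derivative_scaleR_left bounded_linear.has_derivative[OF bounded_linear_vec_nth] assms)

definition hess_form :: "(real^2 \<Rightarrow> real) \<Rightarrow> real^2 \<Rightarrow> real^2 \<Rightarrow> real^2 \<Rightarrow> real" where
  "hess_form v x h w = (\<Sum>j\<in>UNIV. w $ j * dir_deriv (pd j v) x h)"

definition field_at :: "(2 \<Rightarrow> real^3 \<Rightarrow> real) \<Rightarrow> real^3 \<Rightarrow> real^2" where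
  "field_at a q = (\<chi> j. a j q)"

lemma field_at_nth [simp]: "field_at a q $ j = a j q"
  by (simp add: field_at_def)

text \<open>The part of a twice applied field in which the derivative falls on a coefficient. With
  \<open>p\<close> the gradient, \<open>lift h (p \<bullet> h)\<close> is the tangent vector to the
  graph over \<open>h\<close>; \<open>q\<close> and \<open>p\<close> are free arguments because the
  expression is also evaluated off the graph.\<close>

definition lower_order :: "(2 \<Rightarrow> real^3 \<Rightarrow> real) \<Rightarrow> real^3 \<Rightarrow> real^2 \<Rightarrow> real^2 \<Rightarrow> real" where
  "lower_order a q p h = (\<Sum>j\<in>UNIV. p $ j * dir_deriv (a j) q (lift h (p \<bullet> h)))"

section \<open>Nondivergence form of the regularised equation\<close>

lemma field_derivative_expand:
  fixes v :: "real^2 \<Rightarrow> real"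
  assumes a: "\<And>j. smooth_on UNIV (a j)" and v: "smooth_on \<Omega> v" and x: "x \<in> \<Omega>"
  shows "((\<lambda>y. \<Sum>j\<in>UNIV. a j (on_graph v y) * pd j v y) has_derivative
    (\<lambda>h. hess_form v x h (field_at a (on_graph v x)) + lower_order a (on_graph v x) (\<chi> j. pd j v x) h)) (at x)"
proof -
  have gv: "(\<chi> j. pd j v x) \<bullet> h = dir_deriv v x h" for h
    by (simp add: dir_deriv_def inner_vec_def mult.commute)
  have og: "(on_graph v has_derivative (\<lambda>h. lift h (dir_deriv v x h))) (at x)"
    unfolding on_graph_eq_lift[abs_def]
    by (rule has_derivative_lift[OF has_derivative_ident smooth_on_has_derivative[OF v x]])
  have ja: "((\<lambda>y. a j (on_graph v y)) has_derivative (\<lambda>h. dir_deriv (a j) (on_graph v x) (lift h (dir_deriv v x h)))) (at x)" for j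
    by (rule has_derivative_compose[OF og]) (rule smooth_on_has_derivative[OF a UNIV_I])
  have jv: "(pd j v has_derivative dir_deriv (pd j v) x) (at x)" for j
    by (rule smooth_on_has_derivative[OF smooth_on_pd[OF v] x])
  have "((\<lambda>y. \<Sum>j\<in>UNIV. a j (on_graph v y) * pd j v y) has_derivative
     (\<lambda>h. \<Sum>j\<in>UNIV. a j (on_graph v x) * dir_deriv (pd j v) x h
        + dir_deriv (a j) (on_graph v x) (lift h (dir_deriv v x h)) * pd j v x)) (at x)"
    by (intro has_derivative_sum has_derivative_mult ja jv)
  then show ?thesis
    by (simp add: hess_form_def lower_order_def gv sum.distrib mult.commute)
qed

text \<open>Multiplication by \<open>W ^ 3\<close> clears the denominators and leaves the minimal
  surface operator in nondivergence form.\<close>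

lemma quotient_identity:
  fixes p1 p2 a11 a12 a21 a22 :: real
  assumes "W = sqrt (1 + (p1\<^sup>2 + p2\<^sup>2))"
    and "(a11 / W - p1 * (p1 * a11 + p2 * a21) / W ^ 3) + (a22 / W - p2 * (p1 * a12 + p2 * a22) / W ^ 3) = 0"
  shows "(1 + p2\<^sup>2) * a11 + (1 + p1\<^sup>2) * a22 - p1 * p2 * (a21 + a12) = 0"
proof -
  have W: "0 < W" "W\<^sup>2 = 1 + (p1\<^sup>2 + p2\<^sup>2)" using assms(1) by (auto simp: add_pos_nonneg)
  have "0 = W ^ 3 * ((a11 / W - p1 * (p1 * a11 + p2 * a21) / W ^ 3) + (a22 / W - p2 * (p1 * a12 + p2 * a22) / W ^ 3))"
    using assms(2) by simp
  also have "\<dots> = W\<^sup>2 * a11 - p1 * (p1 * a11 + p2 * a21) + (W\<^sup>2 * a22 - p2 * (p1 * a12 + p2 * a22))"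
    using W(1) by (simp add: field_simps power2_eq_square power3_eq_cube)
  finally show ?thesis unfolding W(2) by (simp add: algebra_simps power2_eq_square)
qed

lemma has_derivative_sqrt_at:
  assumes Q: "(Q has_derivative Q') (at x)" and pos: "0 < Q x"
  shows "((\<lambda>y. sqrt (Q y)) has_derivative (\<lambda>h. Q' h / (2 * sqrt (Q x)))) (at x)"
proof -
  have "(sqrt has_derivative (\<lambda>k. inverse (sqrt (Q x)) / 2 * k)) (at (Q x))"
    using DERIV_real_sqrt[OF pos] by (simp only: has_field_derivative_def)
  note d = has_derivative_compose[OF Q this]
  have "inverse (sqrt (Q x)) / 2 * Q' h = Q' h / (2 * sqrt (Q x))" for h using pos by (simp add: field_simps)
  with d show ?thesis by (simp only:)
qed

text \<open>Here \<open>B V1 V2 + G2 V1\<close> is X1 X2 v and \<open>B V2 V1 + G1 V2\<close> is X2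
  X1 v, so the mixed terms enter symmetrically and the fields are never commuted.\<close>

lemma L_op_eq_0_expand:
  fixes v :: "real^2 \<Rightarrow> real"
  assumes \<sigma>: "\<And>j. smooth_on UNIV (\<sigma> j)" and v: "smooth_on \<Omega> v" and x: "x \<in> \<Omega>"
    and L: "L_op \<sigma> \<epsilon> v x = 0"
  defines "q \<equiv> on_graph v x" and "p \<equiv> (\<chi> j. pd j v x)"
  defines "V1 \<equiv> field_at \<sigma> q" and "V2 \<equiv> \<epsilon> *\<^sub>R field_at (\<sigma>2 \<sigma>) q"
  defines "B \<equiv> hess_form v x"
  defines "G1 \<equiv> lower_order \<sigma> q p" and "G2 \<equiv> \<lambda>h. \<epsilon> * lower_order (\<sigma>2 \<sigma>) q p h"
  shows "(1 + (p \<bullet> V2)\<^sup>2) * (B V1 V1 + G1 V1) + (1 + (p \<bullet> V1)\<^sup>2) * (B V2 V2 + G2 V2)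
     - (p \<bullet> V1) * (p \<bullet> V2) * (B V1 V2 + G2 V1 + (B V2 V1 + G1 V2)) = 0"
proof -
  define P1 P2 where "P1 = (\<lambda>y. \<Sum>j\<in>UNIV. \<sigma> j (on_graph v y) * pd j v y)"
    and "P2 = (\<lambda>y. \<epsilon> * (\<Sum>j\<in>UNIV. \<sigma>2 \<sigma> j (on_graph v y) * pd j v y))"
  have \<sigma>2: "smooth_on UNIV (\<sigma>2 \<sigma> j)" for j unfolding \<sigma>2_def by (rule smooth_on_pd[OF \<sigma>])
  have d1: "(P1 has_derivative (\<lambda>h. B h V1 + G1 h)) (at x)"
    unfolding P1_def B_def V1_def G1_def q_def p_def by (rule field_derivative_expand[OF \<sigma> v x])
  have "(P2 has_derivative (\<lambda>h. \<epsilon> * (hess_form v x h (field_at (\<sigma>2 \<sigma>) q) + lower_order (\<sigma>2 \<sigma>) q p h))) (at x)"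
    unfolding P2_def q_def p_def by (intro has_derivative_mult_right field_derivative_expand[OF \<sigma>2 v x])
  then have d2: "(P2 has_derivative (\<lambda>h. B h V2 + G2 h)) (at x)"
    by (simp add: B_def V2_def G2_def hess_form_def sum_distrib_left distrib_left mult.assoc)
  have P12: "P1 x = p \<bullet> V1" "P2 x = p \<bullet> V2"
    by (simp_all add: P1_def P2_def p_def V1_def V2_def q_def inner_vec_def mult.commute sum_distrib_left mult.left_commute)
  define Q where "Q = (\<lambda>y. 1 + ((P1 y)\<^sup>2 + (P2 y)\<^sup>2))"
  define W where "W = (\<lambda>y. sqrt (Q y))"
  have X1: "X_eps \<sigma> \<epsilon> v 1 v = P1" and X2: "X_eps \<sigma> \<epsilon> v 2 v = P2"
    by (auto simp: X_eps_def X1_def Y_field_def P1_def P2_def)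
  have "(norm (grad_eps \<sigma> \<epsilon> v v y))\<^sup>2 = (P1 y)\<^sup>2 + (P2 y)\<^sup>2" for y
    unfolding power2_norm_eq_inner using X1 X2
    by (simp add: inner_vec_def sum_2 grad_eps_def power2_eq_square)
  then have Wn: "sqrt (1 + (norm (grad_eps \<sigma> \<epsilon> v v y))\<^sup>2) = W y" for y by (simp add: W_def Q_def)
  have Wpos: "0 < W x" by (simp add: W_def Q_def add_pos_nonneg)
  define N where "N = (\<lambda>h. P1 x * (B h V1 + G1 h) + P2 x * (B h V2 + G2 h))"
  have dW: "(W has_derivative (\<lambda>h. N h / W x)) (at x)"
  proof -
    have dQ: "(Q has_derivative (\<lambda>h. 2 * N h)) (at x)"
      unfolding Q_def
      by (rule has_derivative_eq_rhs,
          rule has_derivative_add[OF has_derivative_const has_derivative_add[OF has_derivative_power[OF d1] has_derivative_power[OF d2]]])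
        (simp add: N_def fun_eq_iff algebra_simps)
    have "0 < Q x" by (simp add: Q_def add_pos_nonneg)
    then show ?thesis using has_derivative_sqrt_at[OF dQ] by (simp add: W_def)
  qed
  have quot: "((\<lambda>y. P y / W y) has_derivative (\<lambda>h. P' h / W x - P x * N h / (W x) ^ 3)) (at x)"
    if "(P has_derivative P') (at x)" for P P'
    by (rule has_derivative_eq_rhs, rule has_derivative_divide'[OF that dW])
      (use Wpos in \<open>auto simp: field_simps power3_eq_cube\<close>)
  have XV: "X_eps \<sigma> \<epsilon> v 1 f x = f' V1" "X_eps \<sigma> \<epsilon> v 2 f x = f' V2" if "(f has_derivative f') (at x)" for f f'
    using has_derivative_pd[OF that, of V1] has_derivative_pd[OF that, of V2]
    by (auto simp: X_eps_def X1_def Y_field_def V1_def V2_def q_def sum_distrib_left mult.assoc)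
  have "L_op \<sigma> \<epsilon> v x = X_eps \<sigma> \<epsilon> v 1 (\<lambda>y. P1 y / W y) x + X_eps \<sigma> \<epsilon> v 2 (\<lambda>y. P2 y / W y) x"
    unfolding L_op_def Wn by (simp add: sum_2 X1 X2)
  also have "\<dots> = ((B V1 V1 + G1 V1) / W x - P1 x * N V1 / (W x) ^ 3) + ((B V2 V2 + G2 V2) / W x - P2 x * N V2 / (W x) ^ 3)"
    using XV(1)[OF quot[OF d1]] XV(2)[OF quot[OF d2]] by simp
  finally have "((B V1 V1 + G1 V1) / W x - P1 x * N V1 / (W x) ^ 3) + ((B V2 V2 + G2 V2) / W x - P2 x * N V2 / (W x) ^ 3) = 0"
    using L by simp
  from quotient_identity[OF _ this[unfolded N_def]] show ?thesis unfolding P12[symmetric] by (simp add: W_def Q_def)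
qed

section \<open>Second-order test at a penalised maximum\<close>

lemma second_derivative_local_max:
  fixes g :: "real \<Rightarrow> real"
  assumes e: "0 < e" and g: "\<And>s. \<bar>s\<bar> < e \<Longrightarrow> (g has_field_derivative g1 s) (at s)"
    and g1: "(g1 has_field_derivative g2) (at 0)" and max: "\<And>s. \<bar>s\<bar> < e \<Longrightarrow> g s \<le> g 0"
  shows "g1 0 = 0" "g2 \<le> 0"
proof -
  show z: "g1 0 = 0" by (rule DERIV_local_max[OF g e]) (use e max in auto)
  show "g2 \<le> 0"
  proof (rule ccontr)
    assume "\<not> g2 \<le> 0"
    then obtain d where d: "0 < d" "\<And>h. 0 < h \<Longrightarrow> h < d \<Longrightarrow> g1 0 < g1 (0 + h)"
      using DERIV_pos_inc_right[OF g1] by auto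
    define c where "c = min d e / 2"
    have c: "0 < c" "c < d" "c < e" using d e by (auto simp: c_def)
    have "g 0 < g c"
    proof (rule DERIV_pos_imp_increasing_open[OF c(1)])
      show "\<exists>y. (g has_real_derivative y) (at x) \<and> 0 < y" if "0 < x" "x < c" for x
        using g[of x] d(2)[of x] that c z by auto
      show "continuous_on {0..c} g"
        by (intro continuous_at_imp_continuous_on ballI DERIV_isCont[OF g]) (use c in auto)
    qed
    then show False using max[of c] c by auto
  qed
qed

text \<open>The penalised function is restricted to the segment
  \<open>s \<mapsto> (t + c * s, y + s *\<^sub>R V)\<close>. With \<open>c = 0\<close> only space
  moves, and the Hessian is bounded by the penalty. With \<open>c = 1\<close> time moves too, so
  that in the quadratic part the large factor \<open>2 * K\<close> meets only
  \<open>V - X1 t\<close>, which is small when \<open>V\<close> is nearly the velocity of the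
  curve.\<close>

lemma penalised_max_test:
  fixes v :: "real^2 \<Rightarrow> real" and X X1 :: "real \<Rightarrow> real^2" and z z1 :: "real \<Rightarrow> real"
  assumes v: "smooth_on \<Omega> v" and \<Omega>: "open \<Omega>" and y: "y \<in> \<Omega>" and e: "0 < e"
    and X: "\<And>s. \<bar>s - t\<bar> < e \<Longrightarrow> (X has_vector_derivative X1 s) (at s)" and X1: "(X1 has_vector_derivative X2) (at t)"
    and z: "\<And>s. \<bar>s - t\<bar> < e \<Longrightarrow> (z has_field_derivative z1 s) (at s)" and z1: "(z1 has_field_derivative z2) (at t)"
    and max: "\<And>s w. \<bar>s - t\<bar> < e \<Longrightarrow> dist w y < e \<Longrightarrow>
      \<zeta> * (v w - z s) - K * ((w - X s) \<bullet> (w - X s)) \<le> \<zeta> * (v y - z t) - K * ((y - X t) \<bullet> (y - X t))"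
    and c: "\<bar>c\<bar> \<le> 1"
  shows "\<zeta> * (dir_deriv v y V - c * z1 t) = 2 * K * ((y - X t) \<bullet> (V - c *\<^sub>R X1 t))"
    and "\<zeta> * (hess_form v y V V - c\<^sup>2 * z2) \<le>
      2 * K * ((V - c *\<^sub>R X1 t) \<bullet> (V - c *\<^sub>R X1 t) - (y - X t) \<bullet> (c\<^sup>2 *\<^sub>R X2))"
proof -
  obtain r where r: "0 < r" "ball y r \<subseteq> \<Omega>" using \<Omega> y open_contains_ball by blast
  define e' where "e' = min e (min e r / (norm V + 1))"
  have nV: "0 < norm V + 1" by (simp add: add_nonneg_pos)
  have e': "0 < e'" "e' \<le> e" using e r nV by (auto simp: e'_def)
  have small: "norm (s *\<^sub>R V) < min e r" if "\<bar>s\<bar> < e'" for s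
  proof -
    have "\<bar>s\<bar> * norm V \<le> \<bar>s\<bar> * (norm V + 1)" by (intro mult_left_mono) auto
    also have "\<dots> < min e r" using that nV unfolding e'_def by (simp add: pos_less_divide_eq)
    finally show ?thesis by simp
  qed
  have cs: "\<bar>c * s\<bar> < e" if "\<bar>s\<bar> < e'" for s
    using that e' mult_right_mono[OF c, of "\<bar>s\<bar>"] by (auto simp: abs_mult)
  have in\<Omega>: "y + s *\<^sub>R V \<in> \<Omega>" if "\<bar>s\<bar> < e'" for s
    using small[OF that] r(2) by (auto simp: dist_norm subset_eq)
  define g where "g = (\<lambda>s. \<zeta> * (v (y + s *\<^sub>R V) - z (t + c * s))
    - K * ((y + s *\<^sub>R V - X (t + c * s)) \<bullet> (y + s *\<^sub>R V - X (t + c * s))))"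
  define g1 where "g1 = (\<lambda>s. \<zeta> * ((\<Sum>j\<in>UNIV. V $ j * pd j v (y + s *\<^sub>R V)) - c * z1 (t + c * s))
    - K * (2 * ((y + s *\<^sub>R V - X (t + c * s)) \<bullet> (V - c *\<^sub>R X1 (t + c * s)))))"
  have line: "((\<lambda>s. y + s *\<^sub>R V) has_derivative (\<lambda>h. h *\<^sub>R V)) (at s)" for s by (auto intro!: derivative_eq_intros)
  have along: "((\<lambda>s. f (y + s *\<^sub>R V)) has_field_derivative dir_deriv f (y + s *\<^sub>R V) V) (at s)"
    if "smooth_on \<Omega> f" "\<bar>s\<bar> < e'" for f s
    unfolding has_field_derivative_def
    by (rule has_derivative_eq_rhs[OF has_derivative_compose[OF line smooth_on_has_derivative[OF that(1) in\<Omega>[OF that(2)]]]])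
      (simp add: fun_eq_iff dir_deriv_scaleR)
  have tc: "((\<lambda>s. t + c * s) has_field_derivative c) (at s)" for s by (auto intro!: derivative_eq_intros)
  have zc: "((\<lambda>s. z (t + c * s)) has_field_derivative z1 (t + c * s) * c) (at s)" if "\<bar>s\<bar> < e'" for s
    by (rule DERIV_chain2[OF z tc]) (use cs[OF that] in simp)
  have Xc: "((\<lambda>s. X (t + c * s)) has_vector_derivative c *\<^sub>R X1 (t + c * s)) (at s)" if "\<bar>s\<bar> < e'" for s
    using vector_diff_chain_at[of "\<lambda>s. t + c * s" c s X "X1 (t + c * s)"] tc X[of "t + c * s"] cs[OF that]
    by (simp add: comp_def has_real_derivative_iff_has_vector_derivative)
  have dl: "((\<lambda>s. y + s *\<^sub>R V) has_vector_derivative V) (at s)" for s by (auto intro!: derivative_eq_intros)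
  have inn: "((\<lambda>s. f s \<bullet> h s) has_field_derivative (f s \<bullet> h' + f' \<bullet> h s)) (at s)"
    if "(f has_vector_derivative f') (at s)" "(h has_vector_derivative h') (at s)" for f h :: "real \<Rightarrow> real^2" and f' h' s
    using bounded_bilinear.has_vector_derivative[OF bounded_bilinear_inner that]
    by (simp add: has_real_derivative_iff_has_vector_derivative)
  have D: "((\<lambda>s. y + s *\<^sub>R V - X (t + c * s)) has_vector_derivative V - c *\<^sub>R X1 (t + c * s)) (at s)" if "\<bar>s\<bar> < e'" for s
    by (rule has_vector_derivative_diff[OF dl Xc[OF that]])
  have G1: "(g has_field_derivative g1 s) (at s)" if "\<bar>s\<bar> < e'" for s
    unfolding g_def g1_def
    by (rule DERIV_cong, (rule DERIV_diff DERIV_cmult along[OF v that] zc[OF that] inn[OF D[OF that] D[OF that]])+)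
      (simp add: dir_deriv_def inner_commute mult.commute)
  have X1c: "((\<lambda>s. X1 (t + c * s)) has_vector_derivative c *\<^sub>R X2) (at 0)"
    using vector_diff_chain_at[of "\<lambda>s. t + c * s" c 0 X1 X2] tc X1
    by (simp add: comp_def has_real_derivative_iff_has_vector_derivative)
  have z1c: "((\<lambda>s. z1 (t + c * s)) has_field_derivative z2 * c) (at 0)"
    by (rule DERIV_chain2[OF _ tc]) (use z1 in simp)
  have "((\<lambda>s. V - c *\<^sub>R X1 (t + c * s)) has_vector_derivative 0 - c *\<^sub>R (c *\<^sub>R X2)) (at 0)"
    by (intro has_vector_derivative_diff has_vector_derivative_const bounded_linear.has_vector_derivative[OF bounded_linear_scaleR_right] X1c)
  note i2 = inn[OF D[of 0] this]
  have pdl: "((\<lambda>s. \<Sum>j\<in>UNIV. V $ j * pd j v (y + s *\<^sub>R V)) has_field_derivative hess_form v y V V) (at 0)"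
    unfolding hess_form_def using along[OF smooth_on_pd[OF v], of 0] e'(1)
    by (intro DERIV_sum DERIV_cmult) simp
  have G2: "(g1 has_field_derivative (\<zeta> * (hess_form v y V V - c * (z2 * c))
     - K * (2 * ((y - X t) \<bullet> (0 - c *\<^sub>R (c *\<^sub>R X2)) + (V - c *\<^sub>R X1 t) \<bullet> (V - c *\<^sub>R X1 t))))) (at 0)"
    unfolding g1_def using i2 e'(1)
    by (intro DERIV_diff DERIV_cmult pdl z1c) auto
  have mx: "g s \<le> g 0" if "\<bar>s\<bar> < e'" for s
    using max[of "t + c * s" "y + s *\<^sub>R V"] cs[OF that] small[OF that] by (simp add: g_def dist_norm)
  note r12 = second_derivative_local_max[OF e'(1) G1 G2 mx]
  show "\<zeta> * (dir_deriv v y V - c * z1 t) = 2 * K * ((y - X t) \<bullet> (V - c *\<^sub>R X1 t))"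
    using r12(1) by (simp add: g1_def dir_deriv_def)
  show "\<zeta> * (hess_form v y V V - c\<^sup>2 * z2) \<le>
      2 * K * ((V - c *\<^sub>R X1 t) \<bullet> (V - c *\<^sub>R X1 t) - (y - X t) \<bullet> (c\<^sup>2 *\<^sub>R X2))"
    using r12(2) by (simp add: power2_eq_square algebra_simps)
qed

lemma smooth_on_\<sigma>2: "(\<And>j. smooth_on UNIV (\<sigma> j)) \<Longrightarrow> smooth_on UNIV (\<sigma>2 \<sigma> j)"
  unfolding \<sigma>2_def by (rule smooth_on_pd)

lemma continuous_on_field_at [continuous_intros]:
  assumes "\<And>j. smooth_on UNIV (a j)" "continuous_on A g"
  shows "continuous_on A (\<lambda>x. field_at a (g x))"
  unfolding field_at_def
  by (intro continuous_intros continuous_on_compose2[OF smooth_on_continuous_on[OF assms(1)] assms(2)]) auto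

lemma continuous_on_lower_order [continuous_intros]:
  fixes A :: "'b::t2_space set"
  assumes a: "\<And>j. smooth_on UNIV (a j)" and "continuous_on A q" "continuous_on A p" "continuous_on A h"
  shows "continuous_on A (\<lambda>x. lower_order a (q x) (p x) (h x))"
  unfolding lower_order_def by (intro continuous_intros assms)

lemma lower_order_scaleR: "lower_order a q p (c *\<^sub>R h) = c * lower_order a q p h"
  by (simp add: lower_order_def lift_scaleR[symmetric] dir_deriv_scaleR sum_distrib_left mult.left_commute)

lemma hess_form_combine:
  fixes v :: "real^2 \<Rightarrow> real" and x :: "real^2"
  defines "B \<equiv> hess_form v x"
  shows "B (a *\<^sub>R V - b *\<^sub>R W) (a *\<^sub>R V - b *\<^sub>R W) = a\<^sup>2 * B V V + b\<^sup>2 * B W W - a * b * (B V W + B W V)"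
  unfolding B_def hess_form_def
  by (simp add: dir_deriv_diff dir_deriv_scaleR sum_2 algebra_simps power2_eq_square)

lemma field_at_lipschitz_on_compact:
  assumes \<sigma>: "\<And>j. smooth_on UNIV (\<sigma> j)" and Q: "compact Q"
  obtains L where "0 \<le> L"
    "\<And>q q0. q \<in> Q \<Longrightarrow> q0 \<in> Q \<Longrightarrow> norm (field_at \<sigma> q - field_at \<sigma> q0) \<le> L * norm (q - q0)"
proof -
  obtain Lj where Lj: "\<And>j. (Lj j)-lipschitz_on Q (\<sigma> j)" using smooth_lipschitz_on_compact[OF \<sigma> Q] by metis
  show ?thesis
  proof (rule that[of "Lj 1 + Lj 2"])
    fix q q0 assume q: "q \<in> Q" "q0 \<in> Q"
    have "norm (field_at \<sigma> q - field_at \<sigma> q0) \<le> (\<Sum>i\<in>UNIV. \<bar>(field_at \<sigma> q - field_at \<sigma> q0) $ i\<bar>)" by (rule norm_le_l1_cart)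
    also have "\<dots> \<le> Lj 1 * norm (q - q0) + Lj 2 * norm (q - q0)"
      unfolding sum_2 using lipschitz_onD[OF Lj[of 1] q] lipschitz_onD[OF Lj[of 2] q]
      by (intro add_mono) (auto simp: dist_norm)
    finally show "norm (field_at \<sigma> q - field_at \<sigma> q0) \<le> (Lj 1 + Lj 2) * norm (q - q0)" by (simp add: algebra_simps)
  qed (use lipschitz_on_nonneg[OF Lj] in auto)
qed

text \<open>The lower-order terms carrying the factor \<open>\<epsilon>\<^sup>2\<close> after multiplication of the equation by
  \<open>(1 + |\<nabla>\<^sub>\<epsilon> u|\<^sup>2)\<close> to the power \<open>3/2\<close>.\<close>
definition eps_part :: "(2 \<Rightarrow> real^3 \<Rightarrow> real) \<Rightarrow> real^3 \<Rightarrow> real^2 \<Rightarrow> real" where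
  "eps_part \<sigma> q p = (let S = field_at \<sigma> q; S2 = field_at (\<sigma>2 \<sigma>) q in
     (p \<bullet> S2)\<^sup>2 * lower_order \<sigma> q p S + (1 + (p \<bullet> S)\<^sup>2) * lower_order (\<sigma>2 \<sigma>) q p S2
     - (p \<bullet> S) * (p \<bullet> S2) * (lower_order (\<sigma>2 \<sigma>) q p S + lower_order \<sigma> q p S2))"

text \<open>The combination of the two fields whose coefficients are the rotated gradient; its inner
  product with \<open>p\<close> is zero.\<close>

definition mixed_field :: "(2 \<Rightarrow> real^3 \<Rightarrow> real) \<Rightarrow> real^3 \<Rightarrow> real^2 \<Rightarrow> real^2" where
  "mixed_field \<sigma> q p = (p \<bullet> field_at (\<sigma>2 \<sigma>) q) *\<^sub>R field_at \<sigma> q - (p \<bullet> field_at \<sigma> q) *\<^sub>R field_at (\<sigma>2 \<sigma>) q"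

text \<open>With \<open>p = Du\<close> and \<open>P\<^sub>i = X\<^sub>i u\<close>, the coefficient matrix \<open>(1 + |P|\<^sup>2) I - P P\<^sup>T\<close> equals
  \<open>I + P\<^sup>\<bottom> (P\<^sup>\<bottom>)\<^sup>T\<close>, so the second-order part is a sum of three squares, the last two of order \<open>\<epsilon>\<^sup>2\<close>.\<close>
lemma L_op_eq_0_squares:
  fixes v :: "real^2 \<Rightarrow> real"
  assumes \<sigma>: "\<And>j. smooth_on UNIV (\<sigma> j)" and v: "smooth_on \<Omega> v" and x: "x \<in> \<Omega>"
    and L: "L_op \<sigma> \<epsilon> v x = 0"
    and q: "q = lift x (v x)" and p: "\<And>j. pd j v x = p $ j"
  shows "hess_form v x (field_at \<sigma> q) (field_at \<sigma> q)
    + hess_form v x (\<epsilon> *\<^sub>R field_at (\<sigma>2 \<sigma>) q) (\<epsilon> *\<^sub>R field_at (\<sigma>2 \<sigma>) q)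
    + hess_form v x (\<epsilon> *\<^sub>R mixed_field \<sigma> q p) (\<epsilon> *\<^sub>R mixed_field \<sigma> q p)
    + lower_order \<sigma> q p (field_at \<sigma> q) + \<epsilon>\<^sup>2 * eps_part \<sigma> q p = 0"
proof -
  define S S2 where "S = field_at \<sigma> q" and "S2 = field_at (\<sigma>2 \<sigma>) q"
  have pv: "(\<chi> j. pd j v x) = p" using p by (simp add: vec_eq_iff)
  have og: "on_graph v x = q" by (simp add: q on_graph_eq_lift)
  have mixed: "\<epsilon> *\<^sub>R mixed_field \<sigma> q p = (p \<bullet> (\<epsilon> *\<^sub>R S2)) *\<^sub>R S - (p \<bullet> S) *\<^sub>R (\<epsilon> *\<^sub>R S2)"
    by (simp add: mixed_field_def S_def S2_def algebra_simps)
  have e: "\<epsilon>\<^sup>2 * eps_part \<sigma> q p = (p \<bullet> (\<epsilon> *\<^sub>R S2))\<^sup>2 * lower_order \<sigma> q p S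
      + (1 + (p \<bullet> S)\<^sup>2) * (\<epsilon> * lower_order (\<sigma>2 \<sigma>) q p (\<epsilon> *\<^sub>R S2))
      - (p \<bullet> S) * (p \<bullet> (\<epsilon> *\<^sub>R S2)) * (\<epsilon> * lower_order (\<sigma>2 \<sigma>) q p S + lower_order \<sigma> q p (\<epsilon> *\<^sub>R S2))"
    by (simp add: eps_part_def Let_def S_def S2_def lower_order_scaleR algebra_simps power2_eq_square)
  show ?thesis
    using L_op_eq_0_expand[OF \<sigma> v x L] unfolding og pv S_def[symmetric] S2_def[symmetric] mixed e hess_form_combine
    by (simp add: algebra_simps)
qed

text \<open>The first-order conditions identify the gradient of \<open>v\<close> at \<open>y\<close>
  with \<open>p\<close>, and \<open>z1 t\<close> with \<open>p\<close> applied to the velocity of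
  the curve. Hence the acceleration of the curve paired with \<open>p\<close> is precisely the
  lower-order term of the operator at \<open>q0\<close>; subtracting the equation at
  \<open>q\<close> leaves differences between \<open>q\<close> and \<open>q0\<close> besides the
  \<open>\<epsilon>\<close> terms. The two values of \<open>\<zeta>\<close> treat contact from above
  and from below at once.\<close>

lemma contact_inequality:
  fixes v :: "real^2 \<Rightarrow> real" and X X1 :: "real \<Rightarrow> real^2" and z z1 :: "real \<Rightarrow> real"
  assumes \<sigma>: "\<And>j. smooth_on UNIV (\<sigma> j)" and v: "smooth_on \<Omega> v" and \<Omega>: "open \<Omega>" and y: "y \<in> \<Omega>" and e: "0 < e"
    and L: "L_op \<sigma> \<epsilon> v y = 0" and \<zeta>: "\<zeta> \<in> {1, -1}"
    and X: "\<And>s. \<bar>s - t\<bar> < e \<Longrightarrow> (X has_vector_derivative field_at \<sigma> (lift (X s) (z s))) (at s)"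
    and z: "\<And>s. \<bar>s - t\<bar> < e \<Longrightarrow> (z has_field_derivative z1 s) (at s)" and z1: "(z1 has_field_derivative - (2 * \<zeta> * \<delta>)) (at t)"
    and max: "\<And>s w. \<bar>s - t\<bar> < e \<Longrightarrow> dist w y < e \<Longrightarrow>
      \<zeta> * (v w - z s) - K * ((w - X s) \<bullet> (w - X s)) \<le> \<zeta> * (v y - z t) - K * ((y - X t) \<bullet> (y - X t))"
  defines "q \<equiv> lift y (v y)" and "q0 \<equiv> lift (X t) (z t)" and "p \<equiv> (2 * K * \<zeta>) *\<^sub>R (y - X t)"
  shows "2 * \<delta> \<le> 2 * K * (norm (field_at \<sigma> q - field_at \<sigma> q0))\<^sup>2
     + 2 * K * \<epsilon>\<^sup>2 * ((norm (field_at (\<sigma>2 \<sigma>) q))\<^sup>2 + (norm (mixed_field \<sigma> q p))\<^sup>2)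
     + \<zeta> * (lower_order \<sigma> q p (field_at \<sigma> q) - lower_order \<sigma> q0 p (field_at \<sigma> q0)) + \<zeta> * (\<epsilon>\<^sup>2 * eps_part \<sigma> q p)"
proof -
  have \<zeta>2: "\<zeta> * \<zeta> = 1" using \<zeta> by auto
  define X1 where "X1 = (\<lambda>s. field_at \<sigma> (lift (X s) (z s)))"
  define X2 where "X2 = (\<chi> j. dir_deriv (\<sigma> j) q0 (lift (X1 t) (z1 t)))"
  have X': "(X has_vector_derivative X1 s) (at s)" if "\<bar>s - t\<bar> < e" for s using X[OF that] by (simp add: X1_def)
  have X1': "(X1 has_vector_derivative X2) (at t)"
  proof -
    have "(X has_derivative (\<lambda>h. h *\<^sub>R X1 t)) (at t)" using X'[of t] e by (simp add: has_vector_derivative_def)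
    moreover have "(z has_derivative (\<lambda>h. h * z1 t)) (at t)"
    proof -
      have "(\<lambda>h. h * z1 t) = (*) (z1 t)" by (simp add: fun_eq_iff)
      then show ?thesis using z[of t] e by (simp add: has_field_derivative_def)
    qed
    ultimately have lf: "((\<lambda>s. lift (X s) (z s)) has_derivative (\<lambda>h. lift (h *\<^sub>R X1 t) (h * z1 t))) (at t)"
      by (rule has_derivative_lift)
    have "((\<lambda>s. \<sigma> j (lift (X s) (z s))) has_derivative (\<lambda>h. dir_deriv (\<sigma> j) q0 (lift (h *\<^sub>R X1 t) (h * z1 t)))) (at t)" for j
      using has_derivative_compose[OF lf, of "\<sigma> j"] smooth_on_has_derivative[OF \<sigma> UNIV_I, of j q0] by (simp add: q0_def)
    then have j: "((\<lambda>s. \<sigma> j (lift (X s) (z s))) has_derivative (\<lambda>h. h * dir_deriv (\<sigma> j) q0 (lift (X1 t) (z1 t)))) (at t)" for j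
      by (simp add: lift_scaleR[symmetric] dir_deriv_scaleR)
    have "(X1 has_derivative (\<lambda>h. \<Sum>j\<in>UNIV. (h * X2 $ j) *\<^sub>R axis j 1)) (at t)"
    proof -
      have X1e: "X1 = (\<lambda>s. \<Sum>j\<in>UNIV. \<sigma> j (lift (X s) (z s)) *\<^sub>R axis j 1)"
        by (simp add: X1_def fun_eq_iff vec_eq_iff axis_def sum.delta if_distrib cong: if_cong)
      have "((\<lambda>s. \<Sum>j\<in>UNIV. \<sigma> j (lift (X s) (z s)) *\<^sub>R axis j (1::real)) has_derivative
          (\<lambda>h. \<Sum>j\<in>UNIV. (h * X2 $ j) *\<^sub>R axis j 1)) (at t)"
        using j by (intro has_derivative_sum has_derivative_scaleR_left) (simp add: X2_def)
      then show ?thesis by (rule ssubst[OF X1e])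
    qed
    moreover have "(\<Sum>j\<in>UNIV. (h * X2 $ j) *\<^sub>R axis j 1) = h *\<^sub>R X2" for h
      by (simp add: vec_eq_iff axis_def sum.delta if_distrib cong: if_cong)
    ultimately show ?thesis by (simp add: has_vector_derivative_def)
  qed
  note test = penalised_max_test[OF v \<Omega> y e X' X1' z z1 max]
  have dp: "dir_deriv v y V = p \<bullet> V" for V
  proof -
    have "\<zeta> * dir_deriv v y V = 2 * K * ((y - X t) \<bullet> V)" using test(1)[of 0 V] by simp
    then have "\<zeta> * \<zeta> * dir_deriv v y V = \<zeta> * (2 * K * ((y - X t) \<bullet> V))" by (simp add: mult.assoc)
    then show ?thesis unfolding \<zeta>2 by (simp add: p_def)
  qed
  have pj: "pd j v y = p $ j" for j
  proof -
    have "dir_deriv v y (axis j 1) = pd j v y"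
      by (simp add: dir_deriv_def axis_def mult_delta_left sum.delta)
    then show ?thesis using dp[of "axis j 1"] by (simp add: inner_axis)
  qed
  have z1t: "z1 t = p \<bullet> X1 t"
  proof -
    \<comment> \<open>Pure motion in time: \<open>c = 1\<close> and \<open>V = 0\<close>.\<close>
    have "\<zeta> * z1 t = 2 * K * ((y - X t) \<bullet> X1 t)" using test(1)[of 1 0] by (simp add: dir_deriv_def)
    then have "\<zeta> * \<zeta> * z1 t = \<zeta> * (2 * K * ((y - X t) \<bullet> X1 t))" by (simp add: mult.assoc)
    then show ?thesis unfolding \<zeta>2 by (simp add: p_def)
  qed
  have H0: "\<zeta> * hess_form v y V V \<le> 2 * K * (V \<bullet> V)" for V using test(2)[of 0 V] by simp
  have low0: "p \<bullet> X2 = lower_order \<sigma> q0 p (field_at \<sigma> q0)"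
    by (simp add: lower_order_def X2_def inner_vec_def z1t X1_def q0_def)
  have pX2: "2 * K * ((y - X t) \<bullet> X2) = \<zeta> * (p \<bullet> X2)"
    using \<zeta>2 by (simp add: p_def mult.left_commute[of _ \<zeta>] mult.assoc[symmetric])
  have H1: "\<zeta> * hess_form v y (field_at \<sigma> q) (field_at \<sigma> q) \<le> - (2 * \<delta>)
      + 2 * K * (norm (field_at \<sigma> q - field_at \<sigma> q0))\<^sup>2 - \<zeta> * lower_order \<sigma> q0 p (field_at \<sigma> q0)"
  proof -
    have "\<zeta> * (hess_form v y (field_at \<sigma> q) (field_at \<sigma> q) + 2 * \<zeta> * \<delta>) \<le>
        2 * K * ((field_at \<sigma> q - X1 t) \<bullet> (field_at \<sigma> q - X1 t)) - 2 * K * ((y - X t) \<bullet> X2)"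
      using test(2)[of 1 "field_at \<sigma> q"] by (simp add: right_diff_distrib)
    moreover have "\<zeta> * (hess_form v y (field_at \<sigma> q) (field_at \<sigma> q) + 2 * \<zeta> * \<delta>) =
        \<zeta> * hess_form v y (field_at \<sigma> q) (field_at \<sigma> q) + 2 * \<delta>"
      using \<zeta>2 by (simp add: distrib_left mult.assoc[symmetric] mult.left_commute[of \<zeta> 2])
    ultimately show ?thesis unfolding pX2 low0 power2_norm_eq_inner by (simp add: X1_def q0_def)
  qed
  \<comment> \<open>In the transverse directions the curve gives no compensation and the full
    \<open>2 * K\<close> is paid, but with the factor \<open>\<epsilon>\<^sup>2\<close>.\<close>
  have H2: "\<zeta> * hess_form v y (\<epsilon> *\<^sub>R V) (\<epsilon> *\<^sub>R V) \<le> 2 * K * \<epsilon>\<^sup>2 * (norm V)\<^sup>2" for V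
    using H0[of "\<epsilon> *\<^sub>R V"] unfolding power2_norm_eq_inner by (simp add: power2_eq_square mult.assoc)
  have "\<zeta> * 0 = \<zeta> * hess_form v y (field_at \<sigma> q) (field_at \<sigma> q)
    + \<zeta> * hess_form v y (\<epsilon> *\<^sub>R field_at (\<sigma>2 \<sigma>) q) (\<epsilon> *\<^sub>R field_at (\<sigma>2 \<sigma>) q)
    + \<zeta> * hess_form v y (\<epsilon> *\<^sub>R mixed_field \<sigma> q p) (\<epsilon> *\<^sub>R mixed_field \<sigma> q p)
    + \<zeta> * lower_order \<sigma> q p (field_at \<sigma> q) + \<zeta> * (\<epsilon>\<^sup>2 * eps_part \<sigma> q p)"
    unfolding L_op_eq_0_squares[OF \<sigma> v y L q_def[THEN meta_eq_to_obj_eq] pj, symmetric] by (simp only: distrib_left)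
  then show ?thesis
    using H1 H2[of "field_at (\<sigma>2 \<sigma>) q"] H2[of "mixed_field \<sigma> q p"]
    unfolding distrib_left right_diff_distrib by linarith
qed

text \<open>Doubling of variables: \<open>\<zeta> (v\<^sub>n y - z t) - K |y - X t|\<^sup>2\<close> is maximised in \<open>(t, y)\<close>. Since
  \<open>(X, z)\<close> is an integral curve of the lifted field, all errors in the contact inequality
  are \<open>O(1/K)\<close>, whatever the large Hessian \<open>2 K\<close> of the penalisation.\<close>
lemma no_strict_contact:
  fixes v :: "nat \<Rightarrow> real^2 \<Rightarrow> real" and X :: "real \<Rightarrow> real^2" and z z1 :: "real \<Rightarrow> real"
  assumes \<sigma>: "\<And>j. smooth_on UNIV (\<sigma> j)" and \<Omega>: "open \<Omega>"
    and v: "\<And>n. smooth_on \<Omega> (v n)" and L: "\<And>n x. x \<in> \<Omega> \<Longrightarrow> L_op \<sigma> (\<epsilon> n) (v n) x = 0"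
    and \<epsilon>: "\<epsilon> \<longlonglongrightarrow> 0" and lip: "\<And>n. l-lipschitz_on \<Omega> (v n)"
    and conv: "\<And>K. compact K \<Longrightarrow> K \<subseteq> \<Omega> \<Longrightarrow> uniform_limit K v u sequentially"
    and \<zeta>: "\<zeta> \<in> {1, -1}" and \<delta>: "0 < \<delta>" and r: "0 < r"
    and contX: "continuous_on {0..r} X" and X\<Omega>: "X ` {0..r} \<subseteq> \<Omega>"
    and X: "\<And>t. 0 < t \<Longrightarrow> t < r \<Longrightarrow> (X has_vector_derivative field_at \<sigma> (lift (X t) (z t))) (at t)"
    and z: "\<And>t. (z has_field_derivative z1 t) (at t)" and z1: "\<And>t. (z1 has_field_derivative - (2 * \<zeta> * \<delta>)) (at t)"
    and above: "\<And>t. t \<in> {0..r} \<Longrightarrow> 0 \<le> \<zeta> * (z t - u (X t))"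
    and ends: "0 < \<zeta> * (z 0 - u (X 0))" "0 < \<zeta> * (z r - u (X r))"
    and contact: "tc \<in> {0..r}" "z tc = u (X tc)"
  shows False
proof -
  have \<zeta>1: "\<bar>\<zeta>\<bar> = 1" using \<zeta> by auto
  have l0: "0 \<le> l" using lip lipschitz_on_nonneg by blast
  have "compact (X ` {0..r})" by (rule compact_continuous_image[OF contX compact_Icc])
  then obtain K1 \<eta> where K1: "compact K1" "K1 \<subseteq> \<Omega>" "0 < \<eta>" "X ` {0..r} \<subseteq> K1"
      and tube: "\<And>x y. x \<in> X ` {0..r} \<Longrightarrow> dist x y \<le> \<eta> \<Longrightarrow> y \<in> K1"
    using compact_neighbourhood[OF _ \<Omega> X\<Omega>] by metis
  have contz: "continuous_on A z" for A using z by (intro continuous_at_imp_continuous_on ballI DERIV_isCont)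
  \<comment> \<open>One constant for three bounds by \<open>C / K\<close>: the distance
    \<open>d\<close>, the gap \<open>e\<close> between curve and graph, and the difference
    \<open>v n y - z t\<close>.\<close>
  define C where "C = (l + 2) * (l + 2) + 2"
  have "0 < C" unfolding C_def using l0 by (intro add_nonneg_pos) auto
  then have C: "0 < C" "1 + l * (l + 2) \<le> C" "2 + l * (l + 2) \<le> C" "l + 2 \<le> C"
    using l0 by (auto simp: C_def algebra_simps)
  obtain Rx where Rx: "\<And>y. y \<in> K1 \<Longrightarrow> norm y \<le> Rx" using compact_imp_bounded[OF K1(1)] by (auto simp: bounded_iff)
  have "\<exists>B. \<forall>t\<in>{0..r}. \<bar>z t\<bar> \<le> B"
    using compact_imp_bounded[OF compact_continuous_image[OF contz compact_Icc]] by (simp add: bounded_iff)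
  then obtain Rz where Rz: "\<And>t. t \<in> {0..r} \<Longrightarrow> \<bar>z t\<bar> \<le> Rz" by blast
  define Q where "Q = cball (0::real^3) (2 * Rx + Rz + C)"
  \<comment> \<open>The gradient \<open>p\<close> will stay in this ball because
    \<open>K * d \<le> l + 2\<close>.\<close>
  define PB where "PB = cball (0::real^2) (2 * (l + 2))"
  have QP: "compact (Q \<times> PB)" "compact Q" by (auto simp: Q_def PB_def intro!: compact_Times)
  obtain Ls where Ls0: "0 \<le> Ls"
      and Ls: "\<And>q q0. q \<in> Q \<Longrightarrow> q0 \<in> Q \<Longrightarrow> norm (field_at \<sigma> q - field_at \<sigma> q0) \<le> Ls * norm (q - q0)"
    using field_at_lipschitz_on_compact[of \<sigma> Q, OF \<sigma> QP(2)] by blast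
  define M where "M = (\<lambda>(q,p). (norm (field_at (\<sigma>2 \<sigma>) q))\<^sup>2 + (norm (mixed_field \<sigma> q p))\<^sup>2 + \<bar>eps_part \<sigma> q p\<bar>)"
  have "continuous_on (Q \<times> PB) M"
    unfolding M_def case_prod_beta mixed_field_def eps_part_def Let_def
    by (intro continuous_intros \<sigma> smooth_on_\<sigma>2)
  from compact_imp_bounded[OF compact_continuous_image[OF this QP(1)]]
  have "\<exists>B. \<forall>w\<in>Q \<times> PB. \<bar>M w\<bar> \<le> B" by (simp add: bounded_iff)
  then obtain M0 where M0': "\<And>w. w \<in> Q \<times> PB \<Longrightarrow> \<bar>M w\<bar> \<le> M0" by blast
  have M0: "(norm (field_at (\<sigma>2 \<sigma>) q))\<^sup>2 + (norm (mixed_field \<sigma> q p))\<^sup>2 + \<bar>eps_part \<sigma> q p\<bar> \<le> \<bar>M0\<bar>" if "q \<in> Q" "p \<in> PB" for q p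
    using M0'[of "(q, p)"] that by (simp add: M_def)
  define H where "H = (\<lambda>(q,p). lower_order \<sigma> q p (field_at \<sigma> q))"
  have "continuous_on (Q \<times> PB) H" unfolding H_def case_prod_beta by (intro continuous_intros \<sigma>)
  then have "uniformly_continuous_on (Q \<times> PB) H" using QP(1) by (rule compact_uniformly_continuous)
  then obtain d0 where d0: "0 < d0" "\<And>w w'. w \<in> Q \<times> PB \<Longrightarrow> w' \<in> Q \<times> PB \<Longrightarrow> dist w' w < d0 \<Longrightarrow> dist (H w') (H w) < \<delta>"
    using \<delta> unfolding uniformly_continuous_on_def by metis
  have Hd: "\<bar>lower_order \<sigma> q p (field_at \<sigma> q) - lower_order \<sigma> q0 p (field_at \<sigma> q0)\<bar> < \<delta>"
    if "q \<in> Q" "q0 \<in> Q" "p \<in> PB" "norm (q - q0) < d0" for q q0 p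
    using d0(2)[of "(q0,p)" "(q,p)"] that by (simp add: H_def dist_norm norm_Pair)
  \<comment> \<open>The gaps at the end times keep the maximum away from them, \<open>\<eta>\<close>
    keeps \<open>y\<close> inside the tube, and \<open>d0 / 3\<close> brings \<open>q\<close> and
    \<open>q0\<close> closer than \<open>d0\<close>.\<close>
  define E where "E = min (min (\<zeta> * (z 0 - u (X 0))) (\<zeta> * (z r - u (X r)))) (min \<eta> (d0 / 3))"
  have E0: "0 < E" using ends K1(3) d0(1) by (simp add: E_def)
  have "eventually (\<lambda>k::real. 0 < k \<and> 1 \<le> k \<and> C / k < E \<and> 2 * (Ls * (3 * C))\<^sup>2 / k + 3 * \<bar>M0\<bar> / k < \<delta>) at_top"
  proof -
    have 1: "((\<lambda>k::real. C / k) \<longlongrightarrow> 0) at_top" "((\<lambda>k::real. 2 * (Ls * (3 * C))\<^sup>2 / k + 3 * \<bar>M0\<bar> / k) \<longlongrightarrow> 0 + 0) at_top"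
      by (intro tendsto_add tendsto_divide_0[OF tendsto_const] filterlim_at_top_imp_at_infinity filterlim_ident)+
    have "eventually (\<lambda>k::real. C / k < E) at_top" using order_tendstoD(2)[OF 1(1) E0] .
    moreover have "eventually (\<lambda>k::real. 2 * (Ls * (3 * C))\<^sup>2 / k + 3 * \<bar>M0\<bar> / k < \<delta>) at_top"
      using order_tendstoD(2)[OF 1(2), of \<delta>] \<delta> by simp
    moreover have "eventually (\<lambda>k::real. 1 \<le> k) at_top" by (rule eventually_ge_at_top)
    ultimately show ?thesis by eventually_elim auto
  qed
  then obtain K where K: "0 < K" "1 \<le> K" "C / K < E" "2 * (Ls * (3 * C))\<^sup>2 / K + 3 * \<bar>M0\<bar> / K < \<delta>"
    using eventually_happens'[OF trivial_limit_at_top_linorder] by blast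
  \<comment> \<open>With \<open>K\<close> fixed, \<open>n\<close> is chosen so that both errors are
    below \<open>1 / K\<close>, whence
    \<open>K * (\<epsilon> n)\<^sup>2 \<le> 1 / K\<close>.\<close>
  have "eventually (\<lambda>n. \<forall>x\<in>K1. dist (v n x) (u x) < 1 / K) sequentially"
    using conv[OF K1(1,2)] K(1) by (auto simp: uniform_limit_iff)
  moreover have "eventually (\<lambda>n. \<bar>\<epsilon> n\<bar> < 1 / K) sequentially"
    using tendstoD[OF \<epsilon>, of "1/K"] K(1) by (simp add: dist_real_def)
  ultimately have "eventually (\<lambda>n. (\<forall>x\<in>K1. dist (v n x) (u x) < 1 / K) \<and> \<bar>\<epsilon> n\<bar> < 1 / K) sequentially"
    by eventually_elim auto
  then obtain n where vu: "\<And>x. x \<in> K1 \<Longrightarrow> \<bar>v n x - u x\<bar> < 1 / K" and \<epsilon>n: "\<bar>\<epsilon> n\<bar> < 1 / K"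
    using eventually_happens'[OF trivial_limit_sequentially] by (fastforce simp: dist_real_def)
  have Ke2: "K * (\<epsilon> n)\<^sup>2 \<le> 1 / K"
  proof -
    have "(\<epsilon> n)\<^sup>2 \<le> (1 / K)\<^sup>2" using \<epsilon>n K(1) by (intro abs_le_square_iff[THEN iffD1]) simp
    then have "K * (\<epsilon> n)\<^sup>2 \<le> K * (1 / K)\<^sup>2" using K(1) by (intro mult_left_mono) auto
    then show ?thesis using K(1) by (simp add: power2_eq_square)
  qed
  have e2: "(\<epsilon> n)\<^sup>2 \<le> 1 / K" using Ke2 K(2) mult_right_mono[OF K(2), of "(\<epsilon> n)\<^sup>2"] by simp
  define F where "F = (\<lambda>t y. \<zeta> * (v n y - z t) - K * ((y - X t) \<bullet> (y - X t)))"
  have contv: "continuous_on K1 (v n)" using smooth_on_continuous_on[OF v] K1(2) continuous_on_subset by blast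
  have cF: "continuous_on ({0..r} \<times> K1) (\<lambda>w. F (fst w) (snd w))"
    unfolding F_def
    by (intro continuous_intros continuous_on_compose2[OF contv] continuous_on_compose2[OF contz[of UNIV]] continuous_on_compose2[OF contX]) auto
  have "{0..r} \<times> K1 \<noteq> {}" using contact(1) K1(4) by auto
  then obtain t y where t: "t \<in> {0..r}" and y: "y \<in> K1" and mx: "\<And>s w. s \<in> {0..r} \<Longrightarrow> w \<in> K1 \<Longrightarrow> F s w \<le> F t y"
    using continuous_attains_sup[OF compact_Times[OF compact_Icc K1(1)] _ cF] by fastforce
  define d where "d = norm (y - X t)"
  have dd: "(y - X t) \<bullet> (y - X t) = d * d" by (simp add: d_def power2_norm_eq_inner[symmetric] power2_eq_square)
  have Xt: "X t \<in> K1" "X tc \<in> K1" using t contact(1) K1(4) by auto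
  \<comment> \<open>Comparison with the contact point, where the penalty vanishes.\<close>
  have F0: "- (1 / K) \<le> F t y"
  proof -
    have "\<bar>\<zeta> * (v n (X tc) - u (X tc))\<bar> < 1 / K" using vu[OF Xt(2)] \<zeta>1 by (simp add: abs_mult)
    then have "- (1 / K) \<le> F tc (X tc)" by (simp add: F_def contact(2))
    also have "\<dots> \<le> F t y" using mx contact(1) Xt by blast
    finally show ?thesis .
  qed
  define e where "e = \<zeta> * (z t - u (X t))"
  have e0: "0 \<le> e" using above[OF t] by (simp add: e_def)
  have vz: "\<zeta> * (v n y - z t) \<le> - e + 1 / K + l * d"
  proof -
    have "\<bar>\<zeta> * (v n y - v n (X t))\<bar> \<le> l * d"
      using lipschitz_onD[OF lip, of y "X t" n] y Xt K1(2) \<zeta>1 by (auto simp: abs_mult dist_norm d_def)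
    moreover have "\<bar>\<zeta> * (v n (X t) - u (X t))\<bar> \<le> 1 / K" using vu[OF Xt(1)] \<zeta>1 by (simp add: abs_mult)
    ultimately show ?thesis unfolding e_def right_diff_distrib by linarith
  qed
  have main: "K * (d * d) \<le> - e + 2 / K + l * d" using F0 vz unfolding F_def dd by linarith
  \<comment> \<open>Leaving the curve by \<open>d\<close> gains at most \<open>l * d\<close>, so the
    square of \<open>K * d\<close> is at most \<open>2 + l * (K * d)\<close>, which is impossible
    once \<open>K * d > l + 2\<close>.\<close>
  have Kd: "K * d \<le> l + 2"
  proof (rule ccontr)
    assume a: "\<not> K * d \<le> l + 2"
    have "K * (K * (d * d)) \<le> K * (2 / K + l * d)" using main e0 K(1) by (intro mult_left_mono) auto
    then have "(K * d) * (K * d) \<le> 2 + l * (K * d)" using K(1) by (simp add: algebra_simps)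
    moreover have "(l + 2) * (K * d) < (K * d) * (K * d)" using a l0 by (intro mult_strict_right_mono) auto
    moreover have "2 * 1 < 2 * (K * d)" using a l0 by linarith
    ultimately show False by (simp add: algebra_simps)
  qed
  have d_le: "d \<le> (l + 2) / K" using Kd K(1) by (simp add: field_simps)
  have dK: "d \<le> C / K" by (rule order_trans[OF d_le]) (use C(4) K(1) in \<open>simp add: divide_right_mono\<close>)
  have ld: "l * d \<le> l * (l + 2) / K" using mult_left_mono[OF d_le l0] by simp
  have e_le: "e \<le> C / K"
  proof -
    have "0 \<le> K * (d * d)" using K(1) by simp
    then have "e \<le> 2 / K + l * (l + 2) / K" using main ld by linarith
    also have "\<dots> = (2 + l * (l + 2)) / K" by (simp add: add_divide_distrib)
    also have "\<dots> \<le> C / K" using C(3) K(1) by (intro divide_right_mono) auto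
    finally show ?thesis .
  qed
  have vzabs: "\<bar>v n y - z t\<bar> \<le> C / K"
  proof -
    have "0 \<le> K * (d * d)" using K(1) by simp
    then have "- (1 / K) \<le> \<zeta> * (v n y - z t)" using F0 unfolding F_def dd by linarith
    moreover have "\<zeta> * (v n y - z t) \<le> 1 / K + l * (l + 2) / K" using vz ld e0 by linarith
    moreover have "1 / K + l * (l + 2) / K \<le> C / K"
      unfolding add_divide_distrib[symmetric] using C(2) K(1) by (intro divide_right_mono) auto
    moreover have "0 \<le> l * (l + 2)" using l0 by simp
    then have "1 / K \<le> C / K" using C(2) K(1) by (intro divide_right_mono) linarith+
    ultimately have "\<bar>\<zeta> * (v n y - z t)\<bar> \<le> C / K" by linarith
    then show ?thesis using \<zeta>1 by (simp add: abs_mult)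
  qed
  have "t \<noteq> 0" "t \<noteq> r" using e_le K(3) by (auto simp: e_def E_def)
  then have tr: "0 < t" "t < r" using t by auto
  \<comment> \<open>A window inside both the time interval and the tube, so that the maximum counts
    as an interior local one.\<close>
  define \<rho> where "\<rho> = min (min t (r - t)) (\<eta> - d)"
  have \<rho>: "0 < \<rho>" using tr dK K(3) by (auto simp: \<rho>_def E_def)
  have loc: "\<zeta> * (v n w - z s) - K * ((w - X s) \<bullet> (w - X s)) \<le> \<zeta> * (v n y - z t) - K * ((y - X t) \<bullet> (y - X t))"
    if "\<bar>s - t\<bar> < \<rho>" "dist w y < \<rho>" for s w
  proof -
    have "s \<in> {0..r}" using that(1) by (auto simp: \<rho>_def)
    moreover have "dist (X t) w \<le> \<eta>"
      using that(2) dist_triangle[of "X t" w y] by (simp add: \<rho>_def d_def dist_norm norm_minus_commute)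
    then have "w \<in> K1" using tube[of "X t" w] t by blast
    ultimately show ?thesis using mx unfolding F_def by blast
  qed
  define q q0 p where "q = lift y (v n y)" and "q0 = lift (X t) (z t)" and "p = (2 * K * \<zeta>) *\<^sub>R (y - X t)"
  have X': "(X has_vector_derivative field_at \<sigma> (lift (X s) (z s))) (at s)" if "\<bar>s - t\<bar> < \<rho>" for s
    by (rule X) (use that in \<open>auto simp: \<rho>_def\<close>)
  have ineq: "2 * \<delta> \<le> 2 * K * (norm (field_at \<sigma> q - field_at \<sigma> q0))\<^sup>2
     + 2 * K * (\<epsilon> n)\<^sup>2 * ((norm (field_at (\<sigma>2 \<sigma>) q))\<^sup>2 + (norm (mixed_field \<sigma> q p))\<^sup>2)
     + \<zeta> * (lower_order \<sigma> q p (field_at \<sigma> q) - lower_order \<sigma> q0 p (field_at \<sigma> q0)) + \<zeta> * ((\<epsilon> n)\<^sup>2 * eps_part \<sigma> q p)"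
    unfolding q_def q0_def p_def
    by (rule contact_inequality[OF \<sigma> v \<Omega> _ \<rho> L \<zeta> X' z z1 loc]) (use y K1(2) in auto)
  have CK: "C / K \<le> C" using K(1,2) C(1) by (simp add: field_simps)
  have qQ: "q \<in> Q" "q0 \<in> Q"
    using norm_lift_le[of y "v n y"] norm_lift_le[of "X t" "z t"] Rx[OF y] Rx[OF Xt(1)] Rz[OF t] vzabs CK C(1)
    by (auto simp: Q_def q_def q0_def)
  have pP: "p \<in> PB" using Kd K(1) \<zeta>1 by (simp add: PB_def p_def abs_mult d_def)
  have qq: "norm (q - q0) \<le> 3 * C / K"
  proof -
    have "norm (q - q0) \<le> 2 * norm (y - X t) + \<bar>v n y - z t\<bar>"
      unfolding q_def q0_def lift_diff by (rule norm_lift_le)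
    then show ?thesis using dK vzabs by (simp add: d_def)
  qed
  have T1: "2 * K * (norm (field_at \<sigma> q - field_at \<sigma> q0))\<^sup>2 \<le> 2 * (Ls * (3 * C))\<^sup>2 / K"
  proof -
    have "norm (field_at \<sigma> q - field_at \<sigma> q0) \<le> Ls * (3 * C / K)"
      using Ls[OF qQ] mult_left_mono[OF qq Ls0] by linarith
    then have "2 * K * (norm (field_at \<sigma> q - field_at \<sigma> q0))\<^sup>2 \<le> 2 * K * (Ls * (3 * C / K))\<^sup>2"
      using K(1) by (intro mult_left_mono power_mono) auto
    also have "\<dots> = 2 * (Ls * (3 * C))\<^sup>2 / K" using K(1) by (simp add: power2_eq_square field_simps)
    finally show ?thesis .
  qed
  define m1 m2 where "m1 = (norm (field_at (\<sigma>2 \<sigma>) q))\<^sup>2 + (norm (mixed_field \<sigma> q p))\<^sup>2" and "m2 = \<bar>eps_part \<sigma> q p\<bar>"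
  have m: "m1 \<le> \<bar>M0\<bar>" "m2 \<le> \<bar>M0\<bar>" "0 \<le> m1" "0 \<le> m2"
  proof -
    show "0 \<le> m1" "0 \<le> m2" by (simp_all add: m1_def m2_def)
    then show "m1 \<le> \<bar>M0\<bar>" "m2 \<le> \<bar>M0\<bar>" using M0[OF qQ(1) pP] unfolding m1_def[symmetric] m2_def[symmetric] by linarith+
  qed
  have T2: "2 * K * (\<epsilon> n)\<^sup>2 * m1 \<le> 2 * \<bar>M0\<bar> / K"
  proof -
    have "(K * (\<epsilon> n)\<^sup>2) * m1 \<le> (1 / K) * \<bar>M0\<bar>" using Ke2 m K(1) by (intro mult_mono) auto
    then show ?thesis by simp
  qed
  have T3: "\<zeta> * ((\<epsilon> n)\<^sup>2 * eps_part \<sigma> q p) \<le> \<bar>M0\<bar> / K"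
  proof -
    have "\<zeta> * ((\<epsilon> n)\<^sup>2 * eps_part \<sigma> q p) \<le> \<bar>\<zeta> * ((\<epsilon> n)\<^sup>2 * eps_part \<sigma> q p)\<bar>" by (rule abs_ge_self)
    also have "\<dots> = (\<epsilon> n)\<^sup>2 * m2" using \<zeta>1 by (simp add: abs_mult m2_def)
    also have "\<dots> \<le> (1 / K) * \<bar>M0\<bar>" using e2 m K(1) by (intro mult_mono) auto
    finally show ?thesis by simp
  qed
  have T4: "\<zeta> * (lower_order \<sigma> q p (field_at \<sigma> q) - lower_order \<sigma> q0 p (field_at \<sigma> q0)) < \<delta>"
  proof -
    have "3 * C / K < d0" using K(3) by (simp add: E_def mult.commute)
    then have "norm (q - q0) < d0" using qq by linarith
    from Hd[OF qQ pP this] show ?thesis using \<zeta> by auto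
  qed
  have "2 * \<delta> < 2 * (Ls * (3 * C))\<^sup>2 / K + 2 * \<bar>M0\<bar> / K + \<delta> + \<bar>M0\<bar> / K"
    using ineq T1 T2 T3 T4 unfolding m1_def[symmetric] by linarith
  then show False using K(4) by simp
qed

section \<open>Curves of the lifted field\<close>

text \<open>Banach's fixed point theorem in the supremum norm, \<open>r * L \<le> 1 / 2\<close>
  giving the contraction. Projecting onto the ball and clamping time to \<open>{0..r}\<close> puts
  the integral operator on all bounded continuous functions of the real line;
  \<open>r * M \<le> R\<close> keeps the fixed point in the ball, where the projection is the
  identity.\<close>

lemma picard_short_time:
  fixes f :: "real \<Rightarrow> 'a::euclidean_space \<Rightarrow> 'a"
  assumes cont: "continuous_on ({0..r} \<times> cball x0 R) (\<lambda>(t,x). f t x)"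
    and bnd: "\<And>t x. t \<in> {0..r} \<Longrightarrow> x \<in> cball x0 R \<Longrightarrow> norm (f t x) \<le> M"
    and lip: "\<And>t x y. t \<in> {0..r} \<Longrightarrow> x \<in> cball x0 R \<Longrightarrow> y \<in> cball x0 R \<Longrightarrow> norm (f t x - f t y) \<le> L * norm (x - y)"
    and r: "0 \<le> r" "r * M \<le> R" "r * L \<le> 1 / 2" and R: "0 < R" and L: "0 \<le> L"
  obtains X where "X 0 = x0" "\<And>t. t \<in> {0..r} \<Longrightarrow> X t \<in> cball x0 R"
    "\<And>t. t \<in> {0..r} \<Longrightarrow> (X has_vector_derivative f t (X t)) (at t within {0..r})"
proof -
  define P where "P = closest_point (cball x0 R)"
  have ne: "cball x0 R \<noteq> {}" using R by simp
  have Pin: "P x \<in> cball x0 R" for x unfolding P_def by (rule closest_point_in_set[OF closed_cball ne])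
  have Plip: "norm (P x - P y) \<le> norm (x - y)" for x y
    using closest_point_lipschitz[OF convex_cball closed_cball ne, of x y] by (simp add: P_def dist_norm)
  have Pid: "P x = x" if "x \<in> cball x0 R" for x using closest_point_self[OF that] by (simp add: P_def)
  have Pcont: "continuous_on A P" for A
    unfolding P_def by (rule continuous_on_closest_point[OF convex_cball closed_cball ne])
  have M0: "0 \<le> M" using order_trans[OF norm_ge_zero bnd[of 0 x0]] r(1) R by simp
  define g where "g = (\<lambda>\<phi> s. f s (P (\<phi> s)))"
  have gcont: "continuous_on {0..r} (g \<phi>)" if "continuous_on {0..r} \<phi>" for \<phi>
  proof -
    have "continuous_on {0..r} (\<lambda>s. (s, P (\<phi> s)))"
      by (intro continuous_intros continuous_on_compose2[OF Pcont[of UNIV] that]) auto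
    from continuous_on_compose2[OF cont this] show ?thesis
      using Pin by (simp add: g_def image_subset_iff del: mem_cball)
  qed
  have gb: "norm (g \<phi> s) \<le> M" if "s \<in> {0..r}" for \<phi> s unfolding g_def by (rule bnd[OF that Pin])
  define I where "I = (\<lambda>\<phi> t. x0 + integral {0..t} (g \<phi>))"
  have Icont: "continuous_on {0..r} (I \<phi>)" if "continuous_on {0..r} \<phi>" for \<phi>
    unfolding I_def by (intro continuous_intros indefinite_integral_continuous_1 integrable_continuous_real gcont that)
  have sub: "continuous_on {0..t} (g \<phi>)" if "continuous_on {0..r} \<phi>" "t \<in> {0..r}" for \<phi> t
    by (rule continuous_on_subset[OF gcont[OF that(1)]]) (use that(2) in auto)
  have Ib: "norm (I \<phi> t - x0) \<le> R" if "continuous_on {0..r} \<phi>" "t \<in> {0..r}" for \<phi> t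
  proof -
    have "norm (integral {0..t} (g \<phi>)) \<le> M * (t - 0)"
      by (rule integral_bound[OF _ sub[OF that]]) (use that(2) gb in auto)
    also have "\<dots> \<le> M * r" using that(2) M0 by (intro mult_left_mono) auto
    finally show ?thesis using r(2) by (simp add: I_def mult.commute)
  qed
  define cl where "cl = (\<lambda>t::real. max 0 (min r t))"
  have cl: "cl t \<in> {0..r}" "t \<in> {0..r} \<Longrightarrow> cl t = t" for t using r(1) by (auto simp: cl_def)
  define T where "T = (\<lambda>\<phi>::real \<Rightarrow>\<^sub>C 'a. Bcontfun (\<lambda>t. I (apply_bcontfun \<phi>) (cl t)))"
  have appc: "continuous_on A (apply_bcontfun \<phi>)" for A and \<phi> :: "real \<Rightarrow>\<^sub>C 'a" by (rule continuous_on_apply_bcontfun)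
  have Tapp: "apply_bcontfun (T \<phi>) t = I (apply_bcontfun \<phi>) (cl t)" for \<phi> t
  proof -
    have "continuous_on UNIV (\<lambda>t. I (apply_bcontfun \<phi>) (cl t))"
      by (rule continuous_on_compose2[OF Icont[OF appc]]) (use cl(1) in \<open>auto simp: cl_def intro!: continuous_intros\<close>)
    moreover have "bounded (range (\<lambda>t. I (apply_bcontfun \<phi>) (cl t)))"
      unfolding bounded_iff
    proof (intro exI ballI)
      fix w assume "w \<in> range (\<lambda>t. I (apply_bcontfun \<phi>) (cl t))"
      then obtain t where "w = I (apply_bcontfun \<phi>) (cl t)" by auto
      then show "norm w \<le> norm x0 + R" using Ib[OF appc cl(1), of \<phi> t] norm_triangle_sub[of w x0] by simp
    qed
    ultimately have "(\<lambda>t. I (apply_bcontfun \<phi>) (cl t)) \<in> bcontfun" by (simp add: bcontfun_def)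
    then show ?thesis by (simp add: T_def Bcontfun_inverse)
  qed
  have "\<exists>!\<phi>. T \<phi> = \<phi>"
  proof (rule banach_fix_type[of "1/2"])
    show "\<forall>\<phi> \<psi>. dist (T \<phi>) (T \<psi>) \<le> 1 / 2 * dist \<phi> \<psi>"
    proof (intro allI dist_bound)
      fix \<phi> \<psi> and t
      let ?g = "g (apply_bcontfun \<phi>)" and ?h = "g (apply_bcontfun \<psi>)"
      have c: "cl t \<in> {0..r}" by (rule cl)
      have i: "?g integrable_on {0..cl t}" "?h integrable_on {0..cl t}"
        by (intro integrable_continuous_real sub appc c)+
      have "norm (integral {0..cl t} (\<lambda>s. ?g s - ?h s)) \<le> (L * dist \<phi> \<psi>) * (cl t - 0)"
      proof (rule integral_bound)
        show "continuous_on {0..cl t} (\<lambda>s. ?g s - ?h s)" by (intro continuous_intros sub appc c)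
        fix s assume s: "s \<in> {0..cl t}"
        then have s': "s \<in> {0..r}" using c by auto
        have "norm (?g s - ?h s) \<le> L * norm (P (apply_bcontfun \<phi> s) - P (apply_bcontfun \<psi> s))"
          unfolding g_def by (rule lip[OF s' Pin Pin])
        also have "\<dots> \<le> L * dist \<phi> \<psi>"
          using L order_trans[OF Plip dist_bounded[of \<phi> s \<psi>, unfolded dist_norm[of "apply_bcontfun \<phi> s"]]] by (intro mult_left_mono) auto
        finally show "norm (?g s - ?h s) \<le> L * dist \<phi> \<psi>" .
      qed (use c in auto)
      also have "\<dots> \<le> (L * dist \<phi> \<psi>) * r" using c L by (intro mult_left_mono) auto
      also have "\<dots> \<le> 1 / 2 * dist \<phi> \<psi>" using mult_right_mono[OF r(3), of "dist \<phi> \<psi>"] by (simp add: mult_ac)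
      finally show "dist (apply_bcontfun (T \<phi>) t) (apply_bcontfun (T \<psi>) t) \<le> 1 / 2 * dist \<phi> \<psi>"
        unfolding Tapp by (simp add: I_def dist_norm integral_diff[OF i])
    qed
  qed auto
  then obtain \<phi> where \<phi>: "T \<phi> = \<phi>" by blast
  define X where "X = apply_bcontfun \<phi>"
  have Xc: "continuous_on {0..r} X" unfolding X_def by (rule appc)
  have XI: "X t = I X t" if "t \<in> {0..r}" for t
    using Tapp[of \<phi> t] \<phi> cl(2)[OF that] by (simp add: X_def)
  have Xin: "X t \<in> cball x0 R" if "t \<in> {0..r}" for t
    using Ib[OF Xc that] XI[OF that] by (simp add: dist_norm norm_minus_commute)
  show ?thesis
  proof (rule that[of X])
    show "X 0 = x0" using XI[of 0] r(1) by (simp add: I_def)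
    fix t assume t: "t \<in> {0..r}"
    show "X t \<in> cball x0 R" by (rule Xin[OF t])
    have "((\<lambda>t. integral {0..t} (g X)) has_vector_derivative g X t) (at t within {0..r})"
      by (rule integral_has_vector_derivative[OF gcont[OF Xc] t])
    then have "((\<lambda>t. x0 + integral {0..t} (g X)) has_vector_derivative 0 + g X t) (at t within {0..r})"
      by (intro has_vector_derivative_add has_vector_derivative_const)
    then have "(I X has_vector_derivative g X t) (at t within {0..r})" by (simp add: I_def)
    then have "(X has_vector_derivative g X t) (at t within {0..r})"
      by (rule has_vector_derivative_transform[OF t, rotated]) (use XI in auto)
    then show "(X has_vector_derivative f t (X t)) (at t within {0..r})" using Pid[OF Xin[OF t]] by (simp add: g_def)
  qed
qed

lemma vector_derivative_increment_bound:
  fixes W :: "real \<Rightarrow> 'a::euclidean_space"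
  assumes W: "\<And>t. t \<in> {0..r} \<Longrightarrow> (W has_vector_derivative A t) (at t within {0..r})"
    and A: "\<And>t. t \<in> {0..r} \<Longrightarrow> norm (A t) \<le> B" and s: "s \<in> {0..r}" "t \<in> {0..r}"
  shows "norm (W t - W s) \<le> B * \<bar>t - s\<bar>"
proof -
  have "norm (W t - W s) \<le> B * norm (t - s)"
  proof (rule differentiable_bound[of "{0..r}" W "\<lambda>t h. h *\<^sub>R A t"])
    show "onorm (\<lambda>h. h *\<^sub>R A x) \<le> B" if "x \<in> {0..r}" for x
      using A[OF that] by (simp add: onorm_scaleR_left[OF bounded_linear_ident] onorm_id)
  qed (use W s in \<open>auto simp: has_vector_derivative_def\<close>)
  then show ?thesis by simp
qed

text \<open>In place of an exponential estimate: up to the time where the distance attains its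
  maximum \<open>D\<close>, it grows by at most \<open>D / 2 + r * \<eta>\<close>, and the half is
  absorbed.\<close>

lemma short_time_stability:
  fixes X Y :: "real \<Rightarrow> 'a::euclidean_space"
  assumes X: "\<And>t. t \<in> {0..r} \<Longrightarrow> (X has_vector_derivative A t) (at t within {0..r})"
    and Y: "\<And>t. t \<in> {0..r} \<Longrightarrow> (Y has_vector_derivative B t) (at t within {0..r})"
    and AB: "\<And>t. t \<in> {0..r} \<Longrightarrow> norm (A t - B t) \<le> L * norm (X t - Y t) + \<eta>"
    and L: "0 \<le> L" and r: "r * L \<le> 1 / 2" and t: "t \<in> {0..r}"
  shows "norm (X t - Y t) \<le> 2 * norm (X 0 - Y 0) + 2 * r * \<eta>"
proof -
  have r0: "0 \<le> r" using t by simp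
  define W where "W = (\<lambda>t. X t - Y t)"
  have W: "(W has_vector_derivative A t - B t) (at t within {0..r})" if "t \<in> {0..r}" for t
    unfolding W_def by (intro has_vector_derivative_diff X Y that)
  have "continuous_on {0..r} W" unfolding continuous_on_eq_continuous_within by (intro ballI has_vector_derivative_continuous[OF W])
  then obtain s where s: "s \<in> {0..r}" "\<And>t. t \<in> {0..r} \<Longrightarrow> norm (W t) \<le> norm (W s)"
    using continuous_attains_sup[of "{0..r}" "\<lambda>t. norm (W t)"] t by (force intro: continuous_intros)
  define D where "D = norm (W s)"
  have "norm (A t - B t) \<le> L * D + \<eta>" if "t \<in> {0..r}" for t
    using AB[OF that] mult_left_mono[OF s(2)[OF that] L] by (simp add: W_def D_def)
  from vector_derivative_increment_bound[OF W this _ s(1), of 0]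
  have 1: "norm (W s - W 0) \<le> (L * D + \<eta>) * s" using r0 s(1) by simp
  have "0 \<le> L * D + \<eta>" using \<open>\<And>t. t \<in> {0..r} \<Longrightarrow> norm (A t - B t) \<le> L * D + \<eta>\<close>[OF t] norm_ge_zero order_trans by blast
  then have "(L * D + \<eta>) * s \<le> (L * D + \<eta>) * r" using s(1) by (intro mult_left_mono) auto
  moreover have "(r * L) * D \<le> 1 / 2 * D" using r by (intro mult_right_mono) (auto simp: D_def)
  ultimately have "norm (W s - W 0) \<le> D / 2 + r * \<eta>" using 1 by (simp add: algebra_simps)
  then have "D \<le> norm (W 0) + D / 2 + r * \<eta>" using norm_triangle_sub[of "W s" "W 0"] by (simp add: D_def)
  then show ?thesis using s(2)[OF t] by (simp add: W_def D_def)
qed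

section \<open>Comparison of lifted curves with the graph\<close>

locale vanishing_viscosity =
  fixes \<sigma> :: "2 \<Rightarrow> real^3 \<Rightarrow> real" and \<Omega> :: "(real^2) set" and u :: "real^2 \<Rightarrow> real"
    and v :: "nat \<Rightarrow> real^2 \<Rightarrow> real" and \<epsilon> :: "nat \<Rightarrow> real" and l :: real
  assumes \<sigma>: "\<And>j. smooth_on UNIV (\<sigma> j)" and \<Omega>: "open \<Omega>"
    and v: "\<And>n. smooth_on \<Omega> (v n)" and L_op_v: "\<And>n x. x \<in> \<Omega> \<Longrightarrow> L_op \<sigma> (\<epsilon> n) (v n) x = 0"
    and \<epsilon>: "\<epsilon> \<longlonglongrightarrow> 0" and lip_v: "\<And>n. l-lipschitz_on \<Omega> (v n)"
    and conv: "\<And>K. compact K \<Longrightarrow> K \<subseteq> \<Omega> \<Longrightarrow> uniform_limit K v u sequentially"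
begin

lemma l_nonneg: "0 \<le> l" using lip_v lipschitz_on_nonneg by blast

lemma lip_u: "l-lipschitz_on \<Omega> u"
proof (rule lipschitz_onI)
  fix x y assume xy: "x \<in> \<Omega>" "y \<in> \<Omega>"
  have lim: "(\<lambda>n. v n w) \<longlonglongrightarrow> u w" if "w \<in> \<Omega>" for w
    using tendsto_uniform_limitI[OF conv[of "{w}"]] that by simp
  have "(\<lambda>n. dist (v n x) (v n y)) \<longlonglongrightarrow> dist (u x) (u y)" by (intro tendsto_intros lim xy)
  then show "dist (u x) (u y) \<le> l * dist x y"
    by (rule LIMSEQ_le_const2) (use lipschitz_onD[OF lip_v xy] in auto)
qed (rule l_nonneg)

lemma u_diff: "x \<in> \<Omega> \<Longrightarrow> y \<in> \<Omega> \<Longrightarrow> \<bar>u x - u y\<bar> \<le> l * norm (x - y)"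
  using lipschitz_onD[OF lip_u, of x y] by (simp add: dist_norm)

abbreviation speed :: "real^2 \<Rightarrow> real \<Rightarrow> real^2" where
  "speed x c \<equiv> field_at \<sigma> (lift x c)"

text \<open>The characteristics are the case \<open>z = u \<circ> X\<close>. A smooth prescribed
  \<open>z\<close> makes \<open>X\<close> twice differentiable inside the interval, as the
  second-order test demands.\<close>

definition lifted_curve :: "real \<Rightarrow> (real \<Rightarrow> real) \<Rightarrow> (real \<Rightarrow> real^2) \<Rightarrow> bool" where
  "lifted_curve r z X \<longleftrightarrow> (\<forall>t\<in>{0..r}. (X has_vector_derivative speed (X t) (z t)) (at t within {0..r}))"

lemma lifted_curveD: "lifted_curve r z X \<Longrightarrow> t \<in> {0..r} \<Longrightarrow> (X has_vector_derivative speed (X t) (z t)) (at t within {0..r})"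
  by (simp add: lifted_curve_def)

lemma lifted_curve_continuous_on: "lifted_curve r z X \<Longrightarrow> continuous_on {0..r} X"
  unfolding continuous_on_eq_continuous_within lifted_curve_def by (auto intro: has_vector_derivative_continuous)

text \<open>\<open>M\<close> serves both as speed bound and as Lipschitz constant. The radius
  \<open>2 * R\<close> leaves room for curves starting in the ball of radius \<open>R\<close>, the
  height margin 1 for bent and shifted ones. The constant \<open>1 / 32\<close> makes
  \<open>u\<close> along a curve insensitive to its height: a change of \<open>z\<close> by \<eta>
  moves it by at most \<eta>/16.\<close>

lemma short_time_constants:
  assumes x: "x \<in> \<Omega>"
  obtains R r B M where "0 < R" "0 < r" "cball x (2 * R) \<subseteq> \<Omega>" "0 < M" "r * M \<le> R" "r * M * (1 + l) \<le> 1 / 32"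
    "\<And>y. y \<in> cball x (2 * R) \<Longrightarrow> \<bar>u y\<bar> \<le> B"
    "\<And>y c. y \<in> cball x (2 * R) \<Longrightarrow> \<bar>c\<bar> \<le> B + 1 \<Longrightarrow> norm (speed y c) \<le> M"
    "\<And>y c w d. y \<in> cball x (2 * R) \<Longrightarrow> \<bar>c\<bar> \<le> B + 1 \<Longrightarrow> w \<in> cball x (2 * R) \<Longrightarrow> \<bar>d\<bar> \<le> B + 1 \<Longrightarrow>
      norm (speed y c - speed w d) \<le> M * (norm (y - w) + \<bar>c - d\<bar>)"
proof -
  obtain R' where R': "0 < R'" "cball x R' \<subseteq> \<Omega>" using \<Omega> x open_contains_cball by blast
  define R where "R = R' / 2"
  have R: "0 < R" "cball x (2 * R) \<subseteq> \<Omega>" using R' by (auto simp: R_def)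
  have "compact (u ` cball x (2 * R))"
    using lipschitz_on_continuous_on[OF lipschitz_on_subset[OF lip_u R(2)]] by (intro compact_continuous_image) auto
  from compact_imp_bounded[OF this] have "\<exists>B. \<forall>y\<in>cball x (2 * R). \<bar>u y\<bar> \<le> B" by (simp add: bounded_iff)
  then obtain B where B: "\<And>y. y \<in> cball x (2 * R) \<Longrightarrow> \<bar>u y\<bar> \<le> B" by blast
  define Q where "Q = (\<lambda>w. lift (fst w) (snd w)) ` (cball x (2 * R) \<times> {-(B+1)..B+1})"
  have Qc: "compact Q" unfolding Q_def by (intro compact_continuous_image continuous_intros compact_Times) auto
  have inQ: "lift y c \<in> Q" if "y \<in> cball x (2 * R)" "\<bar>c\<bar> \<le> B + 1" for y c
    unfolding Q_def by (rule image_eqI[of _ _ "(y, c)"]) (use that in auto)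
  obtain Ls where Ls: "0 \<le> Ls" "\<And>q q0. q \<in> Q \<Longrightarrow> q0 \<in> Q \<Longrightarrow> norm (field_at \<sigma> q - field_at \<sigma> q0) \<le> Ls * norm (q - q0)"
    using field_at_lipschitz_on_compact[of \<sigma> Q, OF \<sigma> Qc] by blast
  have "continuous_on Q (\<lambda>q. field_at \<sigma> q)" by (intro continuous_intros \<sigma>)
  from compact_imp_bounded[OF compact_continuous_image[OF this Qc]]
  have "\<exists>N. \<forall>q\<in>Q. norm (field_at \<sigma> q) \<le> N" by (simp add: bounded_iff)
  then obtain N where N: "\<And>q. q \<in> Q \<Longrightarrow> norm (field_at \<sigma> q) \<le> N" by blast
  define M where "M = 2 * Ls + \<bar>N\<bar> + 1"
  have M: "0 < M" using Ls(1) by (simp add: M_def)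
  define r where "r = min (R / M) (1 / (32 * (M * (1 + l))))"
  have Ml: "0 < M * (1 + l)" using M l_nonneg by simp
  have r: "0 < r" "r * M \<le> R" "r * M * (1 + l) \<le> 1 / 32"
  proof -
    show "0 < r" using R M Ml by (simp add: r_def)
    have "r * M \<le> R / M * M" unfolding r_def using M by (intro mult_right_mono) auto
    then show "r * M \<le> R" using M by simp
    define a where "a = M * (1 + l)"
    have "r * a \<le> 1 / (32 * a) * a" unfolding r_def a_def using Ml by (intro mult_right_mono) auto
    also have "\<dots> = 1 / 32" using Ml by (simp add: a_def[symmetric])
    finally show "r * M * (1 + l) \<le> 1 / 32" by (simp add: a_def mult.assoc)
  qed
  show ?thesis
  proof (rule that[OF R(1) r(1) R(2) M r(2,3) B])
    fix y c assume y: "y \<in> cball x (2 * R)" "\<bar>c\<bar> \<le> B + 1"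
    show "norm (speed y c) \<le> M" using N[OF inQ[OF y]] Ls(1) by (simp add: M_def)
    fix w d assume w: "w \<in> cball x (2 * R)" "\<bar>d\<bar> \<le> B + 1"
    have "norm (speed y c - speed w d) \<le> Ls * norm (lift y c - lift w d)" by (rule Ls(2)[OF inQ[OF y] inQ[OF w]])
    also have "\<dots> \<le> Ls * (2 * norm (y - w) + \<bar>c - d\<bar>)" unfolding lift_diff using Ls(1) norm_lift_le by (intro mult_left_mono)
    also have "\<dots> \<le> Ls * (2 * (norm (y - w) + \<bar>c - d\<bar>))" using Ls(1) by (intro mult_left_mono) auto
    also have "\<dots> = (2 * Ls) * (norm (y - w) + \<bar>c - d\<bar>)" by simp
    also have "\<dots> \<le> M * (norm (y - w) + \<bar>c - d\<bar>)" by (intro mult_right_mono) (auto simp: M_def)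
    finally show "norm (speed y c - speed w d) \<le> M * (norm (y - w) + \<bar>c - d\<bar>)" .
  qed auto
qed

text \<open>The bend \<open>\<delta> * (t * (r - t))\<close> vanishes at both end times and has
  second derivative \<open>- 2 * \<delta>\<close>, the strict sign that excludes contact.\<close>

lemma contact_excluded:
  assumes \<zeta>: "\<zeta> \<in> {1, -1}" and \<delta>: "0 < \<delta>" and r: "0 < r"
    and X: "lifted_curve r (\<lambda>t. a + b * t + \<zeta> * (\<delta> * (t * (r - t)))) X" and X\<Omega>: "X ` {0..r} \<subseteq> \<Omega>"
    and above: "\<And>t. t \<in> {0..r} \<Longrightarrow> 0 \<le> \<zeta> * (a + b * t + \<zeta> * (\<delta> * (t * (r - t))) - u (X t))"
    and ends: "0 < \<zeta> * (a - u (X 0))" "0 < \<zeta> * (a + b * r - u (X r))"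
    and contact: "tc \<in> {0..r}" "a + b * tc + \<zeta> * (\<delta> * (tc * (r - tc))) = u (X tc)"
  shows False
proof (rule no_strict_contact[OF \<sigma> \<Omega> v L_op_v \<epsilon> lip_v conv \<zeta> \<delta> r lifted_curve_continuous_on[OF X] X\<Omega>])
  let ?z = "\<lambda>t. a + b * t + \<zeta> * (\<delta> * (t * (r - t)))" and ?z1 = "\<lambda>t. b + \<zeta> * (\<delta> * (r - 2 * t))"
  show "(?z has_field_derivative ?z1 t) (at t)" for t by (auto intro!: derivative_eq_intros simp: algebra_simps)
  show "(?z1 has_field_derivative - (2 * \<zeta> * \<delta>)) (at t)" for t by (auto intro!: derivative_eq_intros simp: algebra_simps)
  show "(X has_vector_derivative field_at \<sigma> (lift (X t) (?z t))) (at t)" if "0 < t" "t < r" for t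
    using lifted_curveD[OF X, of t] that by (simp add: at_within_Icc_at)
qed (use above ends contact in auto)

text \<open>Shooting: choose the slope \<open>b\<close> so that the lifted curve with \<open>z t = u x + b t\<close> meets the graph of \<open>u\<close>
  again at time \<open>r\<close>. If it left the graph in between, the family \<open>ZZ \<tau>\<close> of curves bent by \<open>\<delta>\<close> and
  shifted by \<open>\<tau>\<close> would contain one touching the graph from one side at an interior time.\<close>
lemma characteristics_local:
  assumes xb: "xb \<in> \<Omega>"
  obtains R r C b Y where "0 < R" "0 < r" "cball xb R \<subseteq> \<Omega>"
    "\<And>x. x \<in> cball xb R \<Longrightarrow> Y x 0 = x"
    "\<And>x t. x \<in> cball xb R \<Longrightarrow> t \<in> {0..r} \<Longrightarrow> Y x t \<in> \<Omega>"
    "\<And>x. x \<in> cball xb R \<Longrightarrow> lifted_curve r (\<lambda>t. u (Y x t)) (Y x)"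
    "\<And>x t. x \<in> cball xb R \<Longrightarrow> t \<in> {0..r} \<Longrightarrow> u (Y x t) = u x + b x * t"
    "\<And>x y. x \<in> cball xb R \<Longrightarrow> y \<in> cball xb R \<Longrightarrow> \<bar>b x - b y\<bar> \<le> C * norm (x - y)"
proof -
  obtain R r B M where R: "0 < R" "cball xb (2 * R) \<subseteq> \<Omega>" and r: "0 < r" and M: "0 < M" "r * M \<le> R" "r * M * (1 + l) \<le> 1 / 32"
    and B: "\<And>y. y \<in> cball xb (2 * R) \<Longrightarrow> \<bar>u y\<bar> \<le> B"
    and Sb: "\<And>y c. y \<in> cball xb (2 * R) \<Longrightarrow> \<bar>c\<bar> \<le> B + 1 \<Longrightarrow> norm (speed y c) \<le> M"
    and Sl: "\<And>y c w d. y \<in> cball xb (2 * R) \<Longrightarrow> \<bar>c\<bar> \<le> B + 1 \<Longrightarrow> w \<in> cball xb (2 * R) \<Longrightarrow> \<bar>d\<bar> \<le> B + 1 \<Longrightarrow>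
      norm (speed y c - speed w d) \<le> M * (norm (y - w) + \<bar>c - d\<bar>)"
    using short_time_constants[OF xb] by metis
  have rMpos: "0 < r * M" using r M by simp
  have rM: "r * M \<le> 1 / 32" using M(3) mult_left_mono[of 1 "1 + l" "r * M"] rMpos l_nonneg by linarith
  have lrM: "l * (r * M) \<le> 1 / 32" using M(3) rMpos by (simp add: algebra_simps)
  have RR: "cball xb R \<subseteq> cball xb (2 * R)" "cball x R \<subseteq> cball xb (2 * R)" if "x \<in> cball xb R" for x
    using that R(1) by (auto simp: subset_iff intro: order_trans[OF dist_triangle[of xb _ x]])
  have ex: "\<exists>X. X 0 = x \<and> X ` {0..r} \<subseteq> cball xb (2 * R) \<and> lifted_curve r z X"
    if x: "x \<in> cball xb R" and z: "continuous_on {0..r} z" "\<And>t. t \<in> {0..r} \<Longrightarrow> \<bar>z t\<bar> \<le> B + 1" for x z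
  proof -
    obtain X where "X 0 = x" "\<And>t. t \<in> {0..r} \<Longrightarrow> X t \<in> cball x R"
      "\<And>t. t \<in> {0..r} \<Longrightarrow> (X has_vector_derivative speed (X t) (z t)) (at t within {0..r})"
    proof (rule picard_short_time[of r x R "\<lambda>t y. speed y (z t)" M M])
      show "continuous_on ({0..r} \<times> cball x R) (\<lambda>(t, y). speed y (z t))"
        unfolding case_prod_beta by (intro continuous_intros \<sigma> continuous_on_compose2[OF z(1)]) auto
    next
      fix t y assume ty: "t \<in> {0..r}" "y \<in> cball x R"
      show "norm (speed y (z t)) \<le> M" using Sb[of y "z t"] z(2)[OF ty(1)] ty(2) RR(2)[OF x] by blast
      fix w assume w: "w \<in> cball x R"
      have "norm (speed y (z t) - speed w (z t)) \<le> M * (norm (y - w) + \<bar>z t - z t\<bar>)"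
        using Sl[of y "z t" w "z t"] z(2)[OF ty(1)] ty(2) w RR(2)[OF x] by blast
      then show "norm (speed y (z t) - speed w (z t)) \<le> M * norm (y - w)" by simp
    qed (use r M rM R in auto)
    then show ?thesis using RR(2)[OF x] by (intro exI[of _ X]) (auto simp: lifted_curve_def)
  qed
  \<comment> \<open>For curves with a common start only the difference of heights drives them apart,
    at rate \<open>M\<close> for a time \<open>r\<close>; the factor 2 comes from absorbing half of
    the distance.\<close>
  have stab: "norm (X t - Y t) \<le> \<eta> * (2 * (r * M))"
    if X: "X 0 = Y 0" "X ` {0..r} \<subseteq> cball xb (2 * R)" "lifted_curve r z X"
      and Y: "Y ` {0..r} \<subseteq> cball xb (2 * R)" "lifted_curve r w Y"
      and z: "\<And>t. t \<in> {0..r} \<Longrightarrow> \<bar>z t\<bar> \<le> B + 1" and w: "\<And>t. t \<in> {0..r} \<Longrightarrow> \<bar>w t\<bar> \<le> B + 1"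
      and zw: "\<And>t. t \<in> {0..r} \<Longrightarrow> \<bar>z t - w t\<bar> \<le> \<eta>" and t: "t \<in> {0..r}" for X Y z w \<eta> t
  proof -
    have "norm (X t - Y t) \<le> 2 * norm (X 0 - Y 0) + 2 * r * (M * \<eta>)"
    proof (rule short_time_stability[OF lifted_curveD[OF X(3)] lifted_curveD[OF Y(2)] _ _ _ t, where L = M])
      fix t assume t: "t \<in> {0..r}"
      have "norm (speed (X t) (z t) - speed (Y t) (w t)) \<le> M * (norm (X t - Y t) + \<bar>z t - w t\<bar>)"
        using X(2) Y(1) t by (intro Sl z w t) blast+
      also have "\<dots> \<le> M * (norm (X t - Y t) + \<eta>)" using zw[OF t] M(1) by (intro mult_left_mono) auto
      finally show "norm (speed (X t) (z t) - speed (Y t) (w t)) \<le> M * norm (X t - Y t) + M * \<eta>" by (simp add: algebra_simps)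
    qed (use M rM in auto)
    then show ?thesis using X(1) by (simp add: mult_ac)
  qed
  \<comment> \<open>A bound for the rate of change of \<open>u\<close> along any lifted curve in the
    ball, hence the range of slopes worth shooting with.\<close>
  define \<beta> where "\<beta> = l * M"
  have \<beta>: "0 \<le> \<beta>" "\<beta> * r \<le> 1 / 32" using l_nonneg M(1) lrM by (auto simp: \<beta>_def mult_ac)
  have udiff: "\<bar>u (X t) - u (X 0)\<bar> \<le> \<beta> * t"
    if X: "X ` {0..r} \<subseteq> cball xb (2 * R)" "lifted_curve r z X" and z: "\<And>t. t \<in> {0..r} \<Longrightarrow> \<bar>z t\<bar> \<le> B + 1" and t: "t \<in> {0..r}" for X z t
  proof -
    have inb: "X s \<in> cball xb (2 * R)" if "s \<in> {0..r}" for s using X(1) that by blast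
    then have "norm (X t - X 0) \<le> M * \<bar>t - 0\<bar>"
      by (intro vector_derivative_increment_bound[OF lifted_curveD[OF X(2)] Sb] z) (use t r in auto)
    then have "l * norm (X t - X 0) \<le> \<beta> * t" using mult_left_mono[OF _ l_nonneg] t by (fastforce simp: \<beta>_def)
    moreover have "X t \<in> \<Omega>" "X 0 \<in> \<Omega>" using R(2) inb[OF t] inb[of 0] r by auto
    ultimately show ?thesis using u_diff[of "X t" "X 0"] by linarith
  qed
  have char: "\<exists>b X. X 0 = x \<and> X ` {0..r} \<subseteq> cball xb (2 * R) \<and> lifted_curve r (\<lambda>t. u (X t)) X \<and> (\<forall>t\<in>{0..r}. u (X t) = u x + b * t)"
    if x: "x \<in> cball xb R" for x
  proof -
    have ux: "\<bar>u x\<bar> \<le> B" using B RR(1)[OF x] x by blast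
    define Z where "Z = (\<lambda>b t. u x + b * t :: real)"
    have Zb: "\<bar>Z b t\<bar> \<le> B + 1 / 32" if "b \<in> {-\<beta>..\<beta>}" "t \<in> {0..r}" for b t
    proof -
      have "\<bar>b * t\<bar> \<le> \<beta> * r" unfolding abs_mult using that \<beta> by (intro mult_mono) auto
      then show ?thesis using ux \<beta>(2) by (simp add: Z_def)
    qed
    have "\<exists>X. X 0 = x \<and> X ` {0..r} \<subseteq> cball xb (2 * R) \<and> lifted_curve r (Z b) X" if "b \<in> {-\<beta>..\<beta>}" for b
      by (rule ex[OF x]) (use Zb[OF that] in \<open>force simp: Z_def intro!: continuous_intros\<close>)+
    then obtain XX where XX: "\<And>b. b \<in> {-\<beta>..\<beta>} \<Longrightarrow> XX b 0 = x" "\<And>b. b \<in> {-\<beta>..\<beta>} \<Longrightarrow> XX b ` {0..r} \<subseteq> cball xb (2 * R)"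
      "\<And>b. b \<in> {-\<beta>..\<beta>} \<Longrightarrow> lifted_curve r (Z b) (XX b)" by metis
    have Zb1: "\<bar>Z b t\<bar> \<le> B + 1" if "b \<in> {-\<beta>..\<beta>}" "t \<in> {0..r}" for b t using Zb[OF that] by simp
    define er where "er = (\<lambda>b. Z b r - u (XX b r))"
    have rin: "r \<in> {0..r}" using r by simp
    have "(r + 1 / 16 * r)-lipschitz_on {-\<beta>..\<beta>} er"
    proof (rule lipschitz_onI)
      fix b c assume bc: "b \<in> {-\<beta>..\<beta>}" "c \<in> {-\<beta>..\<beta>}"
      have "norm (XX b r - XX c r) \<le> (\<bar>b - c\<bar> * r) * (2 * (r * M))"
      proof (rule stab[OF _ XX(2,3)[OF bc(1)] XX(2,3)[OF bc(2)] Zb1[OF bc(1)] Zb1[OF bc(2)] _ rin])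
        show "\<bar>Z b t - Z c t\<bar> \<le> \<bar>b - c\<bar> * r" if "t \<in> {0..r}" for t
          using that mult_left_mono[of t r "\<bar>b - c\<bar>"] by (auto simp: Z_def abs_mult left_diff_distrib[symmetric])
      qed (use XX(1) bc in auto)
      then have "l * norm (XX b r - XX c r) \<le> l * ((\<bar>b - c\<bar> * r) * (2 * (r * M)))" using l_nonneg by (rule mult_left_mono)
      also have "\<dots> = (\<bar>b - c\<bar> * r) * (2 * (l * (r * M)))" by (simp add: mult_ac)
      also have "\<dots> \<le> (\<bar>b - c\<bar> * r) * (2 * (1 / 32))" using lrM r by (intro mult_left_mono) auto
      finally have "l * norm (XX b r - XX c r) \<le> 1 / 16 * r * \<bar>b - c\<bar>" by (simp add: mult_ac)
      moreover have "XX b r \<in> \<Omega>" "XX c r \<in> \<Omega>" using XX(2)[OF bc(1)] XX(2)[OF bc(2)] R(2) rin by blast+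
      ultimately have "\<bar>u (XX b r) - u (XX c r)\<bar> \<le> 1 / 16 * r * \<bar>b - c\<bar>" using u_diff[of "XX b r" "XX c r"] by linarith
      moreover have "\<bar>Z b r - Z c r\<bar> = r * \<bar>b - c\<bar>" using r by (simp add: Z_def abs_mult left_diff_distrib[symmetric])
      ultimately show "dist (er b) (er c) \<le> (r + 1 / 16 * r) * dist b c"
        unfolding er_def dist_real_def distrib_right by linarith
    qed (use r in auto)
    then have cer: "continuous_on {-\<beta>..\<beta>} er" by (rule lipschitz_on_continuous_on)
    have sg: "\<bar>u (XX b r) - u x\<bar> \<le> \<beta> * r" if "b \<in> {-\<beta>..\<beta>}" for b
      using udiff[OF XX(2,3)[OF that] Zb1[OF that] rin] XX(1)[OF that] by simp
    \<comment> \<open>At the extreme slopes the line ends below, respectively above, every value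
      that \<open>u\<close> can reach by time \<open>r\<close>.\<close>
    have "er (-\<beta>) \<le> 0" "0 \<le> er \<beta>" using sg[of "-\<beta>"] sg[of \<beta>] \<beta>(1) by (auto simp: er_def Z_def)
    then obtain b where b: "b \<in> {-\<beta>..\<beta>}" "er b = 0" using IVT'[of er "-\<beta>" 0 \<beta>] cer \<beta>(1) by auto
    define X where "X = XX b"
    note Xb = XX[OF b(1), folded X_def]
    have "u (X t) = u x + b * t" if that: "t \<in> {0..r}" for t
    proof (rule ccontr)
      assume ne: "u (X t) \<noteq> u x + b * t"
      \<comment> \<open>The sign is chosen so that the oriented gap \<open>e0\<close> is negative at
        the bad time \<open>t\<close>; \<open>m\<close> measures the violation.\<close>
      define \<zeta> :: real where "\<zeta> = (if Z b t < u (X t) then 1 else - 1)"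
      have \<zeta>: "\<zeta> \<in> {1, -1}" "\<bar>\<zeta>\<bar> = 1" "\<zeta> * \<zeta> = 1" by (auto simp: \<zeta>_def)
      define e0 where "e0 = (\<lambda>t. \<zeta> * (Z b t - u (X t)))"
      define m where "m = - e0 t"
      have m0: "0 < m" using ne by (auto simp: m_def e0_def \<zeta>_def Z_def)
      have e0b: "\<bar>e0 s\<bar> \<le> 1 / 16" if s: "s \<in> {0..r}" for s
      proof -
        have "\<bar>u (X s) - u x\<bar> \<le> \<beta> * s" using udiff[OF Xb(2,3) Zb1[OF b(1)] s] Xb(1) by simp
        moreover have "\<bar>b * s\<bar> \<le> \<beta> * s" unfolding abs_mult using b(1) s by (intro mult_mono) auto
        moreover have "\<beta> * s \<le> \<beta> * r" using s \<beta>(1) by (intro mult_left_mono) auto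
        ultimately have "\<bar>Z b s - u (X s)\<bar> \<le> 1 / 16" using \<beta>(2) unfolding Z_def by linarith
        then show ?thesis using \<zeta>(2) by (simp add: e0_def abs_mult)
      qed
      have m1: "m \<le> 1 / 16" using e0b[OF that] m_def by linarith
      \<comment> \<open>With this choice the bend never exceeds \<open>m / 4\<close>, so it cannot
        by itself lift the curve over the graph and a genuine shift is needed.\<close>
      define \<delta> where "\<delta> = m / (4 * (r * r))"
      have \<delta>: "0 < \<delta>" "\<delta> * (r * r) = m / 4" using m0 r by (auto simp: \<delta>_def)
      have bump: "0 \<le> \<delta> * (s * (r - s))" "\<delta> * (s * (r - s)) \<le> m / 4" if "s \<in> {0..r}" for s
      proof -
        show "0 \<le> \<delta> * (s * (r - s))" using that \<delta> by simp
        have "s * (r - s) \<le> r * r" using that by (intro mult_mono) auto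
        then show "\<delta> * (s * (r - s)) \<le> m / 4" unfolding \<delta>(2)[symmetric] using \<delta>(1) by (intro mult_left_mono) auto
      qed
      define ZZ where "ZZ = (\<lambda>\<tau> s. (u x + \<zeta> * \<tau>) + b * s + \<zeta> * (\<delta> * (s * (r - s))))"
      have ZZ_eq: "ZZ \<tau> s = Z b s + \<zeta> * (\<tau> + \<delta> * (s * (r - s)))" for \<tau> s by (simp add: ZZ_def Z_def algebra_simps)
      have ZZb: "\<bar>ZZ \<tau> s\<bar> \<le> B + 1" if "\<tau> \<in> {0..1/2}" "s \<in> {0..r}" for \<tau> s
      proof -
        have "\<bar>\<zeta> * (\<tau> + \<delta> * (s * (r - s)))\<bar> \<le> 1 / 2 + m / 4" using bump[OF that(2)] that(1) \<zeta>(2) by (simp add: abs_mult)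
        then show ?thesis unfolding ZZ_eq using Zb[OF b(1) that(2)] m1 by linarith
      qed
      have "\<exists>X. X 0 = x \<and> X ` {0..r} \<subseteq> cball xb (2 * R) \<and> lifted_curve r (ZZ \<tau>) X" if "\<tau> \<in> {0..1/2}" for \<tau>
        by (rule ex[OF x]) (use ZZb[OF that] in \<open>force simp: ZZ_def intro!: continuous_intros\<close>)+
      then obtain W where W: "\<And>\<tau>. \<tau> \<in> {0..1/2} \<Longrightarrow> W \<tau> 0 = x" "\<And>\<tau>. \<tau> \<in> {0..1/2} \<Longrightarrow> W \<tau> ` {0..r} \<subseteq> cball xb (2 * R)"
        "\<And>\<tau>. \<tau> \<in> {0..1/2} \<Longrightarrow> lifted_curve r (ZZ \<tau>) (W \<tau>)" by metis
      define e where "e = (\<lambda>\<tau> s. \<zeta> * (ZZ \<tau> s - u (W \<tau> s)))"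
      have uclose: "\<bar>\<zeta> * (u p - u q)\<bar> \<le> \<eta> / 16" if "norm (p - q) \<le> \<eta> * (2 * (r * M))" "p \<in> \<Omega>" "q \<in> \<Omega>" "0 \<le> \<eta>" for p q \<eta>
      proof -
        have "\<bar>u p - u q\<bar> \<le> l * (\<eta> * (2 * (r * M)))"
          using u_diff[OF that(2,3)] mult_left_mono[OF that(1) l_nonneg] by linarith
        also have "\<dots> = \<eta> * (2 * (l * (r * M)))" by (simp add: mult_ac)
        also have "\<dots> \<le> \<eta> * (2 * (1 / 32))" using lrM that(4) by (intro mult_left_mono) auto
        finally show ?thesis using \<zeta>(2) by (simp add: abs_mult)
      qed
      have in\<Omega>: "X s \<in> \<Omega>" "\<tau> \<in> {0..1/2} \<Longrightarrow> W \<tau> s \<in> \<Omega>" if "s \<in> {0..r}" for s \<tau>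
        using that Xb(2) W(2)[of \<tau>] R(2) by blast+
      have e_lip_arith: "\<bar>p\<bar> \<le> 2 * \<bar>d\<bar>" if "\<bar>q\<bar> \<le> \<bar>d\<bar> / 16" "p = c - q" "c = d" for p q c d :: real
        using that by linarith
      have e_lip: "\<bar>e \<tau> s - e \<tau>' s\<bar> \<le> 2 * \<bar>\<tau> - \<tau>'\<bar>" if \<tau>: "\<tau> \<in> {0..1/2}" "\<tau>' \<in> {0..1/2}" and s: "s \<in> {0..r}" for \<tau> \<tau>' s
      proof -
        have zd: "ZZ \<tau> t - ZZ \<tau>' t = \<zeta> * (\<tau> - \<tau>')" for t by (simp add: ZZ_def algebra_simps)
        have "norm (W \<tau> s - W \<tau>' s) \<le> \<bar>\<tau> - \<tau>'\<bar> * (2 * (r * M))"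
          by (rule stab[OF _ W(2,3)[OF \<tau>(1)] W(2,3)[OF \<tau>(2)] ZZb[OF \<tau>(1)] ZZb[OF \<tau>(2)] _ s])
            (use W(1) \<tau> \<zeta>(2) in \<open>auto simp: zd abs_mult\<close>)
        then have "\<bar>\<zeta> * (u (W \<tau> s) - u (W \<tau>' s))\<bar> \<le> \<bar>\<tau> - \<tau>'\<bar> / 16" using in\<Omega>[OF s] \<tau> by (intro uclose) auto
        moreover have "e \<tau> s - e \<tau>' s = \<zeta> * (ZZ \<tau> s - ZZ \<tau>' s) - \<zeta> * (u (W \<tau> s) - u (W \<tau>' s))" by (simp add: e_def algebra_simps)
        moreover have "\<zeta> * (ZZ \<tau> s - ZZ \<tau>' s) = \<tau> - \<tau>'" unfolding zd using \<zeta>(3) by (simp add: mult.assoc[symmetric])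
        ultimately show ?thesis using e_lip_arith by blast
      qed
      have e_base_arith: "\<bar>p - (a + d)\<bar> \<le> k" if "\<bar>q\<bar> \<le> k" "p = a + 1 * d - q" for p q a d k :: real
        using that by linarith
      \<comment> \<open>The gap is the original one plus the imposed displacement. The error is one
        sixteenth of the bound \<open>\<tau> + m / 4\<close> for that displacement, because
        \<open>W \<tau>\<close> samples \<open>u\<close> at points near those of
        \<open>X\<close>.\<close>
      have e_base: "\<bar>e \<tau> s - (e0 s + (\<tau> + \<delta> * (s * (r - s))))\<bar> \<le> (\<tau> + m / 4) / 16" if \<tau>: "\<tau> \<in> {0..1/2}" and s: "s \<in> {0..r}" for \<tau> s
      proof -
        have "norm (W \<tau> s - X s) \<le> (\<tau> + m / 4) * (2 * (r * M))"
          by (rule stab[OF _ W(2,3)[OF \<tau>] Xb(2,3) ZZb[OF \<tau>] Zb1[OF b(1)] _ s])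
            (use W(1) \<tau> \<zeta>(2) Xb(1) bump in \<open>auto simp: ZZ_eq abs_mult\<close>)
        then have "\<bar>\<zeta> * (u (W \<tau> s) - u (X s))\<bar> \<le> (\<tau> + m / 4) / 16" using in\<Omega>[OF s] \<tau> m0 by (intro uclose) auto
        moreover have "e \<tau> s = e0 s + \<zeta> * \<zeta> * (\<tau> + \<delta> * (s * (r - s))) - \<zeta> * (u (W \<tau> s) - u (X s))"
          by (simp add: e_def e0_def ZZ_eq algebra_simps)
        ultimately show ?thesis unfolding \<zeta>(3) using e_base_arith by blast
      qed
      define A where "A = {\<tau>\<in>{0..1/2}. \<forall>s\<in>{0..r}. 0 \<le> e \<tau> s}"
      \<comment> \<open>The original gap is nowhere below \<open>- 1 / 16\<close>, so the shift
        \<open>1 / 2\<close> certainly clears the graph.\<close>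
      have half: "1 / 2 \<in> A" unfolding A_def
      proof safe
        fix s assume s: "s \<in> {0..r}"
        have arith: "0 \<le> p"
          if 1: "\<bar>p - (a + (1 / 2 + d))\<bar> \<le> (1 / 2 + m / 4) / 16" and 2: "\<bar>a\<bar> \<le> 1 / 16" and 3: "0 \<le> d" for p a d :: real
        proof -
          have "a + (1 / 2 + d) - p \<le> (1 / 2 + m / 4) / 16" using abs_le_D2[OF 1] by simp
          moreover have "- a \<le> 1 / 16" using abs_le_D2[OF 2] by simp
          ultimately show ?thesis using 3 m1 by simp
        qed
        show "0 \<le> e (1/2) s" by (rule arith[OF e_base[OF _ s] e0b[OF s] bump(1)[OF s]]) simp
      qed auto
      define \<tau>s where "\<tau>s = Inf A"
      have bA: "bdd_below A" unfolding A_def by (auto intro: bdd_belowI[of _ 0])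
      have \<tau>s_le: "\<tau>s \<le> 1 / 2" "0 \<le> \<tau>s"
      proof -
        show "\<tau>s \<le> 1 / 2" unfolding \<tau>s_def by (rule cInf_lower[OF half bA])
        have "A \<noteq> {}" using half by blast
        moreover have "0 \<le> \<tau>" if "\<tau> \<in> A" for \<tau> using that unfolding A_def by simp
        ultimately show "0 \<le> \<tau>s" unfolding \<tau>s_def by (rule cInf_greatest)
      qed
      then have \<tau>sI: "\<tau>s \<in> {0..1/2}" by simp
      \<comment> \<open>By \<open>e_lip\<close> the condition defining \<open>A\<close> is closed in
        \<open>\<tau>\<close>, so it holds at the infimum.\<close>
      have nonneg: "0 \<le> e \<tau>s s" if s: "s \<in> {0..r}" for s
      proof (rule field_le_epsilon)
        fix \<eta> :: real assume "0 < \<eta>"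
        then obtain \<tau> where \<tau>: "\<tau> \<in> A" "\<tau> < \<tau>s + \<eta> / 2" using cInf_lessD[of A "\<tau>s + \<eta> / 2"] half unfolding \<tau>s_def by auto
        have "\<tau>s \<le> \<tau>" unfolding \<tau>s_def by (rule cInf_lower[OF \<tau>(1) bA])
        moreover have "0 \<le> e \<tau> s" "\<tau> \<in> {0..1/2}" using \<tau>(1) s unfolding A_def by blast+
        moreover have "e \<tau> s - e \<tau>s s \<le> 2 * \<bar>\<tau> - \<tau>s\<bar>" by (rule abs_le_D1[OF e_lip[OF _ \<tau>sI s]]) fact
        ultimately show "0 \<le> e \<tau>s s + \<eta>" using \<tau>(2) by simp
      qed
      have big_arith: "m / 2 < \<tau>s"
        if 0: "0 \<le> p" and 1: "\<bar>p - (a + (\<tau>s + d))\<bar> \<le> (\<tau>s + m / 4) / 16" and 2: "d \<le> m / 4" "m = - a" for p a d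
        using abs_le_D1[OF 1] 0 2 m0 by simp
      \<comment> \<open>At the bad time the gap must climb from \<open>- m\<close> with at most
        \<open>m / 4\<close> coming from the bend. At the end times, where original gap and bend
        vanish, a shift of this size makes the separation strict.\<close>
      have big: "m / 2 < \<tau>s" by (rule big_arith[OF nonneg[OF that] e_base[OF \<tau>sI that] bump(2)[OF that] m_def])
      have e_ends: "0 < e \<tau>s 0" "0 < e \<tau>s r"
      proof -
        have "e0 0 = 0" "e0 r = 0" using b(2) Xb(1) by (auto simp: e0_def er_def X_def Z_def)
        moreover have "0 < p" if 1: "\<bar>p - (0 + (\<tau>s + 0))\<bar> \<le> (\<tau>s + m / 4) / 16" for p
          using abs_le_D2[OF 1] big m0 by simp
        ultimately show "0 < e \<tau>s 0" "0 < e \<tau>s r"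
          using e_base[OF \<tau>sI, of 0] e_base[OF \<tau>sI, of r] r by simp_all
      qed
      have econt: "continuous_on {0..r} (e \<tau>s)"
      proof -
        have "continuous_on {0..r} (\<lambda>s. u (W \<tau>s s))"
          by (rule continuous_on_compose2[OF lipschitz_on_continuous_on[OF lip_u] lifted_curve_continuous_on[OF W(3)[OF \<tau>sI]]])
            (use in\<Omega>(2)[OF _ \<tau>sI] in auto)
        then show ?thesis unfolding e_def ZZ_def by (intro continuous_intros)
      qed
      obtain tc where tc: "tc \<in> {0..r}" "\<And>s. s \<in> {0..r} \<Longrightarrow> e \<tau>s tc \<le> e \<tau>s s"
        using continuous_attains_inf[OF compact_Icc _ econt] r by force
      have "e \<tau>s tc = 0"
      proof (rule ccontr)
        assume "e \<tau>s tc \<noteq> 0"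
        then have pos: "0 < e \<tau>s tc" using nonneg[OF tc(1)] by simp
        \<comment> \<open>Lowering the shift by at most a quarter of the minimal gap costs, by the
          factor 2 in \<open>e_lip\<close>, at most half of that gap, so the curve would still clear
          the graph.\<close>
        define \<tau> where "\<tau> = \<tau>s - min \<tau>s (e \<tau>s tc / 4)"
        have \<tau>: "\<tau> \<in> {0..1/2}" "\<tau> < \<tau>s" "\<bar>\<tau> - \<tau>s\<bar> \<le> e \<tau>s tc / 4" using pos \<tau>s_le big m0 by (auto simp: \<tau>_def)
        have "\<tau> \<in> A" unfolding A_def
        proof safe
          fix s assume s: "s \<in> {0..r}"
          show "0 \<le> e \<tau> s" using abs_le_D2[OF e_lip[OF \<tau>(1) \<tau>sI s]] \<tau>(3) tc(2)[OF s] pos by simp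
        qed (use \<tau> in auto)
        then show False using cInf_lower[OF _ bA] \<tau>(2) unfolding \<tau>s_def by fastforce
      qed
      show False
      proof (rule contact_excluded[OF \<zeta>(1) \<delta>(1) r, of "u x + \<zeta> * \<tau>s" b "W \<tau>s" tc])
        show "lifted_curve r (\<lambda>t. u x + \<zeta> * \<tau>s + b * t + \<zeta> * (\<delta> * (t * (r - t)))) (W \<tau>s)"
          using W(3)[OF \<tau>sI] by (simp add: ZZ_def)
        show "W \<tau>s ` {0..r} \<subseteq> \<Omega>" using W(2)[OF \<tau>sI] R(2) by blast
        show "0 \<le> \<zeta> * (u x + \<zeta> * \<tau>s + b * s + \<zeta> * (\<delta> * (s * (r - s))) - u (W \<tau>s s))" if "s \<in> {0..r}" for s
          using nonneg[OF that] by (simp add: e_def ZZ_def)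
        show "0 < \<zeta> * (u x + \<zeta> * \<tau>s - u (W \<tau>s 0))" "0 < \<zeta> * (u x + \<zeta> * \<tau>s + b * r - u (W \<tau>s r))"
          using e_ends by (simp_all add: e_def ZZ_def)
        show "u x + \<zeta> * \<tau>s + b * tc + \<zeta> * (\<delta> * (tc * (r - tc))) = u (W \<tau>s tc)"
          using \<open>e \<tau>s tc = 0\<close> \<zeta>(2) by (auto simp: e_def ZZ_def)
      qed (rule tc(1))
    qed
    moreover from this have "lifted_curve r (\<lambda>t. u (X t)) X"
      using Xb(3) by (simp add: lifted_curve_def Z_def)
    ultimately show ?thesis using Xb(1,2) by blast
  qed
  then obtain b Y where Y: "\<And>x. x \<in> cball xb R \<Longrightarrow> Y x 0 = x" "\<And>x. x \<in> cball xb R \<Longrightarrow> Y x ` {0..r} \<subseteq> cball xb (2 * R)"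
    "\<And>x. x \<in> cball xb R \<Longrightarrow> lifted_curve r (\<lambda>t. u (Y x t)) (Y x)"
    "\<And>x t. x \<in> cball xb R \<Longrightarrow> t \<in> {0..r} \<Longrightarrow> u (Y x t) = u x + b x * t" by metis
  \<comment> \<open>\<open>b x * r\<close> is the difference of \<open>u\<close> between the end and
    the start of the curve. End points are at most twice as far apart as starting points, which
    gives \<open>2 * l + l\<close>.\<close>
  have lipb: "\<bar>b x - b y\<bar> \<le> 3 * l / r * norm (x - y)" if xy: "x \<in> cball xb R" "y \<in> cball xb R" for x y
  proof -
    have rin: "r \<in> {0..r}" using r by simp
    have "norm (Y x r - Y y r) \<le> 2 * norm (Y x 0 - Y y 0) + 2 * r * 0"
    proof (rule short_time_stability[OF lifted_curveD[OF Y(3)[OF xy(1)]] lifted_curveD[OF Y(3)[OF xy(2)]] _ _ _ rin, where L = "M * (1 + l)"])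
      fix t assume t: "t \<in> {0..r}"
      have in2: "Y x t \<in> cball xb (2 * R)" "Y y t \<in> cball xb (2 * R)" using Y(2) xy t by blast+
      have ub: "\<bar>u (Y x t)\<bar> \<le> B + 1" "\<bar>u (Y y t)\<bar> \<le> B + 1" using B[OF in2(1)] B[OF in2(2)] by auto
      have "norm (speed (Y x t) (u (Y x t)) - speed (Y y t) (u (Y y t))) \<le> M * (norm (Y x t - Y y t) + \<bar>u (Y x t) - u (Y y t)\<bar>)"
        by (rule Sl[OF in2(1) ub(1) in2(2) ub(2)])
      also have "\<dots> \<le> M * (norm (Y x t - Y y t) + l * norm (Y x t - Y y t))"
        using u_diff[OF subsetD[OF R(2) in2(1)] subsetD[OF R(2) in2(2)]] M(1)
        by (intro mult_left_mono add_left_mono) auto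
      finally show "norm (speed (Y x t) (u (Y x t)) - speed (Y y t) (u (Y y t))) \<le> M * (1 + l) * norm (Y x t - Y y t) + 0"
        by (simp add: algebra_simps)
    next
      show "r * (M * (1 + l)) \<le> 1 / 2" unfolding mult.assoc[symmetric] by (rule order_trans[OF M(3)]) simp
    qed (use M l_nonneg in auto)
    then have 1: "norm (Y x r - Y y r) \<le> 2 * norm (x - y)" using Y(1) xy by simp
    have "\<bar>u (Y x r) - u (Y y r)\<bar> \<le> l * (2 * norm (x - y))"
      using u_diff[of "Y x r" "Y y r"] Y(2) xy rin R(2) mult_left_mono[OF 1 l_nonneg] by fastforce
    moreover have "\<bar>u x - u y\<bar> \<le> l * norm (x - y)" using u_diff[of x y] RR(1) xy R(2) by blast
    moreover have "(b x - b y) * r = (u (Y x r) - u (Y y r)) - (u x - u y)"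
      using Y(4)[OF xy(1) rin] Y(4)[OF xy(2) rin] by (simp add: algebra_simps)
    ultimately have "\<bar>(b x - b y) * r\<bar> \<le> 3 * l * norm (x - y)" by linarith
    then have "\<bar>b x - b y\<bar> * r \<le> 3 * l * norm (x - y)" by (simp only: abs_mult abs_of_pos[OF r])
    then have "\<bar>b x - b y\<bar> \<le> 3 * l * norm (x - y) / r" by (simp only: pos_le_divide_eq[OF r])
    then show ?thesis by simp
  qed
  show ?thesis
  proof (rule that[of R r Y b "3 * l / r", OF R(1) r _ Y(1) _ Y(3,4) lipb])
    show "cball xb R \<subseteq> \<Omega>" using RR(1)[of xb] R by auto
    show "Y x t \<in> \<Omega>" if "x \<in> cball xb R" "t \<in> {0..r}" for x t using Y(2)[OF that(1)] that(2) R(2) by blast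
  qed
qed

end

section \<open>Weak derivatives along the characteristics\<close>

context vanishing_viscosity
begin

text \<open>\<open>char_slope x\<close> is \<open>X\<^sub>1 u\<close> at \<open>x\<close>; \<open>Lim\<close> is only used where the limit exists.\<close>
definition char_slope :: "real^2 \<Rightarrow> real" where
  "char_slope x = Lim (at_right 0) (\<lambda>t. (u (x + t *\<^sub>R speed x (u x)) - u x) / t)"

text \<open>Curve and tangent line differ by o(t), and so do the values of a Lipschitz
  \<open>g\<close> on them. Affine behaviour along the curve thus gives the one-sided derivative in
  the straight direction, even where \<open>g\<close> is not differentiable.\<close>

lemma quotient_limit_along_curve:
  fixes g :: "real^2 \<Rightarrow> real"
  assumes g: "C-lipschitz_on (cball x \<rho>) g" and \<rho>: "0 < \<rho>" and X0: "X 0 = x" and r: "0 < r"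
    and X: "(X has_vector_derivative w) (at 0 within {0..r})"
    and aff: "\<And>t. t \<in> {0..r} \<Longrightarrow> g (X t) = g x + b * t"
  shows "((\<lambda>t. (g (x + t *\<^sub>R w) - g x) / t) \<longlongrightarrow> b) (at_right 0)"
proof -
  have wf: "at (0::real) within {0..r} = at_right 0" using r by (simp add: at_within_Icc_at_right)
  have q: "((\<lambda>t. norm (X t - x - t *\<^sub>R w) / norm t) \<longlongrightarrow> 0) (at_right 0)"
    using X unfolding has_vector_derivative_def has_derivative_iff_norm wf by (simp add: X0)
  have lim0: "((\<lambda>t. C * (norm (X t - x - t *\<^sub>R w) / norm t)) \<longlongrightarrow> 0) (at_right 0)"
    using tendsto_mult[OF tendsto_const[of C] q] by simp
  have Xc: "(X \<longlongrightarrow> x) (at_right 0)"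
    using has_vector_derivative_continuous[OF X] X0 by (simp add: continuous_within wf)
  have lc: "((\<lambda>t. x + t *\<^sub>R w) \<longlongrightarrow> x + 0 *\<^sub>R w) (at_right 0)" by (intro tendsto_intros)
  have "eventually (\<lambda>t. \<bar>(g (x + t *\<^sub>R w) - g x) / t - b\<bar> \<le> C * (norm (X t - x - t *\<^sub>R w) / norm t)) (at_right 0)"
  proof -
    have "eventually (\<lambda>t. dist (X t) x < \<rho>) (at_right 0)" using tendstoD[OF Xc \<rho>] .
    moreover have "eventually (\<lambda>t. dist (x + t *\<^sub>R w) x < \<rho>) (at_right 0)" using tendstoD[OF lc \<rho>] by simp
    moreover have "eventually (\<lambda>t. t \<in> {0<..<r}) (at_right 0)" by (rule eventually_at_right_real[OF r])
    ultimately show ?thesis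
    proof eventually_elim
      case (elim t)
      then have t: "0 < t" "t \<in> {0..r}" by auto
      have "dist (g (x + t *\<^sub>R w)) (g (X t)) \<le> C * dist (x + t *\<^sub>R w) (X t)"
        by (rule lipschitz_onD[OF g]) (use elim in \<open>auto simp: dist_commute[of x]\<close>)
      then have "\<bar>g (x + t *\<^sub>R w) - g (X t)\<bar> \<le> C * norm (x + t *\<^sub>R w - X t)"
        by (simp add: dist_norm)
      moreover have "(g (x + t *\<^sub>R w) - g x) / t - b = (g (x + t *\<^sub>R w) - g (X t)) / t"
        unfolding aff[OF t(2)] using t(1) by (simp add: field_simps)
      moreover have "norm (x + t *\<^sub>R w - X t) = norm (X t - x - t *\<^sub>R w)"
        using norm_minus_commute[of "x + t *\<^sub>R w" "X t"] by (simp add: algebra_simps)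
      ultimately show ?case using t(1) by (simp add: abs_divide divide_right_mono)
    qed
  qed
  then have "((\<lambda>t. (g (x + t *\<^sub>R w) - g x) / t - b) \<longlongrightarrow> 0) (at_right 0)"
    by (intro Lim_null_comparison[OF _ lim0]) simp
  then show ?thesis by (simp add: LIM_zero_iff)
qed

lemma X1_eq_if_affine_along_curve:
  fixes g :: "real^2 \<Rightarrow> real"
  assumes g: "C-lipschitz_on (cball x \<rho>) g" and \<rho>: "0 < \<rho>" and X0: "X 0 = x" and r: "0 < r"
    and X: "lifted_curve r (\<lambda>t. u (X t)) X"
    and aff: "\<And>t. t \<in> {0..r} \<Longrightarrow> g (X t) = g x + b * t" and diff: "g differentiable (at x)"
  shows "X1 \<sigma> u g x = b"
proof -
  have d: "(g has_derivative frechet_derivative g (at x)) (at x)"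
    using diff by (simp add: frechet_derivative_works[symmetric])
  let ?w = "speed x (u x)"
  have "(X has_vector_derivative ?w) (at 0 within {0..r})" using lifted_curveD[OF X, of 0] r X0 by simp
  from quotient_limit_along_curve[OF g \<rho> X0 r this aff]
  have "((\<lambda>t. (g (x + t *\<^sub>R ?w) - g x) / t) \<longlongrightarrow> b) (at_right 0)" by blast
  moreover have "((\<lambda>t. (g (x + t *\<^sub>R ?w) - g x) / t) \<longlongrightarrow> frechet_derivative g (at x) ?w) (at_right 0)"
    by (rule has_derivative_directional_limit[OF d])
      (simp add: filterlim_at eventually_at_filter filterlim_ident tendsto_ident_at)
  ultimately have "frechet_derivative g (at x) ?w = b" by (intro tendsto_unique[of "at_right 0"]) auto
  then show ?thesis using has_derivative_pd[OF d, of ?w] by (simp add: X1_def on_graph_eq_lift)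
qed

text \<open>The limit in \<open>char_slope\<close> involves only \<open>u\<close> and the point, so
  slopes found on different curves through \<open>x\<close>, or in different local families,
  agree.\<close>

lemma char_slope_eqI:
  assumes x: "x \<in> \<Omega>" and X0: "X 0 = x" and r: "0 < r" and X: "lifted_curve r (\<lambda>t. u (X t)) X"
    and aff: "\<And>t. t \<in> {0..r} \<Longrightarrow> u (X t) = u x + b * t"
  shows "char_slope x = b"
proof -
  obtain \<rho> where \<rho>: "0 < \<rho>" "cball x \<rho> \<subseteq> \<Omega>" using \<Omega> x open_contains_cball by blast
  have "(X has_vector_derivative speed x (u x)) (at 0 within {0..r})" using lifted_curveD[OF X, of 0] r X0 by simp
  from quotient_limit_along_curve[OF lipschitz_on_subset[OF lip_u \<rho>(2)] \<rho>(1) X0 r this aff]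
  have "((\<lambda>t. (u (x + t *\<^sub>R speed x (u x)) - u x) / t) \<longlongrightarrow> b) (at_right 0)" by blast
  then show ?thesis unfolding char_slope_def by (intro tendsto_Lim) auto
qed

lemma lifted_curve_shift:
  assumes X: "lifted_curve r (\<lambda>t. u (X t)) X" and s: "0 \<le> s" "s < r"
  shows "lifted_curve (r - s) (\<lambda>t. u (X (s + t))) (\<lambda>t. X (s + t))"
  unfolding lifted_curve_def
proof
  fix t assume t: "t \<in> {0..r - s}"
  have "(X has_vector_derivative speed (X (s + t)) (u (X (s + t)))) (at (s + t) within (+) s ` {0..r - s})"
    by (rule has_vector_derivative_within_subset[OF lifted_curveD[OF X]]) (use t s in auto)
  moreover have "((\<lambda>t. s + t) has_vector_derivative 1) (at t within {0..r - s})"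
    by (auto intro!: derivative_eq_intros)
  ultimately have "(X \<circ> (+) s has_vector_derivative 1 *\<^sub>R speed (X (s + t)) (u (X (s + t)))) (at t within {0..r - s})"
    by (intro vector_diff_chain_within)
  then show "((\<lambda>t. X (s + t)) has_vector_derivative speed (X (s + t)) (u (X (s + t)))) (at t within {0..r - s})"
    by (simp add: comp_def)
qed

text \<open>The remainder of a characteristic is a characteristic with the same slope, so
  \<open>char_slope\<close> is constant along it.\<close>

lemma char_slope_local:
  assumes x: "xb \<in> \<Omega>"
  obtains R C where "0 < R" "cball xb R \<subseteq> \<Omega>" "C-lipschitz_on (cball xb R) char_slope"
    "\<And>y. y \<in> cball xb R \<Longrightarrow> \<exists>r X. 0 < r \<and> X 0 = y \<and> lifted_curve r (\<lambda>t. u (X t)) X \<and>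
      (\<forall>t\<in>{0..r}. u (X t) = u y + char_slope y * t) \<and> (\<forall>t\<in>{0..r}. char_slope (X t) = char_slope y)"
proof -
  obtain R r C b Y where R: "0 < R" and r: "0 < r" and sub: "cball xb R \<subseteq> \<Omega>"
    and Y0: "\<And>x. x \<in> cball xb R \<Longrightarrow> Y x 0 = x"
    and Y\<Omega>: "\<And>x t. x \<in> cball xb R \<Longrightarrow> t \<in> {0..r} \<Longrightarrow> Y x t \<in> \<Omega>"
    and Yc: "\<And>x. x \<in> cball xb R \<Longrightarrow> lifted_curve r (\<lambda>t. u (Y x t)) (Y x)"
    and Ya: "\<And>x t. x \<in> cball xb R \<Longrightarrow> t \<in> {0..r} \<Longrightarrow> u (Y x t) = u x + b x * t"
    and lb: "\<And>x y. x \<in> cball xb R \<Longrightarrow> y \<in> cball xb R \<Longrightarrow> \<bar>b x - b y\<bar> \<le> C * norm (x - y)"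
    by (rule characteristics_local[OF x]) (rule that, assumption+)
  have bs: "char_slope y = b y" if y: "y \<in> cball xb R" for y
    by (rule char_slope_eqI[OF _ Y0[OF y] r Yc[OF y] Ya[OF y]]) (use y sub in auto)
  show ?thesis
  proof (rule that[OF R sub])
    show "\<bar>C\<bar>-lipschitz_on (cball xb R) char_slope"
    proof (rule lipschitz_onI)
      fix y w assume yw: "y \<in> cball xb R" "w \<in> cball xb R"
      have "C * norm (y - w) \<le> \<bar>C\<bar> * norm (y - w)" by (intro mult_right_mono) auto
      then show "dist (char_slope y) (char_slope w) \<le> \<bar>C\<bar> * dist y w"
        using lb[OF yw] unfolding bs[OF yw(1)] bs[OF yw(2)] dist_norm by simp
    qed simp
    fix y assume y: "y \<in> cball xb R"
    \<comment> \<open>Halving the time leaves each point of the curve a remainder of positive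
      length.\<close>
    have const: "char_slope (Y y t) = char_slope y" if t: "t \<in> {0..r/2}" for t
    proof -
      have tr: "0 \<le> t" "t < r" "t \<in> {0..r}" using t r by auto
      have "char_slope (Y y t) = b y"
      proof (rule char_slope_eqI[OF Y\<Omega>[OF y tr(3)], where X = "\<lambda>s. Y y (t + s)" and r = "r - t"])
        show "lifted_curve (r - t) (\<lambda>s. u (Y y (t + s))) (\<lambda>s. Y y (t + s))" by (rule lifted_curve_shift[OF Yc[OF y] tr(1,2)])
        show "u (Y y (t + s)) = u (Y y t) + b y * s" if "s \<in> {0..r - t}" for s
          using Ya[OF y tr(3)] Ya[OF y, of "t + s"] that tr by (simp add: algebra_simps)
      qed (use tr in auto)
      then show ?thesis using bs[OF y] by simp
    qed
    have "lifted_curve (r/2) (\<lambda>t. u (Y y t)) (Y y)"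
      unfolding lifted_curve_def
      by (intro ballI has_vector_derivative_within_subset[OF lifted_curveD[OF Yc[OF y]]]) (use r in auto)
    then show "\<exists>r X. 0 < r \<and> X 0 = y \<and> lifted_curve r (\<lambda>t. u (X t)) X \<and>
      (\<forall>t\<in>{0..r}. u (X t) = u y + char_slope y * t) \<and> (\<forall>t\<in>{0..r}. char_slope (X t) = char_slope y)"
      using Y0[OF y] Ya[OF y] const bs[OF y] r by (intro exI[of _ "r/2"] exI[of _ "Y y"]) auto
  qed
qed

lemma char_slope_lipschitz_compact:
  assumes K: "compact K" "K \<subseteq> \<Omega>"
  shows "\<exists>L. L-lipschitz_on K char_slope"
proof -
  \<comment> \<open>The notion carries a time parameter, here the single time \<open>0\<close>; it
    supplies the passage from balls to compact sets, which need not be convex.\<close>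
  have "local_lipschitz {0::real} \<Omega> (\<lambda>_. char_slope)"
  proof (rule local_lipschitzI)
    fix t :: real and x assume "x \<in> \<Omega>"
    then obtain R C where R: "0 < R" "C-lipschitz_on (cball x R) char_slope" using char_slope_local[of x] by metis
    then have "\<forall>t\<in>cball t R \<inter> {0}. C-lipschitz_on (cball x R \<inter> \<Omega>) char_slope"
      by (intro ballI lipschitz_on_subset[OF R(2)]) auto
    then show "\<exists>u>0. \<exists>L. \<forall>t\<in>cball t u \<inter> {0}. L-lipschitz_on (cball x u \<inter> \<Omega>) char_slope" using R(1) by blast
  qed
  then have "local_lipschitz {0::real} K (\<lambda>_. char_slope)" by (rule local_lipschitz_subset) (use K in auto)
  then obtain L where "\<And>t. t \<in> {0::real} \<Longrightarrow> L-lipschitz_on K char_slope"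
    by (rule local_lipschitz_compact_implies_lipschitz) (use K in auto)
  then show ?thesis by blast
qed

section \<open>Iterated weak derivatives\<close>

lemma weak_X1_u: "weak_X1 \<sigma> \<Omega> u u char_slope"
proof (rule weak_X1_I[OF \<Omega> \<sigma> _ _ continuous_on_if_lipschitz_on_compact[OF \<Omega> char_slope_lipschitz_compact]])
  show "\<exists>L. L-lipschitz_on K u" if "K \<subseteq> \<Omega>" for K using lipschitz_on_subset[OF lip_u that] by blast
  then show "\<exists>L. L-lipschitz_on K u" if "K \<subseteq> \<Omega>" for K using that by blast
  fix x assume x: "x \<in> \<Omega>" "u differentiable (at x)"
  obtain R where R: "0 < R" "cball x R \<subseteq> \<Omega>" and
    "\<exists>r X. 0 < r \<and> X 0 = x \<and> lifted_curve r (\<lambda>t. u (X t)) X \<and> (\<forall>t\<in>{0..r}. u (X t) = u x + char_slope x * t)"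
    using char_slope_local[OF x(1)] by (metis centre_in_cball less_imp_le)
  then show "X1 \<sigma> u u x = char_slope x"
    using X1_eq_if_affine_along_curve[OF lipschitz_on_subset[OF lip_u R(2)] R(1)] x(2) by blast
qed

text \<open>\<open>char_slope\<close> is affine with slope zero along characteristics, so its
  derivative along the field vanishes wherever it is differentiable.\<close>

lemma weak_X1_char_slope: "weak_X1 \<sigma> \<Omega> u char_slope (\<lambda>_. 0)"
proof (rule weak_X1_I[OF \<Omega> \<sigma> _ char_slope_lipschitz_compact continuous_on_const])
  show "\<exists>L. L-lipschitz_on K u" if "K \<subseteq> \<Omega>" for K using lipschitz_on_subset[OF lip_u that] by blast
  fix x assume x: "x \<in> \<Omega>" "char_slope differentiable (at x)"
  obtain R C where R: "0 < R" "C-lipschitz_on (cball x R) char_slope" and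
    "\<exists>r X. 0 < r \<and> X 0 = x \<and> lifted_curve r (\<lambda>t. u (X t)) X \<and> (\<forall>t\<in>{0..r}. char_slope (X t) = char_slope x)"
    using char_slope_local[OF x(1)] by (metis centre_in_cball less_imp_le)
  then obtain r X where X: "0 < r" "X 0 = x" "lifted_curve r (\<lambda>t. u (X t)) X" "\<forall>t\<in>{0..r}. char_slope (X t) = char_slope x" by blast
  show "X1 \<sigma> u char_slope x = 0"
    by (rule X1_eq_if_affine_along_curve[OF R(2,1) X(2,1,3) _ x(2)]) (use X(4) in simp)
qed

lemma weak_X1_zero: "weak_X1 \<sigma> \<Omega> u (\<lambda>_. 0) (\<lambda>_. 0)"
  by (simp add: weak_X1_def L1_loc_def set_integrable_def set_lebesgue_integral_def)

lemma holder_loc_if_lipschitz: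
  assumes lip: "\<And>K. compact K \<Longrightarrow> K \<subseteq> \<Omega> \<Longrightarrow> \<exists>L. L-lipschitz_on K f" and \<alpha>: "0 < \<alpha>" "\<alpha> < 1"
  shows "f \<in> holder_loc \<alpha> \<Omega>"
  unfolding holder_loc_def
proof safe
  fix K assume K: "compact K" "K \<subseteq> \<Omega>"
  obtain L where L: "L-lipschitz_on K f" using lip[OF K] by blast
  \<comment> \<open>The distance is split into powers \<open>1 - \<alpha>\<close> and
    \<open>\<alpha>\<close>, and the first factor is bounded by means of the diameter.\<close>
  define D where "D = diameter K powr (1 - \<alpha>)"
  show "\<exists>C. \<forall>x\<in>K. \<forall>y\<in>K. \<bar>f x - f y\<bar> \<le> C * dist x y powr \<alpha>"
  proof (intro exI ballI)
    fix x y assume xy: "x \<in> K" "y \<in> K"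
    have "dist x y \<le> diameter K" using diameter_bounded_bound[OF compact_imp_bounded[OF K(1)] xy] .
    then have "dist x y powr (1 - \<alpha>) \<le> D" unfolding D_def using \<alpha> by (intro powr_mono2) auto
    then have "dist x y powr (1 - \<alpha>) * dist x y powr \<alpha> \<le> D * dist x y powr \<alpha>" by (intro mult_right_mono) auto
    moreover have "dist x y powr (1 - \<alpha>) * dist x y powr \<alpha> = dist x y" by (simp flip: powr_add)
    ultimately have "L * dist x y \<le> L * (D * dist x y powr \<alpha>)"
      using lipschitz_on_nonneg[OF L] by (intro mult_left_mono) auto
    then show "\<bar>f x - f y\<bar> \<le> (L * D) * dist x y powr \<alpha>"
      using lipschitz_onD[OF L xy] by (simp add: dist_real_def mult.assoc)
  qed
qed

lemma weak_X1_pow_zero: "weak_X1_pow \<sigma> \<Omega> u (Suc (Suc k)) (\<lambda>_. 0)"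
proof (induction k)
  case 0
  then show ?case using weak_X1_u weak_X1_char_slope by auto
next
  case (Suc k)
  then show ?case using weak_X1_zero weak_X1_pow.simps(2) by blast
qed

lemma weak_X1_pow_regular:
  assumes "0 < k" "0 < \<alpha>" "\<alpha> < 1"
  shows "\<exists>w. weak_X1_pow \<sigma> \<Omega> u k w \<and> w \<in> holder_loc \<alpha> \<Omega>"
proof (cases "k = 1")
  case True
  have "weak_X1_pow \<sigma> \<Omega> u 1 char_slope" using weak_X1_u by simp
  then show ?thesis using holder_loc_if_lipschitz[OF char_slope_lipschitz_compact assms(2,3)] True by blast
next
  case False
  then obtain j where j: "k = Suc (Suc j)" using assms(1) by (metis One_nat_def gr0_implies_Suc not0_implies_Suc)
  have "(\<lambda>_. 0) \<in> holder_loc \<alpha> \<Omega>"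
    by (rule holder_loc_if_lipschitz[OF _ assms(2,3)]) (auto intro: lipschitz_on_constant)
  then show ?thesis using weak_X1_pow_zero[of j] j by blast
qed

end

lemma Lip_norm_le_imp_lipschitz_on:
  fixes f :: "'a::euclidean_space \<Rightarrow> real"
  assumes "Lip_norm S f \<le> ennreal l" "0 \<le> l"
  shows "l-lipschitz_on S f"
proof (rule lipschitz_onI)
  fix x y assume xy: "x \<in> S" "y \<in> S"
  show "dist (f x) (f y) \<le> l * dist x y"
  proof (cases "x = y")
    case False
    have "ennreal (\<bar>f x - f y\<bar> / dist x y) \<le>
        (SUP (x, y)\<in>{(x, y). x \<in> S \<and> y \<in> S \<and> x \<noteq> y}. ennreal (\<bar>f x - f y\<bar> / dist x y))"
      by (rule SUP_upper2[of "(x, y)"]) (use xy False in auto)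
    also have "\<dots> \<le> Lip_norm S f" unfolding Lip_norm_def by (rule add_increasing) auto
    also have "\<dots> \<le> ennreal l" by (rule assms(1))
    finally have "\<bar>f x - f y\<bar> / dist x y \<le> l" using assms(2) by (simp add: ennreal_le_iff)
    then show ?thesis using False by (simp add: dist_real_def field_simps)
  qed simp
qed (rule assms(2))

theorem theorem1p2:
  fixes \<Omega> :: "(real^2) set"
    and \<sigma> :: "2 \<Rightarrow> real^3 \<Rightarrow> real"
    and u :: "real^2 \<Rightarrow> real"
  assumes "open \<Omega>"
    and "\<forall>j. smooth_on UNIV (\<sigma> j)"
    and "\<forall>p. \<bar>\<sigma> 1 p * \<sigma>2 \<sigma> 2 p - \<sigma> 2 p * \<sigma>2 \<sigma> 1 p\<bar> > 0"
    and "u \<in> Lip \<Omega>"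
    and "vanishing_viscosity_solution \<sigma> \<Omega> u"
  shows "\<forall>(k::nat) (\<alpha>::real). k > 0 \<and> 0 < \<alpha> \<and> \<alpha> < 1 \<longrightarrow>
           (\<exists>w. weak_X1_pow \<sigma> \<Omega> u k w \<and> w \<in> holder_loc \<alpha> \<Omega>)"
proof -
  from assms(5) obtain \<epsilon> v l where *: "\<epsilon> \<longlonglongrightarrow> 0" "\<forall>n. smooth_on \<Omega> (v n)"
    "\<forall>n. \<forall>x\<in>\<Omega>. L_op \<sigma> (\<epsilon> n) (v n) x = 0" "0 < l" "\<forall>n. Lip_norm \<Omega> (v n) \<le> ennreal l"
    "\<forall>K. compact K \<and> K \<subseteq> \<Omega> \<longrightarrow> uniform_limit K v u sequentially"
    unfolding vanishing_viscosity_solution_def by (elim conjE exE) (rule that, assumption+)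
  interpret vanishing_viscosity \<sigma> \<Omega> u v \<epsilon> l
    using assms(1,2) * Lip_norm_le_imp_lipschitz_on[OF *(5)[rule_format]] by unfold_locales auto
  show ?thesis using weak_X1_pow_regular by blast
qed

end
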